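(* As $n\to\infty$, the processes $\left(\overline{Q(S_n)}(t),\ t\in[0,1]\right)$ almost surely converge uniformly on $[0,1]$ to $(Q(B)(t),\ t\in[0,1])$, where $S_n$ are the simple random walks embedded in a standard Brownian motion $B$.
   Context: Let $B=(B(t),t\ge0)$ be a standard real-valued Brownian motion. Quantile transform of Brownian motion. Let $\ell(a)=\ell_1(a)$ be an a.s. continuous (in $a$) version of the occupation density local time of $B$ at level $a$ up to time $1$: $\ell(a)=\lim_{\epsilon\downarrow0}\frac1{2\epsilon}\int_0^1\mathbf 1\{|B(s)-a|<\epsilon\}\,ds$. Let $F(a)=\int_{-\infty}^a\ell(y)\,dy=\mathrm{Leb}\{s\in[0,1]:B(s)\le a\}$, $A(s)=\inf\{a:F(a)>s\}$ for $s\in[0,1)$ and $A(1)=\max_{s\in[0,1]}B(s)$. With $(c)_+=\max(c,0)$, define for $t\in[0,1]$ $$Q(B)(t)=\tfrac12\ell(A(t))+(A(t))_+-(A(t)-B(1))_+.$$ Embedded walks. For $n\ge1$ let $\tau_n(0)=0$ and $\tau_n(j)=\inf\{t>\tau_n(j-1): B(t)-B(\tau_n(j-1))=\pm2^{-n}\}$ for $j\in\{1,\dots,4^n\}$. Set $S_n(j)=2^nB(\tau_n(j))$, $j\in\{0,\dots,4^n\}$; $S_n$ is a simple walk of length $4^n$. Quantile transform of a walk. For a walk $w:\{0,\dots,N\}\to\mathbb R$, $w(0)=0$, with increments $x_i=w(i)-w(i-1)$, let $\phi_w$ be the unique permutation of $\{1,\dots,N\}$ such that $(w(\phi_w(1)-1),\phi_w(1)-1),\dots,(w(\phi_w(N)-1),\phi_w(N)-1)$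 is the increasing lexicographic reordering of $(w(0),0),\dots,(w(N-1),N-1)$. Put $Q(w)(j)=\sum_{i=1}^jx_{\phi_w(i)}$ for $0\le j\le N$. Rescaling: $\overline{Q(S_n)}(t)=2^{-n}Q(S_n)([4^nt])$ for $t\in[0,1]$, where $[\cdot]$ is the integer part. *)

theory Defs
  imports "HOL-Probability.Probability" "HOL-Combinatorics.Permutations"
begin

text \<open>
  The index set of the process is \<open>{0..}\<close>; the values \<open>B t\<close> for \<open>t < 0\<close> are irrelevant.
  Both \<open>B 0 = 0\<close> and continuity of the paths are required only almost surely.
\<close>

definition standard_brownian_motion :: "'a measure \<Rightarrow> (real \<Rightarrow> 'a \<Rightarrow> real) \<Rightarrow> bool" where
  "standard_brownian_motion M B \<longleftrightarrow>
     prob_space M \<and>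
     (\<forall>t\<ge>0. B t \<in> borel_measurable M) \<and>
     (AE \<omega> in M. B 0 \<omega> = 0) \<and>
     (\<forall>s t. 0 \<le> s \<and> s < t \<longrightarrow>
        distributed M lborel (\<lambda>\<omega>. B t \<omega> - B s \<omega>) (normal_density 0 (sqrt (t - s)))) \<and>
     (\<forall>(k::nat) (u::nat \<Rightarrow> real). 0 \<le> u 0 \<and> (\<forall>i<k. u i \<le> u (Suc i)) \<longrightarrow>
        prob_space.indep_vars M (\<lambda>_. borel) (\<lambda>i \<omega>. B (u (Suc i)) \<omega> - B (u i) \<omega>) {..<k}) \<and>
     (AE \<omega> in M. continuous_on {0..} (\<lambda>t. B t \<omega>))"

text \<open>
  A process \<open>l\<close> indexed by the level is an almost surely continuous version of the
  occupation density local time up to time 1. The limit is only required to hold almost surely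
  for each fixed level; by continuity this determines \<open>l\<close> up to indistinguishability.
\<close>

definition continuous_local_time ::
    "'a measure \<Rightarrow> (real \<Rightarrow> 'a \<Rightarrow> real) \<Rightarrow> (real \<Rightarrow> 'a \<Rightarrow> real) \<Rightarrow> bool" where
  "continuous_local_time M B l \<longleftrightarrow>
     (AE \<omega> in M. continuous_on UNIV (\<lambda>a. l a \<omega>)) \<and>
     (\<forall>a. AE \<omega> in M.
        ((\<lambda>\<epsilon>. 1 / (2 * \<epsilon>) * (LBINT s:{0..1}. indicator {x. \<bar>x - a\<bar> < \<epsilon>} (B s \<omega>)))
           \<longlongrightarrow> l a \<omega>) (at_right 0))"

text \<open>
  From here on everything is defined path by path: \<open>b\<close> is a path of the Brownian motion and
  \<open>l\<close> its local time profile.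
\<close>

definition occupation_cdf :: "(real \<Rightarrow> real) \<Rightarrow> real \<Rightarrow> real" where
  "occupation_cdf l a = (LBINT y:{..a}. l y)"

definition quantile_level :: "(real \<Rightarrow> real) \<Rightarrow> (real \<Rightarrow> real) \<Rightarrow> real \<Rightarrow> real" where
  "quantile_level b l s =
     (if s < 1 then Inf {a. occupation_cdf l a > s} else Sup (b ` {0..1}))"

definition quantile_transform :: "(real \<Rightarrow> real) \<Rightarrow> (real \<Rightarrow> real) \<Rightarrow> real \<Rightarrow> real" where
  "quantile_transform b l t =
     l (quantile_level b l t) / 2 + max (quantile_level b l t) 0
       - max (quantile_level b l t - b 1) 0"

primrec embedding_time :: "(real \<Rightarrow> real) \<Rightarrow> nat \<Rightarrow> nat \<Rightarrow> real" where
  "embedding_time b n 0 = 0"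
| "embedding_time b n (Suc j) =
     Inf {t. t > embedding_time b n j \<and>
             b t - b (embedding_time b n j) \<in> {1 / 2 ^ n, - (1 / 2 ^ n)}}"

definition embedded_walk :: "(real \<Rightarrow> real) \<Rightarrow> nat \<Rightarrow> nat \<Rightarrow> real" where
  "embedded_walk b n j = 2 ^ n * b (embedding_time b n j)"

text \<open>
  A walk of length \<open>N\<close> is given by a function on \<open>nat\<close> of which only the values on
  \<open>{0..N}\<close> matter. The lexicographic order on pairs is spelled out, since the order instance
  on products available here may be the componentwise one.
\<close>

definition lex_less :: "real \<times> nat \<Rightarrow> real \<times> nat \<Rightarrow> bool" where
  "lex_less x y \<longleftrightarrow> fst x < fst y \<or> (fst x = fst y \<and> snd x < snd y)"

definition is_quantile_perm :: "(nat \<Rightarrow> real) \<Rightarrow> nat \<Rightarrow> (nat \<Rightarrow> nat) \<Rightarrow> bool" where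
  "is_quantile_perm w N p \<longleftrightarrow>
     p permutes {1..N} \<and>
     (\<forall>i\<in>{1..N}. \<forall>j\<in>{1..N}. i < j \<longrightarrow>
        lex_less (w (p i - 1), p i - 1) (w (p j - 1), p j - 1))"

definition quantile_perm :: "(nat \<Rightarrow> real) \<Rightarrow> nat \<Rightarrow> nat \<Rightarrow> nat" where
  "quantile_perm w N = (THE p. is_quantile_perm w N p)"

lemma ex1_quantile_perm: "\<exists>!p. is_quantile_perm w N p"
proof -
  define lt where "lt i j \<longleftrightarrow> lex_less (w (i - 1), i - 1) (w (j - 1), j - 1)" for i j
  define r where "r i = Suc (card {k\<in>{1..N}. lt k i})" for i
  have irr: "\<not> lt i i" for i by (auto simp: lt_def lex_less_def)
  have tr: "lt i j \<Longrightarrow> lt j k \<Longrightarrow> lt i k" for i j k by (auto simp: lt_def lex_less_def)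
  have tot: "lt i j \<or> lt j i" if "i \<in> {1..N}" "j \<in> {1..N}" "i \<noteq> j" for i j
    using that by (auto simp: lt_def lex_less_def)
  have mono: "r i < r j" if "i \<in> {1..N}" "lt i j" for i j
  proof -
    have "{k\<in>{1..N}. lt k i} \<subset> {k\<in>{1..N}. lt k j}" using that tr irr by blast
    then show ?thesis unfolding r_def by (simp add: psubset_card_mono)
  qed
  have inj: "inj_on r {1..N}" by (rule inj_onI) (metis tot mono less_irrefl)
  have "r i \<in> {1..N}" if "i \<in> {1..N}" for i
  proof -
    have "{k\<in>{1..N}. lt k i} \<subset> {1..N}" using that irr by blast
    from psubset_card_mono[OF _ this] show ?thesis by (simp add: r_def)
  qed
  then have im: "r ` {1..N} = {1..N}"
    using inj by (intro endo_inj_surj) auto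
  define q where "q i = (if i \<in> {1..N} then r i else i)" for i
  have "bij_betw q {1..N} {1..N}"
    using inj im by (subst bij_betw_cong[of _ q r]) (auto simp: q_def bij_betw_def)
  then have q: "q permutes {1..N}"
    by (rule bij_imp_permutes) (auto simp: q_def)
  define p where "p = inv q"
  have p: "p permutes {1..N}" unfolding p_def by (rule permutes_inv[OF q])
  have rp: "r (p i) = i" if "i \<in> {1..N}" for i
  proof -
    have "p i \<in> {1..N}" using permutes_in_image[OF p] that by blast
    then have "r (p i) = q (p i)" by (simp add: q_def)
    then show ?thesis by (simp add: p_def permutes_inverses[OF q])
  qed
  have iff: "is_quantile_perm w N p' \<longleftrightarrow> p' permutes {1..N} \<and>
      (\<forall>i\<in>{1..N}. \<forall>j\<in>{1..N}. i < j \<longrightarrow> lt (p' i) (p' j))" for p'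
    by (simp add: is_quantile_perm_def lt_def)
  show ?thesis
  proof (rule ex1I[of _ p])
    have "lt (p i) (p j)" if ij: "i \<in> {1..N}" "j \<in> {1..N}" "i < j" for i j
    proof (rule ccontr)
      assume n: "\<not> lt (p i) (p j)"
      have m: "p i \<in> {1..N}" "p j \<in> {1..N}" using permutes_in_image[OF p] ij by blast+
      have "p i \<noteq> p j" using rp ij by (metis less_irrefl)
      then have "lt (p j) (p i)" using tot m n by blast
      then have "j < i" using mono[OF m(2)] rp ij by metis
      then show False using ij by simp
    qed
    then show "is_quantile_perm w N p" unfolding iff using p by blast
  next
    fix p' assume "is_quantile_perm w N p'"
    then have p': "p' permutes {1..N}"
      and ord: "\<And>i j. i \<in> {1..N} \<Longrightarrow> j \<in> {1..N} \<Longrightarrow> i < j \<Longrightarrow> lt (p' i) (p' j)"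
      unfolding iff by blast+
    show "p' = p"
    proof
      fix i show "p' i = p i"
      proof (cases "i \<in> {1..N}")
        case False
        then show ?thesis using permutes_not_in[OF p] permutes_not_in[OF p'] by simp
      next
        case i: True
        have "{k\<in>{1..N}. lt k (p' i)} = p' ` {1..<i}"
        proof (intro set_eqI iffI)
          fix k assume k: "k \<in> {k\<in>{1..N}. lt k (p' i)}"
          then have "k \<in> p' ` {1..N}" using permutes_image[OF p'] by simp
          then obtain j where j: "j \<in> {1..N}" "k = p' j" by blast
          have "j < i"
          proof (rule ccontr)
            assume "\<not> j < i"
            then have "i = j \<or> lt (p' i) (p' j)" using ord[OF i j(1)] by linarith
            then show False using k j irr tr by blast
          qed
          then show "k \<in> p' ` {1..<i}" using j by auto
        next
          fix k assume "k \<in> p' ` {1..<i}"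
          then obtain j where j: "j \<in> {1..<i}" "k = p' j" by blast
          then have jN: "j \<in> {1..N}" using i by auto
          have "p' j \<in> {1..N}" using permutes_in_image[OF p'] jN by blast
          then show "k \<in> {k\<in>{1..N}. lt k (p' i)}" using ord[OF jN i] j by simp
        qed
        moreover have "card (p' ` {1..<i}) = i - 1"
          using permutes_inj_on[OF p'] by (simp add: card_image)
        ultimately have "r (p' i) = i" using i by (simp add: r_def)
        then have "r (p' i) = r (p i)" using rp i by simp
        moreover have "p' i \<in> {1..N}" "p i \<in> {1..N}"
          using permutes_in_image[OF p] permutes_in_image[OF p'] i by blast+
        ultimately show ?thesis using inj by (auto dest: inj_onD)
      qed
    qed
  qed
qed

definition walk_quantile_transform :: "(nat \<Rightarrow> real) \<Rightarrow> nat \<Rightarrow> nat \<Rightarrow> real" where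
  "walk_quantile_transform w N j =
     (\<Sum>i=1..j. w (quantile_perm w N i) - w (quantile_perm w N i - 1))"

definition rescaled_walk_quantile_transform :: "(real \<Rightarrow> real) \<Rightarrow> nat \<Rightarrow> real \<Rightarrow> real" where
  "rescaled_walk_quantile_transform b n t =
     1 / 2 ^ n * walk_quantile_transform (embedded_walk b n) (4 ^ n) (nat \<lfloor>4 ^ n * t\<rfloor>)"

end

theory Submission
  imports Defs
begin

text \<open>
  Discrete Tanaka formulas turn the quantile transform of the walk at the visit to a level \<open>a\<close> into
  half of the rescaled number of visits to \<open>a\<close>, plus \<open>min (S\<^sub>n(4\<^sup>n)) a - min 0 a\<close>, plus a martingale
  indexed by the visits to \<open>a\<close>. So everything rests on the uniform convergence of the rescaled visit
  counts, and this is obtained without a strong Markov property. For a step function \<open>h\<close> that is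
  constant between embedding times, an exponential inequality for \<open>\<integral> h dW\<close> and an \<open>L\<^sup>2\<close> bound for
  \<open>2 \<integral> h (W - W\<^sub>\<tau>) dW\<close> follow from the same statements on dyadic time grids, where only the
  independence of the next increment from the past is used, and Fatou's lemma. The \<open>L\<^sup>2\<close> bound
  shows that embedding steps take the time \<open>4\<^sup>-\<^sup>n\<close> on average, simultaneously below all levels of a
  fine grid; hence the occupation measure of the walk is geometrically close to that of the path. The
  exponential inequality and Borel-Cantelli bound the oscillation of the visit counts over windows of
  geometrically small length. Therefore the visit counts are close to difference quotients of the
  occupation distribution function \<open>F\<close> of the path, which are uniformly Cauchy; the limit is
  continuous, is the density of the occupation measure, and thus is the local time. Finally \<open>F\<close> is
  strictly increasing on the range of the path, so its inverse, the quantile level, is uniformly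
  continuous and the level reached by the walk at time \<open>t\<close> converges to it uniformly.
\<close>

section \<open>Exit times of a path\<close>

text \<open>The obstacle is a circularity. The exponential inequality bounds a martingale only in
  terms of the real time during which its integrand is nonzero. So the variation of the visit counts
  over a window of levels needs the time spent in that window, which is what the visit counts should
  give. The circle is broken by using the inequality first with parameter 1: the total time is at
  most 2, so every rescaled visit count is crudely at most \<open>P n\<close>, linear in
  \<open>n\<close>. Hence the occupation function of the walk is nearly Lipschitz, short windows
  take little time, and the inequality with the growing parameter \<open>(16 / 15) ^ n\<close> then
  gives the true oscillation. The union bounds also differ: Chebyshev affords only about
  \<open>(3 / 2) ^ n\<close> levels, the exponential inequality all pairs of the
  \<open>2 * 4 ^ n + 1\<close> lattice levels. Probability ends with \<open>walk_bounds\<close>;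
  afterwards a single path is fixed.\<close>

lemma embedding_time_cong:
  assumes "\<And>t. 0 \<le> t \<Longrightarrow> b t = b' t"
    and "\<And>j. 0 \<le> embedding_time b' n j"
  shows "embedding_time b n j = embedding_time b' n j"
proof (induction j)
  case (Suc j)
  have "{t. t > embedding_time b n j \<and> b t - b (embedding_time b n j) \<in> {1 / 2 ^ n, - (1 / 2 ^ n)}}
      = {t. t > embedding_time b' n j \<and> b' t - b' (embedding_time b' n j) \<in> {1 / 2 ^ n, - (1 / 2 ^ n)}}"
    using assms(2)[of j] by (intro Collect_cong) (auto simp: Suc assms(1))
  then show ?case by (simp only: embedding_time.simps)
qed simp

text \<open>Unboundedness makes every exit time finite: the infimum in \<open>embedding_time\<close>
  is never taken over the empty set.\<close>

locale unbounded_path =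
  fixes b :: "real \<Rightarrow> real"
  assumes cont: "continuous_on UNIV b"
    and start: "b 0 = 0"
    and unb: "\<And>K. \<exists>t\<ge>0. K < \<bar>b t\<bar>"
begin

text \<open>By the intermediate value theorem, a path at distance at least \<open>e\<close> from
  \<open>b x\<close> has been at distance exactly \<open>e\<close> before. The set of such times is
  closed, so its infimum is attained.\<close>

lemma
  assumes x: "0 \<le> x" and e: "0 < e"
  defines "T \<equiv> Inf {t. t > x \<and> b t - b x \<in> {e, - e}}"
  shows exit_time_gt: "x < T" and exit_time_diff: "b T - b x \<in> {e, - e}"
    and exit_time_before: "\<And>s. x \<le> s \<Longrightarrow> s < T \<Longrightarrow> \<bar>b s - b x\<bar> < e"
proof -
  define V where "V s = \<bar>b s - b x\<bar>" for s
  have V: "continuous_on A V" for A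
    unfolding V_def by (intro continuous_intros continuous_on_subset[OF cont]) auto
  define A where "A = {t. x \<le> t \<and> V t = e}"
  have A: "{t. t > x \<and> b t - b x \<in> {e, - e}} = A"
    unfolding A_def V_def using e by (auto simp: abs_if order_less_le split: if_splits)
  have ivt: "\<exists>s\<in>A. s \<le> t" if t: "x \<le> t" "e \<le> V t" for t
  proof -
    have "\<exists>s. x \<le> s \<and> s \<le> t \<and> V s = e"
      by (rule IVT'[OF _ t(2,1) V]) (use e in \<open>simp add: V_def\<close>)
    then show ?thesis unfolding A_def by auto
  qed
  \<comment> \<open>Unboundedness yields a far value at some time, which must lie after
    \<open>x\<close>. Since \<open>K\<close> bounds the path up to \<open>x\<close>, a value beyond
    \<open>K + \<bar>b x\<bar> + e\<close> is taken only later.\<close>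
  have "bounded (b ` {0..x})"
    by (intro compact_imp_bounded compact_continuous_image continuous_on_subset[OF cont]) auto
  then obtain K where K: "\<And>s. 0 \<le> s \<Longrightarrow> s \<le> x \<Longrightarrow> \<bar>b s\<bar> \<le> K"
    unfolding bounded_iff by fastforce
  obtain t where t: "0 \<le> t" "K + \<bar>b x\<bar> + e < \<bar>b t\<bar>" using unb by blast
  have "x \<le> t"
  proof (rule ccontr)
    assume "\<not> x \<le> t"
    then show False using K[of t] t e by auto
  qed
  moreover have "0 \<le> K" using K[of 0] x by force
  ultimately have ne: "A \<noteq> {}" using ivt[of t] t unfolding V_def by fastforce
  have bdd: "bdd_below A" unfolding A_def by (auto intro: bdd_belowI[of _ x])
  have "A = {x..} \<inter> V -` {e}" unfolding A_def by auto
  moreover have "closed ({x..} \<inter> V -` {e})"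
    by (intro continuous_closed_preimage V) auto
  ultimately have "closed A" by simp
  then have T: "T \<in> A" unfolding T_def A using ne bdd by (intro closed_contains_Inf)
  have TA: "T \<in> {t. t > x \<and> b t - b x \<in> {e, - e}}" using T A by blast
  show "x < T" "b T - b x \<in> {e, - e}" using TA by auto
  fix s assume s: "x \<le> s" "s < T"
  show "\<bar>b s - b x\<bar> < e"
  proof (rule ccontr)
    assume "\<not> \<bar>b s - b x\<bar> < e"
    then obtain u where "u \<in> A" "u \<le> s" using ivt[of s] s unfolding V_def by auto
    then have "T \<le> s" using bdd unfolding T_def A by (meson cInf_lower order_trans)
    then show False using s by simp
  qed
qed

abbreviation T :: "nat \<Rightarrow> nat \<Rightarrow> real" where "T n j \<equiv> embedding_time b n j"

lemma embedding_time_nonneg: "0 \<le> T n j"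
proof (induction j)
  case (Suc j)
  have "T n j < T n (Suc j)"
    using exit_time_gt[OF Suc, of "1 / 2 ^ n"] by simp
  with Suc show ?case by linarith
qed simp

lemma embedding_time_less_Suc: "T n j < T n (Suc j)"
  using exit_time_gt[OF embedding_time_nonneg, of "1 / 2 ^ n"] by simp

lemma embedding_time_mono: "i \<le> j \<Longrightarrow> T n i \<le> T n j"
  by (rule lift_Suc_mono_le[of "T n"]) (rule less_imp_le[OF embedding_time_less_Suc])

lemma embedding_step:
  "b (T n (Suc j)) - b (T n j) \<in> {1 / 2 ^ n, - (1 / 2 ^ n)}"
  using exit_time_diff[OF embedding_time_nonneg, of "1 / 2 ^ n"] by simp

lemma embedding_between:
  "T n j \<le> s \<Longrightarrow> s < T n (Suc j) \<Longrightarrow>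
    \<bar>b s - b (T n j)\<bar> < 1 / 2 ^ n"
  using exit_time_before[OF embedding_time_nonneg, of "1 / 2 ^ n" n j s] by simp

text \<open>The bound on \<open>z\<close> confines the levels visited in \<open>4 ^ n\<close> steps
  to the finite range over which the union bounds are taken.\<close>

lemma embedding_integer:
  "\<exists>z::int. b (T n j) = of_int z / 2 ^ n \<and> \<bar>z\<bar> \<le> int j"
proof (induction j)
  case 0
  show ?case by (rule exI[of _ 0]) (simp add: start)
next
  case (Suc j)
  then obtain z :: int where z: "b (T n j) = of_int z / 2 ^ n" "\<bar>z\<bar> \<le> int j" by blast
  from embedding_step[of n j] consider
    "b (T n (Suc j)) = of_int (z + 1) / 2 ^ n"
    | "b (T n (Suc j)) = of_int (z - 1) / 2 ^ n"
    by (auto simp: z add_divide_distrib diff_divide_distrib algebra_simps simp del: embedding_time.simps)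
  then show ?case
  proof cases
    case 1
    then show ?thesis using z(2) by (intro exI[of _ "z + 1"]) auto
  next
    case 2
    then show ?thesis using z(2) by (intro exI[of _ "z - 1"]) auto
  qed
qed

end

section \<open>Walks on a lattice\<close>

definition level_sum :: "(nat \<Rightarrow> real) \<Rightarrow> nat \<Rightarrow> real \<Rightarrow> real" where
  "level_sum s J a = (\<Sum>j<J. if s j = a then s (Suc j) - s j else 0)"

text \<open>The discrete stochastic integral of the sign of the walk. As \<open>sgn 0 = 0\<close>,
  steps leaving \<open>a\<close> are missing from it; their contribution to the growth of the
  distance to \<open>a\<close> is what counts the visits.\<close>

definition tanaka_sum :: "(nat \<Rightarrow> real) \<Rightarrow> nat \<Rightarrow> real \<Rightarrow> real" where
  "tanaka_sum s J a = (\<Sum>j<J. sgn (s j - a) * (s (Suc j) - s j))"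

locale lattice_walk =
  fixes s :: "nat \<Rightarrow> real" and h :: real
  assumes h: "0 < h" and s0: "s 0 = 0"
    and step: "\<And>j. s (Suc j) - s j \<in> {h, - h}"
    and lattice: "\<And>j. \<exists>z::int. s j = of_int z * h"
begin

definition visits :: "nat \<Rightarrow> real \<Rightarrow> nat" where
  "visits J a = card {j. j < J \<and> s j = a}"

lemma visits_Suc: "visits (Suc J) a = visits J a + (if s J = a then 1 else 0)"
proof -
  have "{j. j < Suc J \<and> s j = a} = (if s J = a then insert J {j. j < J \<and> s j = a} else {j. j < J \<and> s j = a})"
    by (auto simp: less_Suc_eq)
  then show ?thesis by (auto simp: visits_def)
qed

lemma lattice_cases:
  assumes "a = of_int z * h"
  shows "s j = a \<or> s j \<ge> a + h \<or> s j \<le> a - h"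
proof -
  obtain y :: int where y: "s j = of_int y * h" using lattice by blast
  consider "y = z" | "y \<ge> z + 1" | "y \<le> z - 1" by linarith
  then show ?thesis
  proof cases
    case 2
    then have "(of_int z + 1) * h \<le> of_int y * h" using h by (intro mult_right_mono) linarith+
    then show ?thesis by (simp add: y assms algebra_simps)
  next
    case 3
    then have "of_int y * h \<le> (of_int z - 1) * h" using h by (intro mult_right_mono) linarith+
    then show ?thesis by (simp add: y assms algebra_simps)
  qed (simp add: y assms)
qed

text \<open>A step cannot jump across a lattice level, so away from \<open>a\<close> the distance to
  \<open>a\<close> changes by the signed step; a step from \<open>a\<close> always raises it by
  \<open>h\<close>.\<close>

lemma discrete_tanaka:
  assumes a: "a = of_int z * h"
  shows "h * visits J a = \<bar>s J - a\<bar> - \<bar>a\<bar> - tanaka_sum s J a"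
proof (induction J)
  case 0
  then show ?case by (simp add: visits_def s0 tanaka_sum_def level_sum_def)
next
  case (Suc J)
  have "\<bar>s (Suc J) - a\<bar> - \<bar>s J - a\<bar> = sgn (s J - a) * (s (Suc J) - s J) + (if s J = a then h else 0)"
    using lattice_cases[OF a, of J] step[of J] h by (auto simp: sgn_if abs_if)
  with Suc show ?case by (simp add: visits_Suc tanaka_sum_def algebra_simps)
qed

text \<open>The map \<open>min x a\<close> follows the walk below \<open>a\<close> and is constant
  above. A step from \<open>a\<close> changes it by 0 or \<open>- h\<close>, that is, by half of the
  step minus \<open>h\<close>; this produces both the visits and \<open>level_sum\<close>, each with
  factor one half.\<close>

lemma discrete_tanaka_min:
  assumes a: "a = of_int z * h"
  shows "(\<Sum>j<J. if s j < a then s (Suc j) - s j else 0) =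
    h * visits J a / 2 - level_sum s J a / 2 + min (s J) a - min 0 a"
proof (induction J)
  case 0
  then show ?case by (simp add: visits_def s0 tanaka_sum_def level_sum_def)
next
  case (Suc J)
  have "(if s J < a then s (Suc J) - s J else 0) =
      (if s J = a then h else 0) / 2 - (if s J = a then s (Suc J) - s J else 0) / 2
       + min (s (Suc J)) a - min (s J) a"
    using lattice_cases[OF a, of J] step[of J] h by (auto simp: min_def)
  with Suc show ?case by (auto simp: visits_Suc level_sum_def algebra_simps add_divide_distrib diff_divide_distrib)
qed

end

section \<open>Initial segments of the quantile order\<close>

lemma sum_less_Collect: "sum f {i. i < m \<and> Q i} = (\<Sum>i<(m::nat). if Q i then f i else 0)"
proof -
  have "{i. i < m \<and> Q i} = {i\<in>{..<m}. Q i}" by auto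
  then show ?thesis by (simp only: sum.inter_filter finite_lessThan)
qed

lemma card_less_Collect: "real (card {i. i < (m::nat) \<and> Q i}) = (\<Sum>i<m. if Q i then 1 else 0)"
  using sum_less_Collect[of "\<lambda>_. 1 :: real"] by simp

text \<open>The first \<open>k\<close> indices are an initial segment of the lexicographic order:
  every step from a level below \<open>v\<close>, and those from level \<open>v\<close> up to the
  step \<open>q\<close>. This turns rank and transform into sums over time that Tanaka's formula
  evaluates.\<close>

lemma quantile_perm_initial:
  fixes w :: "nat \<Rightarrow> real"
  assumes k: "k \<in> {1..N}"
  defines "q \<equiv> quantile_perm w N k" and "v \<equiv> w (quantile_perm w N k - 1)"
  shows "q \<in> {1..N}"
    and "k = card {j. j < N \<and> w j < v} + card {j. j < q \<and> w j = v}"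
    and "walk_quantile_transform w N k =
      (\<Sum>j<N. if w j < v then w (Suc j) - w j else 0) + level_sum w q v"
proof -
  define p where "p = quantile_perm w N"
  have "is_quantile_perm w N p"
    unfolding p_def quantile_perm_def by (rule theI'[OF ex1_quantile_perm])
  then have perm: "p permutes {1..N}"
    and ord: "\<And>i j. i \<in> {1..N} \<Longrightarrow> j \<in> {1..N} \<Longrightarrow> i < j \<Longrightarrow>
      lex_less (w (p i - 1), p i - 1) (w (p j - 1), p j - 1)"
    unfolding is_quantile_perm_def by blast+
  have q: "q = p k" and v: "v = w (q - 1)" unfolding q_def v_def p_def by simp_all
  show qN: "q \<in> {1..N}" using permutes_in_image[OF perm] k q by blast
  let ?S = "{j. j < N \<and> w j < v} \<union> {j. j < q \<and> w j = v}"
  have inj: "inj p" using permutes_inj[OF perm] .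
  \<comment> \<open>The permutation numbers steps from 1, whereas \<open>?S\<close> holds their
    starting times, counted from 0; hence \<open>Suc\<close>.\<close>
  have img: "p ` {1..k} = Suc ` ?S"
  proof (intro set_eqI iffI)
    fix y assume "y \<in> p ` {1..k}"
    then obtain i where i: "i \<in> {1..k}" "y = p i" by blast
    then have iN: "i \<in> {1..N}" using k by auto
    have y1: "y \<in> {1..N}" using permutes_in_image[OF perm] iN i by blast
    have "y - 1 \<in> ?S"
    proof (cases "i = k")
      case True
      then have "y = q" using i q by simp
      then show ?thesis using qN v by auto
    next
      case False
      then have "lex_less (w (y - 1), y - 1) (v, q - 1)" using ord[of i k] iN k i q v by auto
      then show ?thesis using y1 by (auto simp: lex_less_def)
    qed
    moreover have "y = Suc (y - 1)" using y1 by auto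
    ultimately show "y \<in> Suc ` ?S" by blast
  next
    fix y assume "y \<in> Suc ` ?S"
    then obtain j where j: "y = Suc j" "j \<in> ?S" by blast
    then have yN: "y \<in> {1..N}" using qN by auto
    then obtain i where i: "i \<in> {1..N}" "y = p i" using permutes_image[OF perm] by blast
    have "i \<le> k"
    proof (rule ccontr)
      assume "\<not> i \<le> k"
      moreover have "p i - 1 = j" using i j by simp
      ultimately have "lex_less (v, q - 1) (w j, j)" using ord[of k i] i k q v by simp
      then show False using j(2) qN by (auto simp: lex_less_def)
    qed
    then show "y \<in> p ` {1..k}" using i by auto
  qed
  have fin: "finite {j. j < N \<and> w j < v}" "finite {j. j < q \<and> w j = v}" by auto
  have disj: "{j. j < N \<and> w j < v} \<inter> {j. j < q \<and> w j = v} = {}" by auto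
  have "card (p ` {1..k}) = k" using inj by (simp add: card_image inj_on_subset)
  then show "k = card {j. j < N \<and> w j < v} + card {j. j < q \<and> w j = v}"
    using img card_Un_disjoint[OF fin disj] by (simp add: card_image)
  have "walk_quantile_transform w N k = (\<Sum>i\<in>p ` {1..k}. w i - w (i - 1))"
    unfolding walk_quantile_transform_def p_def[symmetric]
    by (subst sum.reindex) (use inj in \<open>auto intro: inj_on_subset\<close>)
  also have "\<dots> = (\<Sum>j\<in>?S. w (Suc j) - w j)"
    unfolding img by (subst sum.reindex) auto
  also have "\<dots> = (\<Sum>j\<in>{j. j < N \<and> w j < v}. w (Suc j) - w j) + (\<Sum>j\<in>{j. j < q \<and> w j = v}. w (Suc j) - w j)"
    by (rule sum.union_disjoint[OF fin disj])
  finally show "walk_quantile_transform w N k =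
      (\<Sum>j<N. if w j < v then w (Suc j) - w j else 0) + level_sum w q v"
    unfolding level_sum_def sum_less_Collect .
qed

section \<open>Increments and the past\<close>

text \<open>Replaces an uncountable union by countable operations, so that hitting a level by time
  \<open>t\<close> is an event of the past of \<open>t\<close>. The slack \<open>1 / Suc m\<close>
  is needed since the level may be reached at a single irrational fraction of \<open>t\<close>; the
  converse holds because the maximum is attained.\<close>

lemma continuous_reaches_iff:
  fixes V :: "real \<Rightarrow> real"
  assumes V: "continuous_on {0..t} V" and t: "0 \<le> t"
  shows "(\<exists>s\<in>{0..t}. c \<le> V s) \<longleftrightarrow> (\<forall>m::nat. \<exists>r\<in>\<rat> \<inter> {0..1}. c - 1 / Suc m < V (t * r))"
proof
  assume "\<exists>s\<in>{0..t}. c \<le> V s"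
  then obtain s where s: "s \<in> {0..t}" "c \<le> V s" by blast
  show "\<forall>m::nat. \<exists>r\<in>\<rat> \<inter> {0..1}. c - 1 / Suc m < V (t * r)"
  proof
    fix m :: nat
    obtain \<delta> where \<delta>: "\<delta> > 0" "\<And>u. u \<in> {0..t} \<Longrightarrow> \<bar>u - s\<bar> < \<delta> \<Longrightarrow> \<bar>V u - V s\<bar> < 1 / Suc m"
      using V[unfolded continuous_on_iff, rule_format, OF s(1), of "1 / Suc m"]
      by (auto simp: dist_real_def)
    have "\<exists>r\<in>\<rat> \<inter> {0..1}. \<bar>t * r - s\<bar> < \<delta>"
    proof (cases "s = 0 \<or> t = 0")
      case True
      then show ?thesis using s \<delta> by (intro bexI[of _ 0]) auto
    next
      case False
      with s t have st: "0 < s" "0 < t" "s \<le> t" by auto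
      then have "max 0 ((s - \<delta>) / t) < s / t" using \<delta> by (auto simp: field_simps)
      then obtain r where r: "r \<in> \<rat>" "max 0 ((s - \<delta>) / t) < r" "r < s / t"
        using Rats_dense_in_real by blast
      moreover have "s / t \<le> 1" using st by simp
      ultimately have "r \<in> \<rat> \<inter> {0..1}" by auto
      moreover have "s - \<delta> < t * r" "t * r < s" using r st by (auto simp: field_simps)
      ultimately show ?thesis by (intro bexI[of _ r]) auto
    qed
    then obtain r where r: "r \<in> \<rat> \<inter> {0..1}" "\<bar>t * r - s\<bar> < \<delta>" by blast
    then have "t * r \<in> {0..t}" using t by (auto simp: mult_left_le)
    with \<delta>(2)[of "t * r"] r s(2) show "\<exists>r\<in>\<rat> \<inter> {0..1}. c - 1 / Suc m < V (t * r)"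
      by (intro bexI[of _ r]) auto
  qed
next
  assume *: "\<forall>m::nat. \<exists>r\<in>\<rat> \<inter> {0..1}. c - 1 / Suc m < V (t * r)"
  obtain s where s: "s \<in> {0..t}" "\<And>u. u \<in> {0..t} \<Longrightarrow> V u \<le> V s"
    using continuous_attains_sup[OF _ _ V] t by auto
  have "c - 1 / Suc m < V s" for m
  proof -
    obtain r where r: "r \<in> \<rat> \<inter> {0..1}" "c - 1 / Suc m < V (t * r)" using * by blast
    then have "t * r \<in> {0..t}" using t by (auto simp: mult_left_le)
    with s(2)[of "t * r"] r(2) show ?thesis by simp
  qed
  moreover have "(\<lambda>m. c - 1 / Suc m) \<longlonglongrightarrow> c - 0"
    by (intro tendsto_diff tendsto_const LIMSEQ_Suc lim_1_over_n)
  ultimately have "c \<le> V s" by (intro LIMSEQ_le_const2[of _ c]) (auto intro!: less_imp_le)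
  then show "\<exists>s\<in>{0..t}. c \<le> V s" using s by blast
qed

section \<open>The natural filtration and its independence of the next increment\<close>

abbreviation gauss :: "real \<Rightarrow> real measure" where
  "gauss d \<equiv> density lborel (normal_density 0 (sqrt d))"

text \<open>Path properties are required for every outcome, so that embedding times are finite and
  measurable without exceptional sets. Independence is asked only for cylinder events, which form a
  generator of the past stable under intersection.\<close>

locale continuous_bm = prob_space M for M :: "'a measure" +
  fixes W :: "real \<Rightarrow> 'a \<Rightarrow> real"
  assumes W_borel [measurable]: "\<And>t. W t \<in> borel_measurable M"
    and W_path: "\<And>\<omega>. unbounded_path (\<lambda>t. W t \<omega>)"
    and W_incr: "\<And>t d. 0 \<le> t \<Longrightarrow> 0 < d \<Longrightarrow>
      distributed M lborel (\<lambda>\<omega>. W (t + d) \<omega> - W t \<omega>) (normal_density 0 (sqrt d))"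
    and W_indep: "\<And>t d J E A. 0 \<le> t \<Longrightarrow> 0 < d \<Longrightarrow> finite J \<Longrightarrow> J \<subseteq> {0..t} \<Longrightarrow>
      (\<And>s. s \<in> J \<Longrightarrow> E s \<in> sets borel) \<Longrightarrow> A \<in> sets borel \<Longrightarrow>
      prob {\<omega>\<in>space M. (\<forall>s\<in>J. W s \<omega> \<in> E s) \<and> W (t + d) \<omega> - W t \<omega> \<in> A} =
      prob {\<omega>\<in>space M. \<forall>s\<in>J. W s \<omega> \<in> E s} * prob {\<omega>\<in>space M. W (t + d) \<omega> - W t \<omega> \<in> A}"
begin

definition cylinders :: "real \<Rightarrow> 'a set set" where
  "cylinders t = {{\<omega>\<in>space M. \<forall>s\<in>J. W s \<omega> \<in> E s} | J E.
     finite J \<and> J \<subseteq> {0..t} \<and> (\<forall>s\<in>J. E s \<in> sets borel)}"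

definition past :: "real \<Rightarrow> 'a measure" where
  "past t = sigma (space M) (cylinders t)"

lemma cylinders_subset: "cylinders t \<subseteq> sets M"
  unfolding cylinders_def by auto

lemma space_past [simp]: "space (past t) = space M"
  unfolding past_def by (rule space_measure_of) (use cylinders_subset sets.space_closed in blast)

lemma sets_past: "sets (past t) = sigma_sets (space M) (cylinders t)"
  unfolding past_def by (rule sets_measure_of) (use cylinders_subset sets.space_closed in blast)

lemma past_subset: "sets (past t) \<subseteq> sets M"
  unfolding sets_past by (rule sets.sigma_sets_subset[OF cylinders_subset])

lemma past_mono:
  assumes "s \<le> t" shows "sets (past s) \<subseteq> sets (past t)"
proof -
  have "cylinders s \<subseteq> cylinders t"
    unfolding cylinders_def using assms by (smt (verit) Collect_mono atLeastAtMost_iff subset_iff)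
  then show ?thesis unfolding sets_past by (rule sigma_sets_mono')
qed

lemma measurable_past: "f \<in> measurable (past t) N \<Longrightarrow> f \<in> measurable M N"
  using past_subset[of t] by (auto simp: measurable_def)

lemma measurable_past_mono: "f \<in> measurable (past s) N \<Longrightarrow> s \<le> t \<Longrightarrow> f \<in> measurable (past t) N"
  using past_mono[of s t] by (auto simp: measurable_def)

lemma W_past:
  assumes "0 \<le> s" "s \<le> t" shows "W s \<in> borel_measurable (past t)"
proof (rule measurableI)
  fix A :: "real set" assume A: "A \<in> sets borel"
  have "{\<omega>\<in>space M. \<forall>s\<in>{s}. W s \<omega> \<in> A} \<in> cylinders t"
    unfolding cylinders_def using assms A by (intro CollectI exI[of _ "{s}"] exI[of _ "\<lambda>_. A"]) auto
  moreover have "{\<omega>\<in>space M. \<forall>s\<in>{s}. W s \<omega> \<in> A} = W s -` A \<inter> space (past t)" by auto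
  ultimately show "W s -` A \<inter> space (past t) \<in> sets (past t)"
    unfolding sets_past by auto
qed simp

lemma Int_stable_cylinders: "Int_stable (cylinders t)"
proof (rule Int_stableI)
  fix a c assume "a \<in> cylinders t" "c \<in> cylinders t"
  then obtain J E J' E' where a: "a = {\<omega>\<in>space M. \<forall>s\<in>J. W s \<omega> \<in> E s}" "finite J" "J \<subseteq> {0..t}"
      "\<forall>s\<in>J. E s \<in> sets borel"
    and c: "c = {\<omega>\<in>space M. \<forall>s\<in>J'. W s \<omega> \<in> E' s}" "finite J'" "J' \<subseteq> {0..t}"
      "\<forall>s\<in>J'. E' s \<in> sets borel"
    unfolding cylinders_def by blast
  define G where "G s = (if s \<in> J then E s else UNIV) \<inter> (if s \<in> J' then E' s else UNIV)" for s
  have "a \<inter> c = {\<omega>\<in>space M. \<forall>s\<in>J \<union> J'. W s \<omega> \<in> G s}"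
    unfolding a c G_def by auto
  then show "a \<inter> c \<in> cylinders t"
    unfolding cylinders_def using a c
    by (intro CollectI exI[of _ "J \<union> J'"] exI[of _ G]) (auto simp: G_def)
qed

text \<open>Both families are stable under intersection, so the product formula for cylinders passes
  to the generated sigma-algebras.\<close>

lemma indep_past_increment:
  assumes t: "0 \<le> t" and d: "0 < d"
  shows "indep_set (sets (past t)) {(\<lambda>\<omega>. W (t + d) \<omega> - W t \<omega>) -` A \<inter> space M | A. A \<in> sets borel}"
proof -
  let ?X = "\<lambda>\<omega>. W (t + d) \<omega> - W t \<omega>"
  let ?B = "{?X -` A \<inter> space M | A. A \<in> sets borel}"
  have "indep_set (cylinders t) ?B"
    unfolding indep_sets2_eq
  proof (intro conjI ballI)
    show "cylinders t \<subseteq> events" by (rule cylinders_subset)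
    show "?B \<subseteq> events" by auto
    fix a c assume "a \<in> cylinders t" "c \<in> ?B"
    then obtain J E A where a: "a = {\<omega>\<in>space M. \<forall>s\<in>J. W s \<omega> \<in> E s}" "finite J" "J \<subseteq> {0..t}"
      "\<forall>s\<in>J. E s \<in> sets borel" and c: "c = ?X -` A \<inter> space M" "A \<in> sets borel"
      unfolding cylinders_def by blast
    have "a \<inter> c = {\<omega>\<in>space M. (\<forall>s\<in>J. W s \<omega> \<in> E s) \<and> ?X \<omega> \<in> A}"
      and "c = {\<omega>\<in>space M. ?X \<omega> \<in> A}" unfolding a c by auto
    then show "prob (a \<inter> c) = prob a * prob c"
      using W_indep[OF t d a(2,3) _ c(2), of E] a by simp
  qed
  moreover have "Int_stable ?B"
  proof (rule Int_stableI)
    fix a c assume "a \<in> ?B" "c \<in> ?B"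
    then obtain A C where "a = ?X -` A \<inter> space M" "c = ?X -` C \<inter> space M" "A \<in> sets borel" "C \<in> sets borel"
      by blast
    then show "a \<inter> c \<in> ?B" by (intro CollectI exI[of _ "A \<inter> C"]) auto
  qed
  ultimately have "indep_set (sigma_sets (space M) (cylinders t)) (sigma_sets (space M) ?B)"
    by (rule indep_set_sigma_sets[OF _ Int_stable_cylinders])
  then show ?thesis
    unfolding indep_sets2_eq sets_past by (meson sigma_sets.Basic subset_iff)
qed

lemma increment_distr:
  assumes "0 \<le> t" "0 < d"
  shows "distr M borel (\<lambda>\<omega>. W (t + d) \<omega> - W t \<omega>) = gauss d"
  using W_incr[OF assms] unfolding distributed_def by (metis (no_types, lifting) distr_cong sets_lborel)

text \<open>Freezing of the past: the joint law of the outcome, seen through \<open>past t\<close>,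
  and of the next increment agrees with a product measure on rectangles, hence is that product, and
  Tonelli applies.\<close>

lemma simple_markov:
  assumes t: "0 \<le> t" and d: "0 < d"
    and f: "f \<in> borel_measurable (past t \<Otimes>\<^sub>M borel)"
  shows "(\<integral>\<^sup>+\<omega>. f (\<omega>, W (t + d) \<omega> - W t \<omega>) \<partial>M) =
    (\<integral>\<^sup>+\<omega>. (\<integral>\<^sup>+x. f (\<omega>, x) \<partial>gauss d) \<partial>M)"
proof -
  let ?X = "\<lambda>\<omega>. W (t + d) \<omega> - W t \<omega>" and ?D = "gauss d"
  \<comment> \<open>The restriction of \<open>M\<close> to the smaller sigma-algebra, written as an
    image under the identity.\<close>
  let ?P = "distr M (past t) (\<lambda>\<omega>. \<omega>)"
  have id: "(\<lambda>\<omega>. \<omega>) \<in> measurable M (past t)"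
    by (rule measurable_past[OF measurable_ident_sets]) simp
  have D: "sigma_finite_measure ?D"
    using prob_space_normal_density[of "sqrt d" 0] d prob_space_imp_sigma_finite by auto
  have P: "sigma_finite_measure ?P"
    by (rule prob_space_imp_sigma_finite[OF prob_space_distr[OF id]])
  have pair: "(\<lambda>\<omega>. (\<omega>, ?X \<omega>)) \<in> measurable M (past t \<Otimes>\<^sub>M borel)"
    by (intro measurable_Pair id) simp
  have f': "f \<in> borel_measurable (?P \<Otimes>\<^sub>M ?D)"
    using f by (subst measurable_cong_sets[OF sets_pair_measure_cong refl]) auto
  have prod: "?P \<Otimes>\<^sub>M ?D = distr M (past t \<Otimes>\<^sub>M borel) (\<lambda>\<omega>. (\<omega>, ?X \<omega>))"
  proof (rule pair_measure_eqI[OF P D])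
    show "sets (?P \<Otimes>\<^sub>M ?D) = sets (distr M (past t \<Otimes>\<^sub>M borel) (\<lambda>\<omega>. (\<omega>, ?X \<omega>)))"
      by (simp cong: sets_pair_measure_cong)
    fix A C assume "A \<in> sets ?P" "C \<in> sets ?D"
    then have A: "A \<in> sets (past t)" and C: "C \<in> sets borel" by auto
    have AM: "A \<in> sets M" "A \<inter> space M = A"
      using A past_subset[of t] sets.sets_into_space by blast+
    have "emeasure ?P A = prob A"
      using A id AM by (simp add: emeasure_distr emeasure_eq_measure)
    moreover have "emeasure ?D C = prob (?X -` C \<inter> space M)"
      unfolding increment_distr[OF t d, symmetric] using C
      by (simp add: emeasure_distr emeasure_eq_measure)
    moreover have "prob (A \<inter> (?X -` C \<inter> space M)) = prob A * prob (?X -` C \<inter> space M)"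
      using indep_past_increment[OF t d] A C unfolding indep_sets2_eq by blast
    moreover have "(\<lambda>\<omega>. (\<omega>, ?X \<omega>)) -` (A \<times> C) \<inter> space M = A \<inter> (?X -` C \<inter> space M)"
      using AM by auto
    then have "emeasure (distr M (past t \<Otimes>\<^sub>M borel) (\<lambda>\<omega>. (\<omega>, ?X \<omega>))) (A \<times> C)
        = prob (A \<inter> (?X -` C \<inter> space M))"
      using A C pair by (subst emeasure_distr) (auto simp: emeasure_eq_measure)
    ultimately show "emeasure ?P A * emeasure ?D C =
        emeasure (distr M (past t \<Otimes>\<^sub>M borel) (\<lambda>\<omega>. (\<omega>, ?X \<omega>))) (A \<times> C)"
      by (simp add: ennreal_mult)
  qed
  have "(\<integral>\<^sup>+\<omega>. f (\<omega>, ?X \<omega>) \<partial>M) = (\<integral>\<^sup>+p. f p \<partial>distr M (past t \<Otimes>\<^sub>M borel) (\<lambda>\<omega>. (\<omega>, ?X \<omega>)))"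
    by (rule nn_integral_distr[symmetric, OF pair]) (simp add: f)
  also have "\<dots> = (\<integral>\<^sup>+p. f p \<partial>(?P \<Otimes>\<^sub>M ?D))"
    unfolding prod ..
  also have "\<dots> = (\<integral>\<^sup>+\<omega>. (\<integral>\<^sup>+x. f (\<omega>, x) \<partial>?D) \<partial>?P)"
    by (rule sigma_finite_measure.nn_integral_fst[OF D f', symmetric])
  also have "\<dots> = (\<integral>\<^sup>+\<omega>. (\<integral>\<^sup>+x. f (\<omega>, x) \<partial>?D) \<partial>M)"
  proof (rule nn_integral_distr[OF id])
    show "(\<lambda>\<omega>. \<integral>\<^sup>+x. f (\<omega>, x) \<partial>?D) \<in> borel_measurable ?P"
      by (rule sigma_finite_measure.borel_measurable_nn_integral_fst[OF D f'])
  qed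
  finally show ?thesis .
qed

end

section \<open>Gaussian increments on a time grid\<close>

text \<open>Completing the square: the exponential factor turns the centred density into the normal
  density with mean \<open>h * d\<close>.\<close>

lemma gaussian_exp_martingale:
  assumes d: "0 < d"
  shows "(\<integral>\<^sup>+x. ennreal (exp (h * x - h\<^sup>2 * d / 2)) \<partial>gauss d) = 1"
proof -
  have "(\<integral>\<^sup>+x. ennreal (exp (h * x - h\<^sup>2 * d / 2)) \<partial>gauss d)
    = (\<integral>\<^sup>+x. ennreal (normal_density 0 (sqrt d) x) * ennreal (exp (h * x - h\<^sup>2 * d / 2)) \<partial>lborel)"
    by (rule nn_integral_density) auto
  also have "\<dots> = (\<integral>\<^sup>+x. ennreal (normal_density (h * d) (sqrt d) x) \<partial>lborel)"
  proof (rule nn_integral_cong)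
    fix x :: real
    have "- (x - 0)\<^sup>2 / (2 * (sqrt d)\<^sup>2) + (h * x - h\<^sup>2 * d / 2) = - (x - h * d)\<^sup>2 / (2 * (sqrt d)\<^sup>2)"
      using d by (simp add: field_simps power2_eq_square)
    then have "normal_density 0 (sqrt d) x * exp (h * x - h\<^sup>2 * d / 2) = normal_density (h * d) (sqrt d) x"
      unfolding normal_density_def by (simp add: mult.assoc exp_add[symmetric])
    then show "ennreal (normal_density 0 (sqrt d) x) * ennreal (exp (h * x - h\<^sup>2 * d / 2))
        = ennreal (normal_density (h * d) (sqrt d) x)"
      by (simp add: ennreal_mult'[symmetric])
  qed
  also have "\<dots> = emeasure (density lborel (normal_density (h * d) (sqrt d))) UNIV"
    by (simp add: emeasure_density)
  also have "\<dots> = 1"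
    using prob_space.emeasure_space_1[OF prob_space_normal_density[of "sqrt d" "h * d"]] d by simp
  finally show ?thesis .
qed

text \<open>The constant, the linear term and \<open>x\<^sup>2 - d\<close> are orthogonal under the
  Gaussian law, and the last has variance \<open>2 * d\<^sup>2\<close>.\<close>

lemma gaussian_square_moment:
  assumes d: "0 < d"
  shows "(\<integral>\<^sup>+x. ennreal ((y + 2 * h * x + g * (x\<^sup>2 - d))\<^sup>2) \<partial>gauss d)
    = ennreal (y\<^sup>2 + 4 * h\<^sup>2 * d + 2 * g\<^sup>2 * d\<^sup>2)"
proof -
  let ?n = "normal_density 0 (sqrt d)"
  have s: "sqrt d > 0" using d by simp
  have 0: "has_bochner_integral lborel (\<lambda>x. ?n x * x ^ 0) 1"
    and 2: "has_bochner_integral lborel (\<lambda>x. ?n x * x ^ 2) d"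
    and 4: "has_bochner_integral lborel (\<lambda>x. ?n x * x ^ 4) (3 * d\<^sup>2)"
    and 1: "has_bochner_integral lborel (\<lambda>x. ?n x * x ^ 1) 0"
    and 3: "has_bochner_integral lborel (\<lambda>x. ?n x * x ^ 3) 0"
    using normal_moment_even[OF s, of 0 0] normal_moment_even[OF s, of 0 1]
      normal_moment_even[OF s, of 0 2] normal_moment_odd[OF s, of 0 0] normal_moment_odd[OF s, of 0 1] d
    by (simp_all add: eval_nat_numeral power2_eq_square field_simps)
  let ?f = "\<lambda>x. (y - g * d)\<^sup>2 * (?n x * x ^ 0) + 4 * h * (y - g * d) * (?n x * x ^ 1)
     + (4 * h\<^sup>2 + 2 * g * (y - g * d)) * (?n x * x ^ 2) + 4 * h * g * (?n x * x ^ 3) + g\<^sup>2 * (?n x * x ^ 4)"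
  have f: "has_bochner_integral lborel ?f ((y - g * d)\<^sup>2 * 1 + 4 * h * (y - g * d) * 0
     + (4 * h\<^sup>2 + 2 * g * (y - g * d)) * d + 4 * h * g * 0 + g\<^sup>2 * (3 * d\<^sup>2))"
    by (intro has_bochner_integral_add has_bochner_integral_mult_right 0 1 2 3 4)
  have feq: "?f x = ?n x * (y + 2 * h * x + g * (x\<^sup>2 - d))\<^sup>2" for x
    by (simp add: eval_nat_numeral algebra_simps)
  have "(\<integral>\<^sup>+x. ennreal ((y + 2 * h * x + g * (x\<^sup>2 - d))\<^sup>2) \<partial>density lborel ?n)
    = (\<integral>\<^sup>+x. ennreal (?n x) * ennreal ((y + 2 * h * x + g * (x\<^sup>2 - d))\<^sup>2) \<partial>lborel)"
    by (rule nn_integral_density) auto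
  also have "\<dots> = (\<integral>\<^sup>+x. ennreal (?f x) \<partial>lborel)"
    unfolding feq by (simp add: ennreal_mult'[symmetric])
  also have "\<dots> = ennreal (integral\<^sup>L lborel ?f)"
    by (rule nn_integral_eq_integral[OF integrable.intros[OF f]]) (unfold feq, auto)
  also have "integral\<^sup>L lborel ?f = y\<^sup>2 + 4 * h\<^sup>2 * d + 2 * g\<^sup>2 * d\<^sup>2"
    unfolding has_bochner_integral_integral_eq[OF f] by (simp add: power2_eq_square algebra_simps)
  finally show ?thesis .
qed

context continuous_bm
begin

definition incr :: "real \<Rightarrow> nat \<Rightarrow> 'a \<Rightarrow> real" where
  "incr d i \<omega> = W (real (Suc i) * d) \<omega> - W (real i * d) \<omega>"

lemma incr_past: "0 < d \<Longrightarrow> i < m \<Longrightarrow> incr d i \<in> borel_measurable (past (real m * d))"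
  unfolding incr_def[abs_def]
  by (intro borel_measurable_diff W_past) (auto intro!: mult_right_mono)

lemma incr_markov:
  assumes d: "0 < d" and f: "f \<in> borel_measurable (past (real m * d) \<Otimes>\<^sub>M borel)"
  shows "(\<integral>\<^sup>+\<omega>. f (\<omega>, incr d m \<omega>) \<partial>M) =
    (\<integral>\<^sup>+\<omega>. (\<integral>\<^sup>+x. f (\<omega>, x) \<partial>gauss d) \<partial>M)"
proof -
  have "incr d m = (\<lambda>\<omega>. W (real m * d + d) \<omega> - W (real m * d) \<omega>)"
    by (simp add: incr_def[abs_def] algebra_simps)
  then show ?thesis using simple_markov[OF _ d f] d by simp
qed

lemma discrete_exp_martingale:
  assumes d: "0 < d" and h: "\<And>i. h i \<in> borel_measurable (past (real i * d))"
  shows "(\<integral>\<^sup>+\<omega>. ennreal (exp (\<Sum>i<m. h i \<omega> * incr d i \<omega> - (h i \<omega>)\<^sup>2 * d / 2)) \<partial>M) = 1"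
proof (induction m)
  case 0
  then show ?case by (simp add: emeasure_space_1)
next
  case (Suc m)
  let ?S = "\<lambda>\<omega>. \<Sum>i<m. h i \<omega> * incr d i \<omega> - (h i \<omega>)\<^sup>2 * d / 2"
  have hm: "h i \<in> borel_measurable (past (real m * d))" if "i \<le> m" for i
    using that d by (intro measurable_past_mono[OF h]) (auto intro!: mult_right_mono)
  have S: "?S \<in> borel_measurable (past (real m * d))"
    using hm incr_past[OF d] by (intro borel_measurable_sum) auto
  let ?f = "\<lambda>(\<omega>, x). ennreal (exp (?S \<omega>)) * ennreal (exp (h m \<omega> * x - (h m \<omega>)\<^sup>2 * d / 2))"
  have f: "?f \<in> borel_measurable (past (real m * d) \<Otimes>\<^sub>M borel)"
    using S hm[of m] by (auto intro!: borel_measurable_times simp: split_beta'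
      simp del: sum_subtractf intro: measurable_compose[OF measurable_fst])
  have "(\<integral>\<^sup>+\<omega>. ennreal (exp (\<Sum>i<Suc m. h i \<omega> * incr d i \<omega> - (h i \<omega>)\<^sup>2 * d / 2)) \<partial>M)
      = (\<integral>\<^sup>+\<omega>. ?f (\<omega>, incr d m \<omega>) \<partial>M)"
    by (simp add: exp_add ennreal_mult')
  also have "\<dots> = (\<integral>\<^sup>+\<omega>. (\<integral>\<^sup>+x. ?f (\<omega>, x) \<partial>gauss d) \<partial>M)"
    by (rule incr_markov[OF d f])
  also have "\<dots> = (\<integral>\<^sup>+\<omega>. ennreal (exp (?S \<omega>)) \<partial>M)"
    using gaussian_exp_martingale[OF d] by (simp add: nn_integral_cmult)
  finally show ?case using Suc by simp
qed

text \<open>The terms with \<open>g\<close> are the discretization error of Ito's formula for a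
  square. They cost only \<open>d\<^sup>2\<close> per step and so vanish with the mesh.\<close>

lemma discrete_square_martingale:
  assumes d: "0 < d" and h: "\<And>i. h i \<in> borel_measurable (past (real i * d))"
    and g: "\<And>i. g i \<in> borel_measurable (past (real i * d))"
    and H: "\<And>i \<omega>. \<bar>h i \<omega>\<bar> \<le> H" and G: "\<And>i \<omega>. \<bar>g i \<omega>\<bar> \<le> G"
  shows "(\<integral>\<^sup>+\<omega>. ennreal ((\<Sum>i<m. 2 * h i \<omega> * incr d i \<omega> + g i \<omega> * ((incr d i \<omega>)\<^sup>2 - d))\<^sup>2) \<partial>M)
    \<le> ennreal (real m * (4 * H\<^sup>2 * d + 2 * G\<^sup>2 * d\<^sup>2))"
proof (induction m)
  case 0
  then show ?case by simp
next
  case (Suc m)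
  let ?S = "\<lambda>\<omega>. \<Sum>i<m. 2 * h i \<omega> * incr d i \<omega> + g i \<omega> * ((incr d i \<omega>)\<^sup>2 - d)"
  let ?c = "4 * H\<^sup>2 * d + 2 * G\<^sup>2 * d\<^sup>2"
  have hm: "h i \<in> borel_measurable (past (real m * d))" "g i \<in> borel_measurable (past (real m * d))"
    if "i \<le> m" for i
    using that d by (auto intro!: measurable_past_mono[OF h] measurable_past_mono[OF g] mult_right_mono)
  have S: "?S \<in> borel_measurable (past (real m * d))"
    using hm incr_past[OF d] by (intro borel_measurable_sum) auto
  let ?f = "\<lambda>(\<omega>, x). ennreal ((?S \<omega> + 2 * h m \<omega> * x + g m \<omega> * (x\<^sup>2 - d))\<^sup>2)"
  have f: "?f \<in> borel_measurable (past (real m * d) \<Otimes>\<^sub>M borel)"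
    using measurable_compose[OF measurable_fst S] hm[of m]
    by (auto simp: split_beta' simp del: sum.distrib
        intro!: borel_measurable_power borel_measurable_add borel_measurable_times
        intro: measurable_compose[OF measurable_fst])
  have "(\<integral>\<^sup>+\<omega>. ennreal ((\<Sum>i<Suc m. 2 * h i \<omega> * incr d i \<omega> + g i \<omega> * ((incr d i \<omega>)\<^sup>2 - d))\<^sup>2) \<partial>M)
      = (\<integral>\<^sup>+\<omega>. ?f (\<omega>, incr d m \<omega>) \<partial>M)"
    by (simp add: add.assoc)
  also have "\<dots> = (\<integral>\<^sup>+\<omega>. (\<integral>\<^sup>+x. ?f (\<omega>, x) \<partial>gauss d) \<partial>M)"
    by (rule incr_markov[OF d f])
  also have "\<dots> = (\<integral>\<^sup>+\<omega>. ennreal ((?S \<omega>)\<^sup>2 + 4 * (h m \<omega>)\<^sup>2 * d + 2 * (g m \<omega>)\<^sup>2 * d\<^sup>2) \<partial>M)"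
    using gaussian_square_moment[OF d] by simp
  also have "\<dots> \<le> (\<integral>\<^sup>+\<omega>. ennreal ((?S \<omega>)\<^sup>2) + ennreal ?c \<partial>M)"
  proof (rule nn_integral_mono)
    fix \<omega>
    have "(h m \<omega>)\<^sup>2 \<le> H\<^sup>2" "(g m \<omega>)\<^sup>2 \<le> G\<^sup>2"
      using H[of m \<omega>] G[of m \<omega>] by (simp_all add: abs_le_square_iff[symmetric])
    then have "4 * (h m \<omega>)\<^sup>2 * d + 2 * (g m \<omega>)\<^sup>2 * d\<^sup>2 \<le> ?c"
      using d by (intro add_mono mult_right_mono) auto
    then show "ennreal ((?S \<omega>)\<^sup>2 + 4 * (h m \<omega>)\<^sup>2 * d + 2 * (g m \<omega>)\<^sup>2 * d\<^sup>2) \<le> ennreal ((?S \<omega>)\<^sup>2) + ennreal ?c"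
    proof -
      assume le: "4 * (h m \<omega>)\<^sup>2 * d + 2 * (g m \<omega>)\<^sup>2 * d\<^sup>2 \<le> ?c"
      have "ennreal ((?S \<omega>)\<^sup>2 + 4 * (h m \<omega>)\<^sup>2 * d + 2 * (g m \<omega>)\<^sup>2 * d\<^sup>2) \<le> ennreal ((?S \<omega>)\<^sup>2 + ?c)"
        using le by (intro ennreal_leI) linarith
      also have "\<dots> = ennreal ((?S \<omega>)\<^sup>2) + ennreal ?c"
        using d by (intro ennreal_plus) auto
      finally show ?thesis .
    qed
  qed
  also have "\<dots> = (\<integral>\<^sup>+\<omega>. ennreal ((?S \<omega>)\<^sup>2) \<partial>M) + ennreal ?c"
    using measurable_past[OF S] by (subst nn_integral_add) (auto simp: emeasure_space_1)
  also have "\<dots> \<le> ennreal (real m * ?c) + ennreal ?c"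
    by (intro add_right_mono Suc.IH)
  also have "\<dots> = ennreal (real (Suc m) * ?c)"
    using d by (subst ennreal_plus[symmetric]) (auto simp: algebra_simps)
  finally show ?case .
qed

end

section \<open>Martingales along the embedding times\<close>

text \<open>At any time at most one embedding step is in progress, so even a nonlinear
  \<open>f\<close>, such as one containing a square, passes through the sum over steps.\<close>

lemma sum_exclusive:
  fixes a :: "nat \<Rightarrow> 'b::comm_monoid_add"
  assumes excl: "\<And>i j. P i \<Longrightarrow> P j \<Longrightarrow> i = j" and f: "f 0 = (0::'c::comm_monoid_add)"
  shows "f (\<Sum>j<J. if P j then a j else 0) = (\<Sum>j<J. if P j then f (a j) else 0)"
proof (cases "\<exists>j<J. P j")
  case True
  then obtain j where j: "j < J" "P j" by blast
  then have "P i \<longleftrightarrow> i = j" for i using excl by blast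
  then show ?thesis using j by (simp add: sum.delta)
next
  case False
  then show ?thesis by (simp add: f)
qed

lemma abs_sum_exclusive_le:
  fixes a :: "nat \<Rightarrow> real"
  assumes excl: "\<And>i j. P i \<Longrightarrow> P j \<Longrightarrow> i = j" and le: "\<And>j. P j \<Longrightarrow> \<bar>a j\<bar> \<le> H" and H: "0 \<le> H"
  shows "\<bar>\<Sum>j<J. if P j then a j else 0\<bar> \<le> H"
proof (cases "\<exists>j<J. P j")
  case True
  then obtain j where j: "j < J" "P j" by blast
  then have "P i \<longleftrightarrow> i = j" for i using excl by blast
  then show ?thesis using j le by (simp add: sum.delta)
qed (use H in auto)

definition grid_point :: "real \<Rightarrow> nat \<Rightarrow> real \<Rightarrow> nat" where
  "grid_point d m x = min (nat \<lceil>x / d\<rceil>) m"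

lemma sum_grid_telescope:
  fixes f :: "nat \<Rightarrow> real"
  assumes "0 < d" "0 \<le> x" "x \<le> y"
  shows "(\<Sum>i<m. if x \<le> real i * d \<and> real i * d < y then f (Suc i) - f i else 0)
    = f (grid_point d m y) - f (grid_point d m x)"
proof -
  have le: "z \<le> real i * d \<longleftrightarrow> nat \<lceil>z / d\<rceil> \<le> i" for z i
    using assms(1) by (simp add: nat_le_iff ceiling_le_iff pos_divide_le_eq)
  have "(\<Sum>i<m. if x \<le> real i * d \<and> real i * d < y then f (Suc i) - f i else 0)
     = (\<Sum>i\<in>{i\<in>{..<m}. x \<le> real i * d \<and> real i * d < y}. f (Suc i) - f i)"
    by (subst sum.inter_filter) auto
  also have "{i\<in>{..<m}. x \<le> real i * d \<and> real i * d < y} = {grid_point d m x..<grid_point d m y}"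
  proof (intro set_eqI)
    fix i
    define X Y where "X = nat \<lceil>x / d\<rceil>" and "Y = nat \<lceil>y / d\<rceil>"
    have "x \<le> real i * d \<longleftrightarrow> X \<le> i" "real i * d < y \<longleftrightarrow> i < Y"
      using le[of x i] le[of y i] by (simp_all add: X_def Y_def not_le[symmetric] del: not_le)
    then show "i \<in> {i\<in>{..<m}. x \<le> real i * d \<and> real i * d < y} \<longleftrightarrow> i \<in> {grid_point d m x..<grid_point d m y}"
      unfolding grid_point_def X_def[symmetric] Y_def[symmetric] by auto
  qed
  also have "(\<Sum>i\<in>\<dots>. f (Suc i) - f i) = f (grid_point d m y) - f (grid_point d m x)"
  proof (rule sum_Suc_diff')
    have "nat \<lceil>x / d\<rceil> \<le> nat \<lceil>y / d\<rceil>"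
      using assms by (intro nat_mono ceiling_mono divide_right_mono) auto
    then show "grid_point d m x \<le> grid_point d m y"
      unfolding grid_point_def by (rule min.mono) simp
  qed
  finally show ?thesis .
qed

lemma dyadic_floor_tendsto: "(\<lambda>k. of_int \<lfloor>x * 2 ^ k\<rfloor> / 2 ^ k) \<longlonglongrightarrow> (x::real)"
proof (rule tendsto_sandwich)
  show "\<forall>\<^sub>F k in sequentially. of_int \<lfloor>x * 2 ^ k\<rfloor> / 2 ^ k \<le> x"
    by (auto simp: field_simps)
  show "\<forall>\<^sub>F k in sequentially. x - (1 / 2) ^ k \<le> of_int \<lfloor>x * 2 ^ k\<rfloor> / 2 ^ k"
  proof (rule always_eventually, rule allI)
    fix k
    have "x - (1 / 2) ^ k = (x * 2 ^ k - 1) / 2 ^ k"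
      by (simp add: field_simps power_one_over)
    also have "\<dots> \<le> of_int \<lfloor>x * 2 ^ k\<rfloor> / 2 ^ k"
      by (intro divide_right_mono) (linarith, simp)
    finally show "x - (1 / 2) ^ k \<le> of_int \<lfloor>x * 2 ^ k\<rfloor> / 2 ^ k" .
  qed
  have "(\<lambda>k. x - (1 / 2) ^ k :: real) \<longlonglongrightarrow> x - 0"
    by (intro tendsto_diff tendsto_const LIMSEQ_power_zero) auto
  then show "(\<lambda>k. x - (1 / 2) ^ k :: real) \<longlonglongrightarrow> x" by simp
qed simp

text \<open>A grid of \<open>2 * 2 ^ k\<close> cells of width \<open>1 / 2 ^ k\<close> ends at time
  2; this is where the stopping at 2 comes from.\<close>

lemma grid_point_tendsto:
  assumes x: "0 \<le> x"
  shows "(\<lambda>k. real (grid_point (1 / 2 ^ k) (2 * 2 ^ k) x) * (1 / 2 ^ k)) \<longlonglongrightarrow> min x 2"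
proof -
  have eq: "real (grid_point (1 / 2 ^ k) (2 * 2 ^ k) x) * (1 / 2 ^ k) = min (of_int \<lceil>x * 2 ^ k\<rceil> / 2 ^ k) 2" for k
  proof -
    define z where "z = \<lceil>x * 2 ^ k\<rceil>"
    have "\<lceil>0::real\<rceil> \<le> z" unfolding z_def using x by (intro ceiling_mono) simp
    then have "real (grid_point (1 / 2 ^ k) (2 * 2 ^ k) x) = min (of_int z) (2 * 2 ^ k)"
      by (simp add: grid_point_def z_def[symmetric] of_nat_min)
    then show ?thesis unfolding z_def[symmetric]
      by (simp add: min_divide_distrib_right)
  qed
  have "(\<lambda>k. - (of_int \<lfloor>- x * 2 ^ k\<rfloor> / 2 ^ k) :: real) \<longlonglongrightarrow> - (- x)"
    by (rule tendsto_minus[OF dyadic_floor_tendsto])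
  then have "(\<lambda>k. of_int \<lceil>x * 2 ^ k\<rceil> / 2 ^ k :: real) \<longlonglongrightarrow> x" by (simp add: ceiling_def)
  then show ?thesis unfolding eq by (intro tendsto_min tendsto_const)
qed

context continuous_bm
begin

lemma W_cont: "continuous_on A (\<lambda>t. W t \<omega>)"
  using unbounded_path.cont[OF W_path] continuous_on_subset by blast

text \<open>\<open>T\<close> is approximated by dyadic times, clamped to the interval from 0 to
  \<open>t\<close>. Each approximation takes countably many values, none after \<open>t\<close>, and
  path continuity gives the limit.\<close>

lemma W_at_past_time:
  assumes T: "T \<in> borel_measurable (past t)" and le: "\<And>\<omega>. 0 \<le> T \<omega> \<and> T \<omega> \<le> t"
  shows "(\<lambda>\<omega>. W (T \<omega>) \<omega>) \<in> borel_measurable (past t)"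
proof (rule borel_measurable_LIMSEQ_real)
  have t: "0 \<le> t" using le order_trans by blast
  fix \<omega>
  have "(\<lambda>k. of_int \<lfloor>T \<omega> * 2 ^ k\<rfloor> / 2 ^ k) \<longlonglongrightarrow> T \<omega>" by (rule dyadic_floor_tendsto)
  then have "(\<lambda>k. max 0 (min (of_int \<lfloor>T \<omega> * 2 ^ k\<rfloor> / 2 ^ k) t)) \<longlonglongrightarrow> max 0 (min (T \<omega>) t)"
    by (intro tendsto_max tendsto_min tendsto_const)
  moreover have "max 0 (min (T \<omega>) t) = T \<omega>" using le[of \<omega>] by auto
  ultimately have "(\<lambda>k. max 0 (min (of_int \<lfloor>T \<omega> * 2 ^ k\<rfloor> / 2 ^ k) t)) \<longlonglongrightarrow> T \<omega>" by simp
  then show "(\<lambda>k. W (max 0 (min (of_int \<lfloor>T \<omega> * 2 ^ k\<rfloor> / 2 ^ k) t)) \<omega>) \<longlonglongrightarrow> W (T \<omega>) \<omega>"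
    by (rule continuous_on_tendsto_compose[OF W_cont[of UNIV]]) auto
next
  have t: "0 \<le> t" using le order_trans by blast
  fix k :: nat
  show "(\<lambda>\<omega>. W (max 0 (min (of_int \<lfloor>T \<omega> * 2 ^ k\<rfloor> / 2 ^ k) t)) \<omega>) \<in> borel_measurable (past t)"
  proof (rule measurable_compose_countable[where f = "\<lambda>i::int. W (max 0 (min (of_int i / 2 ^ k) t))"])
    show "W (max 0 (min (of_int i / 2 ^ k) t)) \<in> borel_measurable (past t)" for i :: int
      using t by (intro W_past) auto
    show "(\<lambda>\<omega>. \<lfloor>T \<omega> * 2 ^ k\<rfloor>) \<in> measurable (past t) (count_space UNIV)"
      using T by measurable
  qed
qed

lemma incr_measurable: "incr d i \<in> borel_measurable M"
  unfolding incr_def[abs_def] by measurable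

section \<open>Embedding times as stopping times\<close>

definition tau :: "nat \<Rightarrow> nat \<Rightarrow> 'a \<Rightarrow> real" where
  "tau n j \<omega> = embedding_time (\<lambda>t. W t \<omega>) n j"

lemma tau_0 [simp]: "tau n 0 \<omega> = 0" by (simp add: tau_def)

lemma tau_nonneg [simp]: "0 \<le> tau n j \<omega>"
  unfolding tau_def by (rule unbounded_path.embedding_time_nonneg[OF W_path])

lemma tau_less_Suc: "tau n j \<omega> < tau n (Suc j) \<omega>"
  unfolding tau_def by (rule unbounded_path.embedding_time_less_Suc[OF W_path])

lemma tau_mono: "i \<le> j \<Longrightarrow> tau n i \<omega> \<le> tau n j \<omega>"
  unfolding tau_def by (rule unbounded_path.embedding_time_mono[OF W_path])

lemma tau_step: "\<bar>W (tau n (Suc j) \<omega>) \<omega> - W (tau n j \<omega>) \<omega>\<bar> = 1 / 2 ^ n"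
  unfolding tau_def using unbounded_path.embedding_step[OF W_path, of \<omega> n j] by auto

lemma tau_between: "tau n j \<omega> \<le> s \<Longrightarrow> s < tau n (Suc j) \<omega> \<Longrightarrow> \<bar>W s \<omega> - W (tau n j \<omega>) \<omega>\<bar> < 1 / 2 ^ n"
  unfolding tau_def using unbounded_path.embedding_between[OF W_path] by auto

lemma min_tau_past:
  assumes "\<And>u. 0 \<le> u \<Longrightarrow> {\<omega>\<in>space M. T \<omega> \<le> u} \<in> sets (past u)" "0 \<le> t" "\<And>\<omega>. 0 \<le> T \<omega>"
  shows "(\<lambda>\<omega>. min (T \<omega>) t) \<in> borel_measurable (past t)"
proof (rule borel_measurableI_le)
  fix u :: real
  consider "t \<le> u" | "u < 0" | "0 \<le> u" "u < t" by linarith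
  then show "{\<omega>\<in>space (past t). min (T \<omega>) t \<le> u} \<in> sets (past t)"
  proof cases
    case 1
    then have "{\<omega>\<in>space (past t). min (T \<omega>) t \<le> u} = space (past t)" by auto
    then show ?thesis by (simp only: sets.top)
  next
    case 2
    then have "\<not> min (T \<omega>) t \<le> u" for \<omega>
      using assms(2) assms(3)[of \<omega>] by (auto simp: min_def)
    then show ?thesis by simp
  next
    case 3
    then have "{\<omega>\<in>space (past t). min (T \<omega>) t \<le> u} = {\<omega>\<in>space M. T \<omega> \<le> u}" by auto
    then show ?thesis using assms(1)[OF 3(1)] past_mono[of u t] 3 by auto
  qed
qed

text \<open>The process \<open>V s\<close> vanishes until the \<open>j\<close>-th embedding time and
  is the displacement since then, so the next embedding time is at most \<open>t\<close> exactly if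
  \<open>V\<close> reaches the step size by \<open>t\<close>. The level being attained, the natural
  filtration suffices.\<close>

lemma tau_past: "0 \<le> t \<Longrightarrow> {\<omega>\<in>space M. tau n j \<omega> \<le> t} \<in> sets (past t)"
proof (induction j arbitrary: t)
  case 0
  then have "{\<omega>\<in>space M. tau n 0 \<omega> \<le> t} = space (past t)" by auto
  then show ?case by (simp only: sets.top)
next
  case (Suc j)
  define V where "V s \<omega> = \<bar>W s \<omega> - W (min (tau n j \<omega>) s) \<omega>\<bar>" for s \<omega>
  have V: "V s \<in> borel_measurable (past t)" if "0 \<le> s" "s \<le> t" for s
  proof (rule measurable_past_mono[OF _ that(2)])
    show "V s \<in> borel_measurable (past s)"
      unfolding V_def[abs_def]
      by (intro borel_measurable_abs borel_measurable_diff W_past W_at_past_time min_tau_past Suc.IH) (use that in auto)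
  qed
  have Vc: "continuous_on {0..t} (\<lambda>s. V s \<omega>)" for \<omega>
    unfolding V_def
    by (intro continuous_intros W_cont continuous_on_compose2[OF W_cont[of UNIV]]) auto
  have "tau n (Suc j) \<omega> \<le> t \<longleftrightarrow> (\<exists>s\<in>{0..t}. 1 / 2 ^ n \<le> V s \<omega>)" for \<omega>
  proof
    assume "tau n (Suc j) \<omega> \<le> t"
    then show "\<exists>s\<in>{0..t}. 1 / 2 ^ n \<le> V s \<omega>"
      using tau_step[of n j \<omega>] tau_less_Suc[of n j \<omega>]
      by (intro bexI[of _ "tau n (Suc j) \<omega>"]) (auto simp: V_def)
  next
    assume "\<exists>s\<in>{0..t}. 1 / 2 ^ n \<le> V s \<omega>"
    then obtain s where s: "s \<in> {0..t}" "1 / 2 ^ n \<le> V s \<omega>" by blast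
    have "\<not> s \<le> tau n j \<omega>"
    proof
      assume "s \<le> tau n j \<omega>"
      then have "V s \<omega> = 0" by (simp add: V_def min_def)
      moreover have "0 < 1 / (2::real) ^ n" by simp
      ultimately show False using s(2) by linarith
    qed
    then have "\<not> s < tau n (Suc j) \<omega>"
      using tau_between[of n j \<omega> s] s(2) by (auto simp: V_def min_def)
    then show "tau n (Suc j) \<omega> \<le> t" using s by auto
  qed
  then have "{\<omega>\<in>space M. tau n (Suc j) \<omega> \<le> t}
      = (\<Inter>m::nat. \<Union>r\<in>\<rat> \<inter> {0..1}. {\<omega>\<in>space (past t). 1 / 2 ^ n - 1 / Suc m < V (t * r) \<omega>})"
    unfolding continuous_reaches_iff[OF Vc Suc.prems] by auto
  also have "\<dots> \<in> sets (past t)"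
  proof (intro sets.countable_INT sets.countable_UN' ballI image_subsetI)
    show "countable (\<rat> \<inter> {0..1::real})" by (simp add: countable_rat)
    fix m :: nat and r :: real assume "r \<in> \<rat> \<inter> {0..1}"
    then have "0 \<le> t * r" "t * r \<le> t" using Suc.prems by (auto simp: mult_left_le)
    from V[OF this] show "{\<omega>\<in>space (past t). 1 / 2 ^ n - 1 / real (Suc m) < V (t * r) \<omega>} \<in> sets (past t)"
      by measurable
  qed auto
  finally show ?case .
qed

lemma W_min_tau_past [measurable (raw)]:
  "0 \<le> t \<Longrightarrow> (\<lambda>\<omega>. W (min (tau n j \<omega>) t) \<omega>) \<in> borel_measurable (past t)"
  by (intro W_at_past_time min_tau_past tau_past) auto

definition at_step :: "nat \<Rightarrow> real \<Rightarrow> nat \<Rightarrow> 'a \<Rightarrow> bool" where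
  "at_step n t j \<omega> \<longleftrightarrow> tau n j \<omega> \<le> t \<and> t < tau n (Suc j) \<omega>"

lemma at_step_excl: "at_step n t i \<omega> \<Longrightarrow> at_step n t j \<omega> \<Longrightarrow> i = j"
  unfolding at_step_def using tau_mono[of "Suc i" j n \<omega>] tau_mono[of "Suc j" i n \<omega>]
  by (meson Suc_leI dual_order.trans le_less_trans less_le_not_le linorder_neqE_nat)

lemma at_step_past:
  assumes t: "0 \<le> t" and f: "f \<in> borel_measurable (past t)" 
  shows "(\<lambda>\<omega>. if at_step n t j \<omega> then f \<omega> else 0 :: real) \<in> borel_measurable (past t)"
proof (rule measurable_If[OF f])
  have "{\<omega>\<in>space (past t). at_step n t j \<omega>}
      = {\<omega>\<in>space M. tau n j \<omega> \<le> t} - {\<omega>\<in>space M. tau n (Suc j) \<omega> \<le> t}"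
    by (auto simp: at_step_def)
  then show "{\<omega>\<in>space (past t). at_step n t j \<omega>} \<in> sets (past t)"
    using tau_past[OF t] by auto
qed simp

lemma W_tau_grid_tendsto:
  "(\<lambda>k. W (real (grid_point (1 / 2 ^ k) (2 * 2 ^ k) (tau n j \<omega>)) * (1 / 2 ^ k)) \<omega>) \<longlonglongrightarrow> W (min (tau n j \<omega>) 2) \<omega>"
  by (rule continuous_on_tendsto_compose[OF W_cont[of UNIV] grid_point_tendsto]) auto

text \<open>Fatou's lemma. Only upper bounds survive the passage to continuous time, but neither
  uniform integrability nor moments of the embedding times are required.\<close>

lemma nn_integral_limit_le:
  assumes u: "\<And>k. u k \<in> borel_measurable M" and lim: "\<And>\<omega>. (\<lambda>k. u k \<omega>) \<longlonglongrightarrow> (v \<omega> :: real)"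
    and le: "\<And>k. (\<integral>\<^sup>+\<omega>. ennreal (u k \<omega>) \<partial>M) \<le> C k" and C: "C \<longlonglongrightarrow> c"
  shows "(\<integral>\<^sup>+\<omega>. ennreal (v \<omega>) \<partial>M) \<le> c"
proof -
  have "ennreal (v \<omega>) = liminf (\<lambda>k. ennreal (u k \<omega>))" for \<omega>
    by (rule lim_imp_Liminf[symmetric]) (auto intro: tendsto_ennrealI lim)
  then have "(\<integral>\<^sup>+\<omega>. ennreal (v \<omega>) \<partial>M) = (\<integral>\<^sup>+\<omega>. liminf (\<lambda>k. ennreal (u k \<omega>)) \<partial>M)" by simp
  also have "\<dots> \<le> liminf (\<lambda>k. \<integral>\<^sup>+\<omega>. ennreal (u k \<omega>) \<partial>M)"
    by (rule nn_integral_liminf) (use u in measurable)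
  also have "\<dots> \<le> liminf C"
    by (rule Liminf_mono) (use le in auto)
  also have "liminf C = c" by (rule lim_imp_Liminf[OF _ C]) simp
  finally show ?thesis .
qed

abbreviation tau2 :: "nat \<Rightarrow> nat \<Rightarrow> 'a \<Rightarrow> real" where "tau2 n j \<omega> \<equiv> min (tau n j \<omega>) 2"

abbreviation V :: "nat \<Rightarrow> nat \<Rightarrow> 'a \<Rightarrow> real" where "V n j \<omega> \<equiv> W (tau n j \<omega>) \<omega>"

abbreviation V2 :: "nat \<Rightarrow> nat \<Rightarrow> 'a \<Rightarrow> real" where "V2 n j \<omega> \<equiv> W (tau2 n j \<omega>) \<omega>"

text \<open>
  For a weight \<open>c\<close> depending on the index and the position of the embedded walk, the first
  quantity is \<open>\<integral> h dW - 1/2 \<integral> h\<^sup>2 dt\<close> for the step function \<open>h\<close> equal to \<open>c j (V n j)\<close> on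
  \<open>[\<tau>\<^sub>j, \<tau>\<^sub>j\<^sub>+\<^sub>1)\<close>, the second one is \<open>2 \<integral> h (W - V n j) dW\<close>; everything is stopped at time 2, so
  that no moments of the embedding times are needed.
\<close>

definition exp_weight :: "nat \<Rightarrow> nat \<Rightarrow> (nat \<Rightarrow> real \<Rightarrow> real) \<Rightarrow> 'a \<Rightarrow> real" where
  "exp_weight n J c \<omega> = (\<Sum>j<J. c j (V n j \<omega>) * (V2 n (Suc j) \<omega> - V2 n j \<omega>)
      - (c j (V n j \<omega>))\<^sup>2 / 2 * (tau2 n (Suc j) \<omega> - tau2 n j \<omega>))"

definition time_defect :: "nat \<Rightarrow> nat \<Rightarrow> (nat \<Rightarrow> real \<Rightarrow> real) \<Rightarrow> 'a \<Rightarrow> real" where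
  "time_defect n J c \<omega> = (\<Sum>j<J. c j (V n j \<omega>) *
      ((V2 n (Suc j) \<omega> - V n j \<omega>)\<^sup>2 - (V2 n j \<omega> - V n j \<omega>)\<^sup>2 - (tau2 n (Suc j) \<omega> - tau2 n j \<omega>)))"

text \<open>In general \<open>V n j\<close> looks beyond time \<open>t\<close>; while step
  \<open>j\<close> is in progress it equals the value of the path stopped at \<open>t\<close>, which
  is known by then.\<close>

lemma step_value_past:
  fixes c :: "real \<Rightarrow> real"
  assumes c: "c \<in> borel_measurable borel" and t: "0 \<le> t"
  shows "(\<lambda>\<omega>. if at_step n t j \<omega> then c (V n j \<omega>) else 0) \<in> borel_measurable (past t)"
proof -
  have "(\<lambda>\<omega>. if at_step n t j \<omega> then c (V n j \<omega>) else 0)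
      = (\<lambda>\<omega>. if at_step n t j \<omega> then c (W (min (tau n j \<omega>) t) \<omega>) else 0)"
    by (auto simp: at_step_def min_def fun_eq_iff)
  moreover have "(\<lambda>\<omega>. if at_step n t j \<omega> then c (W (min (tau n j \<omega>) t) \<omega>) else 0) \<in> borel_measurable (past t)"
    using t by (intro at_step_past measurable_compose[OF _ c] W_min_tau_past)
  ultimately show ?thesis by simp
qed

lemma step_sum_telescope:
  fixes F :: "nat \<Rightarrow> real \<Rightarrow> real"
  assumes "0 < d"
  shows "(\<Sum>i<m. \<Sum>j<J. if at_step n (real i * d) j \<omega> then F j (real (Suc i) * d) - F j (real i * d) else 0)
    = (\<Sum>j<J. F j (real (grid_point d m (tau n (Suc j) \<omega>)) * d) - F j (real (grid_point d m (tau n j \<omega>)) * d))"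
  unfolding sum.swap[of _ "{..<J}"] at_step_def
  by (intro sum.cong refl sum_grid_telescope assms tau_nonneg less_imp_le[OF tau_less_Suc])

text \<open>On grid times within step \<open>j\<close> the summands are increments of
  \<open>F \<omega> j\<close>, so they telescope to the two ends of the step rounded to the grid.
  Path continuity then removes the rounding.\<close>

lemma embedded_exp_martingale:
  fixes c :: "nat \<Rightarrow> real \<Rightarrow> real"
  assumes c: "\<And>j. c j \<in> borel_measurable borel"
  shows "(\<integral>\<^sup>+\<omega>. ennreal (exp (exp_weight n J c \<omega>)) \<partial>M) \<le> 1"
proof -
  define d :: "nat \<Rightarrow> real" where "d k = 1 / 2 ^ k" for k
  define a where "a j \<omega> = c j (V n j \<omega>)" for j \<omega>
  define h where "h k i \<omega> = (\<Sum>j<J. if at_step n (real i * d k) j \<omega> then a j \<omega> else 0)" for k i \<omega>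
  define S where "S k \<omega> = (\<Sum>i<2 * 2 ^ k. h k i \<omega> * incr (d k) i \<omega> - (h k i \<omega>)\<^sup>2 * d k / 2)" for k \<omega>
  define F where "F \<omega> j t = a j \<omega> * W t \<omega> - (a j \<omega>)\<^sup>2 / 2 * t" for j \<omega> t
  have d: "0 < d k" for k by (simp add: d_def)
  have h_past: "h k i \<in> borel_measurable (past (real i * d k))" for k i
    unfolding h_def[abs_def] a_def using d[of k]
    by (intro borel_measurable_sum step_value_past c) simp
  have S_meas: "S k \<in> borel_measurable M" for k
    unfolding S_def[abs_def]
    by (intro borel_measurable_sum borel_measurable_diff borel_measurable_times borel_measurable_divide
        borel_measurable_power measurable_past[OF h_past] incr_measurable borel_measurable_const)
  have S_eq: "S k \<omega> = (\<Sum>j<J. F \<omega> j (real (grid_point (d k) (2 * 2 ^ k) (tau n (Suc j) \<omega>)) * d k)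
      - F \<omega> j (real (grid_point (d k) (2 * 2 ^ k) (tau n j \<omega>)) * d k))" for k \<omega>
  proof -
    have "h k i \<omega> * incr (d k) i \<omega> - (h k i \<omega>)\<^sup>2 * d k / 2
      = (\<Sum>j<J. if at_step n (real i * d k) j \<omega>
          then F \<omega> j (real (Suc i) * d k) - F \<omega> j (real i * d k) else 0)" for i
      \<comment> \<open>The square of \<open>h k i\<close> equals the sum of the squares because at
        most one step is active.\<close>
      unfolding h_def
      by (subst sum_exclusive[where f = "\<lambda>x. x * incr (d k) i \<omega> - x\<^sup>2 * d k / 2"])
        (auto intro!: sum.cong at_step_excl simp: F_def incr_def algebra_simps)
    then show ?thesis unfolding S_def by (simp only: step_sum_telescope[OF d])
  qed
  have lim: "(\<lambda>k. S k \<omega>) \<longlonglongrightarrow> (\<Sum>j<J. F \<omega> j (tau2 n (Suc j) \<omega>) - F \<omega> j (tau2 n j \<omega>))" for \<omega>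
    unfolding S_eq F_def d_def
    by (intro tendsto_intros W_tau_grid_tendsto grid_point_tendsto tau_nonneg)
  have "(\<integral>\<^sup>+\<omega>. ennreal (exp (\<Sum>j<J. F \<omega> j (tau2 n (Suc j) \<omega>) - F \<omega> j (tau2 n j \<omega>))) \<partial>M) \<le> 1"
  proof (rule nn_integral_limit_le)
    show "(\<lambda>\<omega>. exp (S k \<omega>)) \<in> borel_measurable M" for k using S_meas by measurable
    show "(\<lambda>k. exp (S k \<omega>)) \<longlonglongrightarrow> exp (\<Sum>j<J. F \<omega> j (tau2 n (Suc j) \<omega>) - F \<omega> j (tau2 n j \<omega>))" for \<omega>
      by (intro tendsto_exp lim)
    show "(\<integral>\<^sup>+\<omega>. ennreal (exp (S k \<omega>)) \<partial>M) \<le> 1" for k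
      unfolding S_def using discrete_exp_martingale[OF d h_past] by simp
  qed simp
  then show ?thesis by (simp add: exp_weight_def F_def a_def algebra_simps)
qed

text \<open>Expanding \<open>(W t - V n j)\<^sup>2 - t\<close> over one grid cell gives twice the
  current displacement times the increment, plus the squared increment minus the cell width. Hence
  the choice of \<open>h\<close> and \<open>g\<close>.\<close>

lemma embedded_square_martingale:
  fixes c :: "nat \<Rightarrow> real \<Rightarrow> real"
  assumes c: "\<And>j. c j \<in> borel_measurable borel" and c1: "\<And>j x. \<bar>c j x\<bar> \<le> 1"
  shows "(\<integral>\<^sup>+\<omega>. ennreal ((time_defect n J c \<omega>)\<^sup>2) \<partial>M) \<le> ennreal (8 / 4 ^ n)"
proof -
  define d :: "nat \<Rightarrow> real" where "d k = 1 / 2 ^ k" for k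
  define a where "a j \<omega> = c j (V n j \<omega>)" for j \<omega>
  define g where "g k i \<omega> = (\<Sum>j<J. if at_step n (real i * d k) j \<omega> then a j \<omega> else 0)" for k i \<omega>
  define h where "h k i \<omega> = (\<Sum>j<J. if at_step n (real i * d k) j \<omega>
      then a j \<omega> * (W (real i * d k) \<omega> - V n j \<omega>) else 0)" for k i \<omega>
  define S where "S k \<omega> = (\<Sum>i<2 * 2 ^ k. 2 * h k i \<omega> * incr (d k) i \<omega> + g k i \<omega> * ((incr (d k) i \<omega>)\<^sup>2 - d k))" for k \<omega>
  define F where "F \<omega> j t = a j \<omega> * ((W t \<omega> - V n j \<omega>)\<^sup>2 - t)" for j \<omega> t
  have d: "0 < d k" for k by (simp add: d_def)
  have a1: "\<bar>a j \<omega>\<bar> \<le> 1" for j \<omega> using c1 by (simp add: a_def)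
  have g_past: "g k i \<in> borel_measurable (past (real i * d k))" for k i
    unfolding g_def[abs_def] a_def using d[of k]
    by (intro borel_measurable_sum step_value_past c) simp
  have h_past: "h k i \<in> borel_measurable (past (real i * d k))" for k i
  proof -
    have "(\<lambda>\<omega>. if at_step n (real i * d k) j \<omega> then a j \<omega> * (W (real i * d k) \<omega> - V n j \<omega>) else 0)
        = (\<lambda>\<omega>. (if at_step n (real i * d k) j \<omega> then c j (V n j \<omega>) else 0) *
          (W (real i * d k) \<omega> - W (min (tau n j \<omega>) (real i * d k)) \<omega>))" for j
      by (auto simp: at_step_def a_def min_def fun_eq_iff)
    then show ?thesis unfolding h_def[abs_def] using d[of k]
      by (auto intro!: borel_measurable_sum borel_measurable_times borel_measurable_diff step_value_past c
          W_min_tau_past W_past)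
  qed
  have g_le: "\<bar>g k i \<omega>\<bar> \<le> 1" for k i \<omega>
    unfolding g_def by (intro abs_sum_exclusive_le a1 at_step_excl) auto
  \<comment> \<open>Before the step ends the displacement stays below \<open>1 / 2 ^ n\<close>; this
    makes the variance of order \<open>1 / 4 ^ n\<close>.\<close>
  have "\<bar>a j \<omega>\<bar> * \<bar>W t \<omega> - V n j \<omega>\<bar> \<le> 1 * (1 / 2 ^ n)" if "at_step n t j \<omega>" for j t \<omega>
    using that tau_between[of n j \<omega> t] a1
    by (intro mult_mono) (auto simp: at_step_def intro: less_imp_le)
  then have h_le: "\<bar>h k i \<omega>\<bar> \<le> 1 / 2 ^ n" for k i \<omega>
    unfolding h_def by (intro abs_sum_exclusive_le at_step_excl) (auto simp: abs_mult)
  have S_meas: "S k \<in> borel_measurable M" for k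
    unfolding S_def[abs_def]
    by (intro borel_measurable_sum borel_measurable_add borel_measurable_diff borel_measurable_times
        borel_measurable_power measurable_past[OF h_past] measurable_past[OF g_past]
        incr_measurable borel_measurable_const)
  have S_eq: "S k \<omega> = (\<Sum>j<J. F \<omega> j (real (grid_point (d k) (2 * 2 ^ k) (tau n (Suc j) \<omega>)) * d k)
      - F \<omega> j (real (grid_point (d k) (2 * 2 ^ k) (tau n j \<omega>)) * d k))" for k \<omega>
  proof -
    have "2 * h k i \<omega> * incr (d k) i \<omega> + g k i \<omega> * ((incr (d k) i \<omega>)\<^sup>2 - d k)
      = (\<Sum>j<J. if at_step n (real i * d k) j \<omega>
          then F \<omega> j (real (Suc i) * d k) - F \<omega> j (real i * d k) else 0)" for i
      unfolding h_def g_def sum_distrib_left sum_distrib_right sum.distrib[symmetric]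
      by (intro sum.cong refl) (auto simp: F_def incr_def algebra_simps power2_eq_square)
    then show ?thesis unfolding S_def by (simp only: step_sum_telescope[OF d])
  qed
  have lim: "(\<lambda>k. S k \<omega>) \<longlonglongrightarrow> (\<Sum>j<J. F \<omega> j (tau2 n (Suc j) \<omega>) - F \<omega> j (tau2 n j \<omega>))" for \<omega>
    unfolding S_eq F_def d_def
    by (intro tendsto_intros W_tau_grid_tendsto grid_point_tendsto tau_nonneg)
  have "(\<integral>\<^sup>+\<omega>. ennreal ((\<Sum>j<J. F \<omega> j (tau2 n (Suc j) \<omega>) - F \<omega> j (tau2 n j \<omega>))\<^sup>2) \<partial>M) \<le> ennreal (8 / 4 ^ n)"
  proof (rule nn_integral_limit_le)
    show "(\<lambda>\<omega>. (S k \<omega>)\<^sup>2) \<in> borel_measurable M" for k using S_meas by measurable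
    show "(\<lambda>k. (S k \<omega>)\<^sup>2) \<longlonglongrightarrow> (\<Sum>j<J. F \<omega> j (tau2 n (Suc j) \<omega>) - F \<omega> j (tau2 n j \<omega>))\<^sup>2" for \<omega>
      by (intro tendsto_power lim)
    show "(\<integral>\<^sup>+\<omega>. ennreal ((S k \<omega>)\<^sup>2) \<partial>M) \<le> ennreal (real (2 * 2 ^ k) * (4 * (1 / 2 ^ n)\<^sup>2 * d k + 2 * 1\<^sup>2 * (d k)\<^sup>2))" for k
      unfolding S_def by (rule discrete_square_martingale[OF d h_past g_past h_le g_le])
    \<comment> \<open>Twice \<open>2 ^ k\<close> cells times the variance per cell:
      \<open>8 / 4 ^ n\<close> from the stochastic integral, and a mesh term that tends to
      0.\<close>
    have eq: "real (2 * 2 ^ k) * (4 * (1 / 2 ^ n)\<^sup>2 * d k + 2 * 1\<^sup>2 * (d k)\<^sup>2) = 8 / 4 ^ n + 4 * (1 / 2) ^ k" for k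
    proof -
      have "(2::real) ^ n * 2 ^ n = 4 ^ n" by (simp add: power_mult_distrib[symmetric])
      then show ?thesis by (simp add: d_def field_simps power2_eq_square)
    qed
    have "(\<lambda>k. ennreal (8 / 4 ^ n + 4 * (1 / 2) ^ k)) \<longlonglongrightarrow> ennreal (8 / 4 ^ n + 4 * 0)"
      by (intro tendsto_ennrealI tendsto_intros LIMSEQ_power_zero) auto
    then show "(\<lambda>k. ennreal (real (2 * 2 ^ k) * (4 * (1 / 2 ^ n)\<^sup>2 * d k + 2 * 1\<^sup>2 * (d k)\<^sup>2))) \<longlonglongrightarrow> ennreal (8 / 4 ^ n)"
      unfolding eq by simp
  qed
  then show ?thesis by (simp add: time_defect_def F_def a_def algebra_simps)
qed

end

section \<open>Borel-Cantelli bounds\<close>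

lemma (in prob_space) exp_Markov:
  assumes Z: "Z \<in> borel_measurable M" and le: "(\<integral>\<^sup>+\<omega>. ennreal (exp (Z \<omega>)) \<partial>M) \<le> 1"
  shows "prob {\<omega>\<in>space M. r \<le> Z \<omega>} \<le> exp (- r)"
proof -
  have "{\<omega>\<in>space M. r \<le> Z \<omega>} = {\<omega>\<in>space M. 1 \<le> ennreal (exp (- r)) * ennreal (exp (Z \<omega>))}"
    by (auto simp: ennreal_mult'[symmetric] exp_add[symmetric])
  then have "emeasure M {\<omega>\<in>space M. r \<le> Z \<omega>} \<le> ennreal (exp (- r)) * (\<integral>\<^sup>+\<omega>. ennreal (exp (Z \<omega>)) * indicator (space M) \<omega> \<partial>M)"
    using nn_integral_Markov_inequality[of "\<lambda>\<omega>. ennreal (exp (Z \<omega>))" "space M" M "ennreal (exp (- r))"] Z by simp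
  also have "(\<integral>\<^sup>+\<omega>. ennreal (exp (Z \<omega>)) * indicator (space M) \<omega> \<partial>M) = (\<integral>\<^sup>+\<omega>. ennreal (exp (Z \<omega>)) \<partial>M)"
    by (intro nn_integral_cong) auto
  also have "ennreal (exp (- r)) * \<dots> \<le> ennreal (exp (- r)) * 1"
    by (intro mult_left_mono le) simp
  finally show ?thesis by (simp add: emeasure_eq_measure)
qed

lemma (in prob_space) square_Markov:
  assumes Y: "Y \<in> borel_measurable M" and le: "(\<integral>\<^sup>+\<omega>. ennreal ((Y \<omega>)\<^sup>2) \<partial>M) \<le> ennreal v"
    and e: "0 < e" and v: "0 \<le> v"
  shows "prob {\<omega>\<in>space M. e \<le> \<bar>Y \<omega>\<bar>} \<le> v / e\<^sup>2"
proof -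
  have "e \<le> \<bar>Y \<omega>\<bar> \<longleftrightarrow> 1 \<le> 1 / e\<^sup>2 * (Y \<omega>)\<^sup>2" for \<omega>
    using e abs_le_square_iff[of e "Y \<omega>"] by (simp add: field_simps)
  then have "{\<omega>\<in>space M. e \<le> \<bar>Y \<omega>\<bar>} = {\<omega>\<in>space M. 1 \<le> ennreal (1 / e\<^sup>2) * ennreal ((Y \<omega>)\<^sup>2)}"
    by (auto simp: ennreal_mult'[symmetric])
  then have "emeasure M {\<omega>\<in>space M. e \<le> \<bar>Y \<omega>\<bar>} \<le> ennreal (1 / e\<^sup>2) * (\<integral>\<^sup>+\<omega>. ennreal ((Y \<omega>)\<^sup>2) * indicator (space M) \<omega> \<partial>M)"
    using nn_integral_Markov_inequality[of "\<lambda>\<omega>. ennreal ((Y \<omega>)\<^sup>2)" "space M" M "ennreal (1 / e\<^sup>2)"] Y by simp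
  also have "(\<integral>\<^sup>+\<omega>. ennreal ((Y \<omega>)\<^sup>2) * indicator (space M) \<omega> \<partial>M) = (\<integral>\<^sup>+\<omega>. ennreal ((Y \<omega>)\<^sup>2) \<partial>M)"
    by (intro nn_integral_cong) auto
  also have "ennreal (1 / e\<^sup>2) * \<dots> \<le> ennreal (1 / e\<^sup>2) * ennreal v"
    by (intro mult_left_mono le) simp
  also have "\<dots> = ennreal (v / e\<^sup>2)"
    by (simp add: ennreal_mult'[symmetric])
  finally show ?thesis using v by (simp add: emeasure_eq_measure ennreal_le_iff)
qed

lemma (in prob_space) Borel_Cantelli_families:
  assumes fin: "\<And>n. finite (C n)" and card: "\<And>n. real (card (C n)) * p n \<le> K * q ^ n"
    and q: "0 \<le> q" "q < 1"
    and sets: "\<And>n c. c \<in> C n \<Longrightarrow> {\<omega>\<in>space M. P n c \<omega>} \<in> sets M"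
    and p: "\<And>n c. c \<in> C n \<Longrightarrow> prob {\<omega>\<in>space M. P n c \<omega>} \<le> p n"
  shows "AE \<omega> in M. \<forall>\<^sub>F n in sequentially. \<forall>c\<in>C n. \<not> P n c \<omega>"
proof -
  let ?A = "\<lambda>n. \<Union>c\<in>C n. {\<omega>\<in>space M. P n c \<omega>}"
  have A: "?A n \<in> sets M" for n
    using sets fin by (intro sets.finite_UN) auto
  have le: "prob (?A n) \<le> K * q ^ n" for n
  proof -
    have "prob (?A n) \<le> (\<Sum>c\<in>C n. prob {\<omega>\<in>space M. P n c \<omega>})"
      by (rule finite_measure_subadditive_finite) (use fin sets in auto)
    also have "\<dots> \<le> (\<Sum>c\<in>C n. p n)" by (intro sum_mono p)
    also have "\<dots> \<le> K * q ^ n" using card by simp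
    finally show ?thesis .
  qed
  have "AE \<omega> in M. \<forall>\<^sub>F n in sequentially. \<omega> \<in> space M - ?A n"
  proof (rule borel_cantelli_AE1[OF A])
    show "summable (\<lambda>n. prob (?A n))"
      by (rule summable_comparison_test'[OF summable_mult[OF summable_geometric[of q]], of 0])
        (use q le in auto)
  qed (simp add: emeasure_eq_measure)
  then show ?thesis
    by (rule AE_mp) (intro AE_I2 impI, auto elim!: eventually_mono)
qed

context continuous_bm
begin

lemma W_min_tau [measurable]: "(\<lambda>\<omega>. W (min (tau n j \<omega>) (real k)) \<omega>) \<in> borel_measurable M"
  by (rule measurable_past[OF W_min_tau_past]) simp

lemma W_tau [measurable]: "(\<lambda>\<omega>. W (tau n j \<omega>) \<omega>) \<in> borel_measurable M"
proof (rule borel_measurable_LIMSEQ_real)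
  fix \<omega>
  obtain k0 :: nat where "tau n j \<omega> \<le> real k0" using real_arch_simple by blast
  then have "\<forall>\<^sub>F k in sequentially. W (tau n j \<omega>) \<omega> = W (min (tau n j \<omega>) (real k)) \<omega>"
    by (intro eventually_sequentiallyI[of k0]) (simp add: min_def)
  then show "(\<lambda>k. W (min (tau n j \<omega>) (real k)) \<omega>) \<longlonglongrightarrow> W (tau n j \<omega>) \<omega>"
    by (rule tendsto_eventually[OF eventually_mono]) simp
qed measurable

lemma min_tau_2 [measurable]: "(\<lambda>\<omega>. min (tau n j \<omega>) 2) \<in> borel_measurable M"
  by (rule measurable_past[OF min_tau_past[OF tau_past]]) auto

lemma W_min_tau_2 [measurable]: "(\<lambda>\<omega>. W (min (tau n j \<omega>) 2) \<omega>) \<in> borel_measurable M"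
  using W_min_tau[of n j 2] by simp

text \<open>The threshold \<open>8 * real n\<close> beats a union over \<open>16 ^ n\<close> weights
  because \<open>16 * exp (- 8)\<close> is at most \<open>1 / 2\<close>.\<close>

lemma AE_exp_bound:
  fixes C :: "nat \<Rightarrow> (nat \<Rightarrow> real \<Rightarrow> real) set"
  assumes fin: "\<And>n. finite (C n)" and card: "\<And>n. real (card (C n)) \<le> K * 16 ^ n"
    and borel: "\<And>n c j. c \<in> C n \<Longrightarrow> c j \<in> borel_measurable borel"
  shows "AE \<omega> in M. \<forall>\<^sub>F n in sequentially. \<forall>c\<in>C n.
    exp_weight n (4 ^ n) c \<omega> < 8 * real n"
proof -
  have Zm: "exp_weight n (4 ^ n) c \<in> borel_measurable M" if "c \<in> C n" for n c
  proof -
    have [measurable]: "(\<lambda>\<omega>. c j (V n j \<omega>)) \<in> borel_measurable M" for j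
      by (rule measurable_compose[OF W_tau borel[OF that]])
    show ?thesis unfolding exp_weight_def[abs_def] by measurable
  qed
  have "AE \<omega> in M. \<forall>\<^sub>F n in sequentially. \<forall>c\<in>C n. \<not> 8 * real n \<le> exp_weight n (4 ^ n) c \<omega>"
  proof (rule Borel_Cantelli_families[OF fin, where p = "\<lambda>n. exp (- (8 * real n))" and K = K and q = "1 / 2"])
    fix n
    have K: "0 \<le> K" using card[of 0] by (simp add: order_trans[OF of_nat_0_le_iff])
    have "(2::real) ^ 8 \<le> exp 1 ^ 8"
      using exp_ge_add_one_self[of 1] by (intro power_mono) auto
    then have "(32::real) \<le> exp 8" by (simp add: exp_of_nat_mult[symmetric] del: exp_ge_add_one_self)
    then have "16 * exp (- 8) \<le> (1 / 2 :: real)" by (simp add: exp_minus field_simps)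
    then have "(16 * exp (- 8)) ^ n \<le> (1 / 2 :: real) ^ n" by (intro power_mono) auto
    moreover have "exp (- (8 * real n)) = exp (- 8) ^ n"
      by (simp add: exp_of_nat_mult[symmetric] mult.commute)
    ultimately have "16 ^ n * exp (- (8 * real n)) \<le> (1 / 2) ^ n" by (simp add: power_mult_distrib)
    then have "K * (16 ^ n * exp (- (8 * real n))) \<le> K * (1 / 2) ^ n" using K by (rule mult_left_mono)
    moreover have "real (card (C n)) * exp (- (8 * real n)) \<le> K * 16 ^ n * exp (- (8 * real n))"
      by (intro mult_right_mono card) simp
    ultimately show "real (card (C n)) * exp (- (8 * real n)) \<le> K * (1 / 2) ^ n"
      by (metis (no_types, lifting) mult.assoc order_trans)
  next
    fix n c assume c: "c \<in> C n"
    show "{\<omega>\<in>space M. 8 * real n \<le> exp_weight n (4 ^ n) c \<omega>} \<in> sets M" using Zm[OF c] by measurable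
    show "prob {\<omega>\<in>space M. 8 * real n \<le> exp_weight n (4 ^ n) c \<omega>} \<le> exp (- (8 * real n))"
      by (rule exp_Markov[OF Zm[OF c] embedded_exp_martingale[OF borel[OF c]]])
  qed auto
  then show ?thesis by (simp add: not_le)
qed

text \<open>Chebyshev at height \<open>(3 / 4) ^ n\<close> leaves \<open>8 * (4 / 9) ^ n\<close> per
  weight, so \<open>(3 / 2) ^ n\<close> weights still have the summable total rate
  \<open>(2 / 3) ^ n\<close>.\<close>

lemma AE_square_bound:
  fixes C :: "nat \<Rightarrow> (nat \<Rightarrow> real \<Rightarrow> real) set"
  assumes fin: "\<And>n. finite (C n)" and card: "\<And>n. real (card (C n)) \<le> K * (3 / 2) ^ n"
    and borel: "\<And>n c j. c \<in> C n \<Longrightarrow> c j \<in> borel_measurable borel"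
    and le1: "\<And>n c j x. c \<in> C n \<Longrightarrow> \<bar>c j x\<bar> \<le> 1"
  shows "AE \<omega> in M. \<forall>\<^sub>F n in sequentially. \<forall>c\<in>C n.
    \<bar>time_defect n (4 ^ n) c \<omega>\<bar> < (3 / 4) ^ n"
proof -
  have Ym: "time_defect n (4 ^ n) c \<in> borel_measurable M" if "c \<in> C n" for n c
  proof -
    have [measurable]: "(\<lambda>\<omega>. c j (V n j \<omega>)) \<in> borel_measurable M" for j
      by (rule measurable_compose[OF W_tau borel[OF that]])
    show ?thesis unfolding time_defect_def[abs_def] by measurable
  qed
  have "AE \<omega> in M. \<forall>\<^sub>F n in sequentially. \<forall>c\<in>C n. \<not> (3 / 4) ^ n \<le> \<bar>time_defect n (4 ^ n) c \<omega>\<bar>"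
  proof (rule Borel_Cantelli_families[OF fin, where p = "\<lambda>n. 8 / 4 ^ n / ((3 / 4) ^ n)\<^sup>2" and K = "8 * K" and q = "2 / 3"])
    fix n
    have p: "8 / 4 ^ n / ((3 / 4) ^ n)\<^sup>2 = (8::real) * (4 / 9) ^ n"
    proof -
      have "((3 / 4 :: real) ^ n)\<^sup>2 = (9 / 16) ^ n" by (simp add: power2_eq_square power_mult_distrib[symmetric])
      then have "8 / 4 ^ n / ((3 / 4 :: real) ^ n)\<^sup>2 = 8 / (4 * (9 / 16)) ^ n"
        by (simp only: power_mult_distrib divide_divide_eq_left)
      then show ?thesis by (simp add: power_divide)
    qed
    have "real (card (C n)) * (8 * (4 / 9) ^ n) \<le> K * (3 / 2) ^ n * (8 * (4 / 9) ^ n)"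
      by (intro mult_right_mono card) simp
    also have "\<dots> = 8 * K * ((3 / 2) * (4 / 9)) ^ n" by (simp only: power_mult_distrib mult_ac)
    finally show "real (card (C n)) * (8 / 4 ^ n / ((3 / 4) ^ n)\<^sup>2) \<le> 8 * K * (2 / 3) ^ n"
      unfolding p by simp
  next
    fix n c assume c: "c \<in> C n"
    show "{\<omega>\<in>space M. (3 / 4) ^ n \<le> \<bar>time_defect n (4 ^ n) c \<omega>\<bar>} \<in> sets M" using Ym[OF c] by measurable
    show "prob {\<omega>\<in>space M. (3 / 4) ^ n \<le> \<bar>time_defect n (4 ^ n) c \<omega>\<bar>} \<le> 8 / 4 ^ n / ((3 / 4) ^ n)\<^sup>2"
      by (rule square_Markov[OF Ym[OF c] embedded_square_martingale[OF borel[OF c] le1[OF c]]]) auto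
  qed auto
  then show ?thesis by (simp add: not_le)
qed

end

section \<open>A continuous modification\<close>

text \<open>Values at finitely many times are partial sums of consecutive increments, so the
  cylinder event depends only on increments before \<open>t\<close>. Subtracting \<open>B 0\<close>
  makes this hold for every outcome, as \<open>B 0 = 0\<close> is known only almost surely.\<close>

lemma (in prob_space) indep_increments_cylinder:
  fixes B :: "real \<Rightarrow> 'a \<Rightarrow> real"
  assumes B: "\<And>t. 0 \<le> t \<Longrightarrow> B t \<in> borel_measurable M"
    and ind: "\<And>(k::nat) (u::nat \<Rightarrow> real). 0 \<le> u 0 \<Longrightarrow> (\<forall>i<k. u i \<le> u (Suc i)) \<Longrightarrow>
        indep_vars (\<lambda>_. borel) (\<lambda>i \<omega>. B (u (Suc i)) \<omega> - B (u i) \<omega>) {..<k}"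
    and t: "0 \<le> t" and d: "0 < d" and J: "finite J" "J \<subseteq> {0..t}"
    and E: "\<And>s. s \<in> J \<Longrightarrow> E s \<in> sets borel" and A: "A \<in> sets borel"
  shows "prob {\<omega>\<in>space M. (\<forall>s\<in>J. B s \<omega> - B 0 \<omega> \<in> E s) \<and> B (t + d) \<omega> - B t \<omega> \<in> A} =
      prob {\<omega>\<in>space M. \<forall>s\<in>J. B s \<omega> - B 0 \<omega> \<in> E s} * prob {\<omega>\<in>space M. B (t + d) \<omega> - B t \<omega> \<in> A}"
proof -
  \<comment> \<open>With 0 and \<open>t\<close> added, the sorted times start at 0 and end at
    \<open>t\<close>; \<open>u\<close> below appends \<open>t + d\<close>, so that increment number
    \<open>m\<close> is the future one.\<close>
  define L where "L = sorted_list_of_set (insert 0 (insert t J))"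
  define m where "m = length L - 1"
  have setL: "set L = insert 0 (insert t J)" and sL: "sorted L"
    unfolding L_def using J set_sorted_list_of_set[of "insert 0 (insert t J)"]
      sorted_sorted_list_of_set[of "insert 0 (insert t J)"] by blast+
  have len: "length L = Suc m" using setL unfolding m_def by (cases L) auto
  have range: "0 \<le> L ! i" "L ! i \<le> t" if "i \<le> m" for i
    using nth_mem[of i L] that len setL J t by auto
  have mono: "L ! i \<le> L ! j" if "i \<le> j" "j \<le> m" for i j
    using sorted_nth_mono[OF sL that(1)] that len by simp
  have idx: "\<exists>i\<le>m. L ! i = s" if "s \<in> insert 0 (insert t J)" for s
    using that len unfolding setL[symmetric] in_set_conv_nth by (auto simp: less_Suc_eq_le)
  have L0: "L ! 0 = 0" using idx[of 0] mono[of 0] range[of 0] by force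
  have Lm: "L ! m = t" using idx[of t] mono[of _ m] range[of m] by force
  obtain ix where ix: "\<And>s. s \<in> J \<Longrightarrow> ix s \<le> m \<and> L ! (ix s) = s" using idx by (metis insertCI)
  define u where "u i = (if i \<le> m then L ! i else t + d)" for i
  define D where "D i \<omega> = B (u (Suc i)) \<omega> - B (u i) \<omega>" for i \<omega>
  have "indep_vars (\<lambda>_. borel) D {..<Suc m}"
    unfolding D_def[abs_def]
  proof (rule ind)
    show "0 \<le> u 0" using L0 by (simp add: u_def)
    show "\<forall>i<Suc m. u i \<le> u (Suc i)"
      using mono range(2)[of m] d by (auto simp: u_def less_Suc_eq)
  qed
  then have iv: "indep_var (PiM {..<m} (\<lambda>_. borel)) (\<lambda>\<omega>. restrict (\<lambda>i. D i \<omega>) {..<m})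
      (PiM {m} (\<lambda>_. borel)) (\<lambda>\<omega>. restrict (\<lambda>i. D i \<omega>) {m})"
    by (rule indep_var_restrict) auto
  have tel: "(\<Sum>i<ix s. D i \<omega>) = B s \<omega> - B 0 \<omega>" if "s \<in> J" for s \<omega>
    unfolding D_def using ix[OF that] L0 by (subst sum_lessThan_telescope) (simp add: u_def)
  have Dm: "D m \<omega> = B (t + d) \<omega> - B t \<omega>" for \<omega> unfolding D_def u_def using Lm by simp
  define G where "G = {x\<in>space (PiM {..<m} (\<lambda>_. borel)). \<forall>s\<in>J. (\<Sum>i<ix s. x i) \<in> E s}"
  define H where "H = {x\<in>space (PiM {m} (\<lambda>_. borel)). x m \<in> A}"
  have G: "G \<in> sets (PiM {..<m} (\<lambda>_. borel))"
    unfolding G_def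
  proof (intro sets.sets_Collect_finite_All J(1))
    fix s assume s: "s \<in> J"
    have "(\<lambda>x. \<Sum>i<ix s. x i) \<in> borel_measurable (PiM {..<m} (\<lambda>_. borel :: real measure))"
      using ix[OF s] by (intro borel_measurable_sum measurable_component_singleton) auto
    then show "{x\<in>space (PiM {..<m} (\<lambda>_. borel)). (\<Sum>i<ix s. x i) \<in> E s} \<in> sets (PiM {..<m} (\<lambda>_. borel))"
      using E[OF s] by measurable
  qed
  have H: "H \<in> sets (PiM {m} (\<lambda>_. borel))"
    unfolding H_def using A by measurable
  have "(\<Sum>i<ix s. restrict (\<lambda>i. D i \<omega>) {..<m} i) = B s \<omega> - B 0 \<omega>" if "s \<in> J" for s \<omega>
    unfolding tel[OF that, symmetric] using ix[OF that] by (intro sum.cong) auto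
  then have mem: "restrict (\<lambda>i. D i \<omega>) {..<m} \<in> G \<longleftrightarrow> (\<forall>s\<in>J. B s \<omega> - B 0 \<omega> \<in> E s)"
    "restrict (\<lambda>i. D i \<omega>) {m} \<in> H \<longleftrightarrow> B (t + d) \<omega> - B t \<omega> \<in> A" for \<omega>
    unfolding G_def H_def by (auto simp: space_PiM Dm)
  have "{\<omega>\<in>space M. (\<forall>s\<in>J. B s \<omega> - B 0 \<omega> \<in> E s) \<and> B (t + d) \<omega> - B t \<omega> \<in> A}
      = (\<lambda>\<omega>. (restrict (\<lambda>i. D i \<omega>) {..<m}, restrict (\<lambda>i. D i \<omega>) {m})) -` (G \<times> H) \<inter> space M"
    "{\<omega>\<in>space M. \<forall>s\<in>J. B s \<omega> - B 0 \<omega> \<in> E s} = (\<lambda>\<omega>. restrict (\<lambda>i. D i \<omega>) {..<m}) -` G \<inter> space M"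
    "{\<omega>\<in>space M. B (t + d) \<omega> - B t \<omega> \<in> A} = (\<lambda>\<omega>. restrict (\<lambda>i. D i \<omega>) {m}) -` H \<inter> space M"
    using mem by auto
  then show ?thesis using indep_varD[OF iv G H] by simp
qed

lemma (in prob_space) normal_small_ball:
  assumes X: "distributed M lborel X (normal_density 0 s)" and s: "0 < s" and K: "0 \<le> K"
  shows "prob {\<omega>\<in>space M. \<bar>X \<omega>\<bar> \<le> K} \<le> 2 * K / s"
proof -
  have "emeasure M (X -` {-K..K} \<inter> space M) = (\<integral>\<^sup>+x. ennreal (normal_density 0 s x) * indicator {-K..K} x \<partial>lborel)"
    by (rule distributed_emeasure[OF X]) simp
  also have "\<dots> \<le> (\<integral>\<^sup>+x. ennreal (1 / s) * indicator {-K..K} x \<partial>lborel)"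
  proof (intro nn_integral_mono mult_right_mono ennreal_leI)
    fix x :: real
    have "1 \<le> sqrt (2 * pi)" using pi_gt3 by (intro real_le_rsqrt) simp
    then have "s \<le> sqrt (2 * pi) * s" using s by simp
    moreover have "sqrt (2 * pi * s\<^sup>2) = sqrt (2 * pi) * s" using s by (simp add: real_sqrt_mult)
    ultimately have "1 / sqrt (2 * pi * s\<^sup>2) \<le> 1 / s" using s by (simp add: frac_le)
    then show "normal_density 0 s x \<le> 1 / s"
      unfolding normal_density_def using s by (intro order_trans[OF mult_left_le]) auto
  qed simp
  also have "\<dots> = ennreal (2 * K / s)"
    using K s by (simp add: nn_integral_cmult ennreal_mult'[symmetric])
  finally have "emeasure M (X -` {-K..K} \<inter> space M) \<le> ennreal (2 * K / s)" .
  moreover have "X -` {-K..K} \<inter> space M = {\<omega>\<in>space M. \<bar>X \<omega>\<bar> \<le> K}" by auto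
  ultimately show ?thesis using K s by (simp add: emeasure_eq_measure)
qed

text \<open>The probability that all values at integer times stay within a fixed bound is at most
  that for time \<open>k\<close> alone, which is of order \<open>1 / sqrt k\<close>.\<close>

lemma brownian_unbounded:
  assumes "standard_brownian_motion M B"
  shows "AE \<omega> in M. \<forall>K. \<exists>t\<ge>0. K < \<bar>B t \<omega>\<bar>"
proof -
  interpret prob_space M using assms by (simp add: standard_brownian_motion_def)
  have B [measurable]: "B (real k) \<in> borel_measurable M" "B 0 \<in> borel_measurable M" for k
    using assms by (auto simp: standard_brownian_motion_def)
  have B0: "AE \<omega> in M. B 0 \<omega> = 0" using assms by (simp add: standard_brownian_motion_def)
  have dist: "distributed M lborel (\<lambda>\<omega>. B (real k) \<omega> - B 0 \<omega>) (normal_density 0 (sqrt (real k)))" if "0 < k" for k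
  proof -
    have "\<forall>s t. 0 \<le> s \<and> s < t \<longrightarrow>
        distributed M lborel (\<lambda>\<omega>. B t \<omega> - B s \<omega>) (normal_density 0 (sqrt (t - s)))"
      using assms unfolding standard_brownian_motion_def by blast
    from this[rule_format, of 0 "real k"] show ?thesis using that by simp
  qed
  have "AE \<omega> in M. \<exists>k. real K < \<bar>B (real k) \<omega> - B 0 \<omega>\<bar>" for K :: nat
  proof -
    let ?N = "{\<omega>\<in>space M. \<forall>k. \<bar>B (real k) \<omega> - B 0 \<omega>\<bar> \<le> real K}"
    have N: "?N \<in> sets M" by measurable
    have "prob ?N \<le> 2 * real K / sqrt (real k)" if "k \<ge> 1" for k
    proof -
      have "prob ?N \<le> prob {\<omega>\<in>space M. \<bar>B (real k) \<omega> - B 0 \<omega>\<bar> \<le> real K}"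
        by (intro finite_measure_mono) auto
      also have "\<dots> \<le> 2 * real K / sqrt (real k)"
        using that by (intro normal_small_ball dist) auto
      finally show ?thesis .
    qed
    moreover have "(\<lambda>k. 2 * real K / sqrt (real k)) \<longlonglongrightarrow> 0"
      by (intro tendsto_divide_0[OF tendsto_const] filterlim_at_top_imp_at_infinity
          filterlim_compose[OF sqrt_at_top filterlim_real_sequentially])
    ultimately have "prob ?N \<le> 0"
      by (intro LIMSEQ_le_const[of _ 0]) auto
    then have "?N \<in> null_sets M" using N by (simp add: null_sets_def emeasure_eq_measure measure_le_0_iff)
    then show ?thesis by (rule AE_I'[of ?N]) (auto simp: not_less)
  qed
  then have "AE \<omega> in M. \<forall>K::nat. \<exists>k. real K < \<bar>B (real k) \<omega> - B 0 \<omega>\<bar>"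
    by (simp add: AE_all_countable)
  with B0 show ?thesis
  proof eventually_elim
    case (elim \<omega>)
    show ?case
    proof
      fix K :: real
      obtain K' :: nat where "K \<le> real K'" using real_arch_simple by blast
      moreover obtain k :: nat where "real K' < \<bar>B (real k) \<omega> - B 0 \<omega>\<bar>" using elim by blast
      ultimately show "\<exists>t\<ge>0. K < \<bar>B t \<omega>\<bar>"
        using elim(1) by (intro exI[of _ "real k"]) auto
    qed
  qed
qed

text \<open>The increment laws and the product formula are statements about probabilities, so they
  survive a change on a null set.\<close>

lemma continuous_modification:
  assumes bm: "standard_brownian_motion M B"
  obtains W where "continuous_bm M W" "AE \<omega> in M. \<forall>t\<ge>0. W t \<omega> = B t \<omega>"
proof -
  interpret prob_space M using bm by (simp add: standard_brownian_motion_def)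
  have B: "\<And>t. 0 \<le> t \<Longrightarrow> B t \<in> borel_measurable M"
    and B0: "AE \<omega> in M. B 0 \<omega> = 0"
    and Bd: "\<And>s t. 0 \<le> s \<Longrightarrow> s < t \<Longrightarrow>
        distributed M lborel (\<lambda>\<omega>. B t \<omega> - B s \<omega>) (normal_density 0 (sqrt (t - s)))"
    and Bi: "\<And>(k::nat) (u::nat \<Rightarrow> real). 0 \<le> u 0 \<Longrightarrow> (\<forall>i<k. u i \<le> u (Suc i)) \<Longrightarrow>
        indep_vars (\<lambda>_. borel) (\<lambda>i \<omega>. B (u (Suc i)) \<omega> - B (u i) \<omega>) {..<k}"
    and Bc: "AE \<omega> in M. continuous_on {0..} (\<lambda>t. B t \<omega>)"
    using bm unfolding standard_brownian_motion_def by blast+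
  have "AE \<omega> in M. B 0 \<omega> = 0 \<and> continuous_on {0..} (\<lambda>t. B t \<omega>) \<and> (\<forall>K. \<exists>t\<ge>0. K < \<bar>B t \<omega>\<bar>)"
    using B0 Bc brownian_unbounded[OF bm] by eventually_elim auto
  then obtain N where N: "N \<in> null_sets M"
    and good_all: "\<And>\<omega>. \<omega> \<in> space M - N \<Longrightarrow>
      B 0 \<omega> = 0 \<and> continuous_on {0..} (\<lambda>t. B t \<omega>) \<and> (\<forall>K. \<exists>t\<ge>0. K < \<bar>B t \<omega>\<bar>)"
    by (rule AE_E3) blast
  note good = good_all[THEN conjunct1] good_all[THEN conjunct2, THEN conjunct1]
    good_all[THEN conjunct2, THEN conjunct2]
  \<comment> \<open>On the null set the path \<open>t \<mapsto> t\<close> keeps every path continuous and unbounded, so that all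
    embedding times are finite without exception.\<close>
  define W where "W t \<omega> = (if \<omega> \<in> space M - N then B (max t 0) \<omega> else t)" for t \<omega>
  have WB: "AE \<omega> in M. \<forall>t\<ge>0. W t \<omega> = B t \<omega>"
    using AE_not_in[OF N] by (rule AE_mp) (auto simp: W_def intro!: AE_I2)
  have W0: "AE \<omega> in M. \<forall>t\<ge>0. W t \<omega> = B t \<omega> - B 0 \<omega>"
    using WB B0 by eventually_elim auto
  have Wm: "W t \<in> borel_measurable M" for t
    unfolding W_def[abs_def] using B[of "max t 0"] N by (intro measurable_If) auto
  have "continuous_bm M W"
  proof unfold_locales
    show "W t \<in> borel_measurable M" for t by (rule Wm)
    fix \<omega>
    show "continuous_on UNIV (\<lambda>t. W t \<omega>)"
    proof (cases "\<omega> \<in> space M - N")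
      case True
      have "continuous_on UNIV (\<lambda>t. B (max t 0) \<omega>)"
        by (rule continuous_on_compose2[OF good(2)[OF True]]) (auto intro: continuous_intros)
      then show ?thesis using True by (simp add: W_def)
    qed (auto simp: W_def intro: continuous_intros)
    show "W 0 \<omega> = 0" using good(1) by (auto simp: W_def)
    show "\<exists>t\<ge>0. K < \<bar>W t \<omega>\<bar>" for K
    proof (cases "\<omega> \<in> space M - N")
      case True
      then obtain t where "t \<ge> 0" "K < \<bar>B t \<omega>\<bar>" using good(3) by blast
      then show ?thesis using True by (intro exI[of _ t]) (auto simp: W_def)
    next
      case False
      then show ?thesis by (intro exI[of _ "\<bar>K\<bar> + 1"]) (auto simp: W_def)
    qed
  next
    fix t d :: real assume td: "0 \<le> t" "0 < d"
    have Bm: "B (t + d) \<in> borel_measurable M" "B t \<in> borel_measurable M" using B td by auto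
    have "distr M lborel (\<lambda>\<omega>. W (t + d) \<omega> - W t \<omega>) = distr M lborel (\<lambda>\<omega>. B (t + d) \<omega> - B t \<omega>)"
    proof (rule distr_cong_AE)
      show "AE \<omega> in M. W (t + d) \<omega> - W t \<omega> = B (t + d) \<omega> - B t \<omega>"
        using WB by eventually_elim (use td in simp)
    qed (use Wm Bm in auto)
    then show "distributed M lborel (\<lambda>\<omega>. W (t + d) \<omega> - W t \<omega>) (normal_density 0 (sqrt d))"
      using Bd[of t "t + d"] td Wm unfolding distributed_def by auto
    fix J :: "real set" and E A assume J: "finite J" "J \<subseteq> {0..t}"
      and E: "\<And>s. s \<in> J \<Longrightarrow> E s \<in> sets (borel :: real measure)" and A: "A \<in> sets (borel :: real measure)"
    have [measurable]: "(\<lambda>\<omega>. B s \<omega> - B 0 \<omega>) \<in> borel_measurable M" if "s \<in> J" for s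
      using B J that by (intro borel_measurable_diff) auto
    have J1: "{\<omega>\<in>space M. \<forall>s\<in>J. W s \<omega> \<in> E s} \<in> sets M"
      and J2: "{\<omega>\<in>space M. \<forall>s\<in>J. B s \<omega> - B 0 \<omega> \<in> E s} \<in> sets M"
      using J(1) E Wm by measurable
    have I1: "{\<omega>\<in>space M. W (t + d) \<omega> - W t \<omega> \<in> A} \<in> sets M"
      and I2: "{\<omega>\<in>space M. B (t + d) \<omega> - B t \<omega> \<in> A} \<in> sets M"
      using A Wm Bm by measurable
    have JI: "{\<omega>\<in>space M. P \<omega> \<and> Q \<omega>} \<in> sets M"
      if "{\<omega>\<in>space M. P \<omega>} \<in> sets M" "{\<omega>\<in>space M. Q \<omega>} \<in> sets M" for P Q
      using sets.Int[OF that] by (simp add: Int_def conj_ac cong: conj_cong)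
    have AEJ: "AE \<omega> in M. (\<forall>s\<in>J. W s \<omega> \<in> E s) \<longleftrightarrow> (\<forall>s\<in>J. B s \<omega> - B 0 \<omega> \<in> E s)"
      using W0
    proof eventually_elim
      case (elim \<omega>)
      then have "W s \<omega> = B s \<omega> - B 0 \<omega>" if "s \<in> J" for s
        using J that by auto
      then show ?case by simp
    qed
    have AEI: "AE \<omega> in M. W (t + d) \<omega> - W t \<omega> \<in> A \<longleftrightarrow> B (t + d) \<omega> - B t \<omega> \<in> A"
      using WB by eventually_elim (use td in auto)
    have "prob {\<omega>\<in>space M. (\<forall>s\<in>J. W s \<omega> \<in> E s) \<and> W (t + d) \<omega> - W t \<omega> \<in> A}
        = prob {\<omega>\<in>space M. (\<forall>s\<in>J. B s \<omega> - B 0 \<omega> \<in> E s) \<and> B (t + d) \<omega> - B t \<omega> \<in> A}"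
      by (rule measure_eq_AE) (use AEJ AEI in \<open>eventually_elim, auto\<close>, intro JI J1 I1, intro JI J2 I2)
    moreover have "prob {\<omega>\<in>space M. \<forall>s\<in>J. W s \<omega> \<in> E s} = prob {\<omega>\<in>space M. \<forall>s\<in>J. B s \<omega> - B 0 \<omega> \<in> E s}"
      by (rule measure_eq_AE) (use AEJ in \<open>eventually_elim, auto\<close>, intro J1, intro J2)
    moreover have "prob {\<omega>\<in>space M. W (t + d) \<omega> - W t \<omega> \<in> A} = prob {\<omega>\<in>space M. B (t + d) \<omega> - B t \<omega> \<in> A}"
      by (rule measure_eq_AE) (use AEI in \<open>eventually_elim, auto\<close>, intro I1, intro I2)
    ultimately show "prob {\<omega>\<in>space M. (\<forall>s\<in>J. W s \<omega> \<in> E s) \<and> W (t + d) \<omega> - W t \<omega> \<in> A} =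
      prob {\<omega>\<in>space M. \<forall>s\<in>J. W s \<omega> \<in> E s} * prob {\<omega>\<in>space M. W (t + d) \<omega> - W t \<omega> \<in> A}"
      using indep_increments_cylinder[OF B Bi td J E A] by simp
  qed
  then show thesis using WB that by blast
qed

section \<open>Almost sure bounds for the embedded walks\<close>

text \<open>
  The clauses bound the total time, the time spent below a level (on the grid of mesh \<open>(3/4)\<^sup>n\<close>),
  and the three martingales that occur in Tanaka's formula. The rates only have to be geometric and
  nested: times are known up to \<open>(3/4)\<^sup>n\<close>, the local time of the walk is averaged over windows of
  length \<open>(7/8)\<^sup>n\<close>, and the exponential inequality is used with parameter \<open>(16/15)\<^sup>n\<close>, so that
  \<open>(7/8) (16/15) < 15/16\<close> makes fluctuations over a window of order \<open>n (15/16)\<^sup>n\<close>.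
\<close>

definition walk_bounds :: "(real \<Rightarrow> real) \<Rightarrow> nat \<Rightarrow> bool" where
  "walk_bounds b n \<longleftrightarrow> (let T = embedding_time b n; s = (\<lambda>j. b (T j)) in
     T (4 ^ n) \<le> 2 \<and> \<bar>T (4 ^ n) - 1\<bar> \<le> (3 / 4) ^ n \<and>
     (\<forall>i::int. \<bar>of_int i\<bar> \<le> (3 / 2 :: real) ^ n \<longrightarrow>
       \<bar>\<Sum>j<4 ^ n. if s j \<le> of_int i * (3 / 4) ^ n then 1 / 4 ^ n - (T (Suc j) - T j) else 0\<bar> \<le> (3 / 4) ^ n) \<and>
     (\<forall>a\<in>{- (4 ^ n)..4 ^ n :: int}.
       - tanaka_sum s (4 ^ n) (of_int a / 2 ^ n) \<le> 8 * real n + 1) \<and>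
     (\<forall>a\<in>{- (4 ^ n)..4 ^ n :: int}. \<forall>a'\<in>{- (4 ^ n)..4 ^ n :: int}.
       (tanaka_sum s (4 ^ n) (of_int a / 2 ^ n) - tanaka_sum s (4 ^ n) (of_int a' / 2 ^ n)) * (16 / 15) ^ n
       \<le> 8 * real n + ((16 / 15) ^ n)\<^sup>2 / 2 *
         (\<Sum>j<4 ^ n. (sgn (s j - of_int a / 2 ^ n) - sgn (s j - of_int a' / 2 ^ n))\<^sup>2 * (T (Suc j) - T j))) \<and>
     (\<forall>a\<in>{- (4 ^ n)..4 ^ n :: int}. \<forall>J\<le>4 ^ n.
       \<bar>level_sum s J (of_int a / 2 ^ n)\<bar> * (16 / 15) ^ n
       \<le> 8 * real n + ((16 / 15) ^ n)\<^sup>2 / 2 *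
         (\<Sum>j<4 ^ n. if s j = of_int a / 2 ^ n then T (Suc j) - T j else 0)))"

lemma card_int_interval_le: "real (card {- (4 ^ n)..4 ^ n :: int}) \<le> 3 * 4 ^ n"
proof -
  have "real (card {- (4 ^ n)..4 ^ n :: int}) = of_int (2 * 4 ^ n + 1)"
    by (simp add: nat_add_distrib nat_mult_distrib)
  also have "\<dots> \<le> (3 * 4 ^ n :: real)" by simp
  finally show ?thesis .
qed

lemma int_ball_eq: "{i::int. \<bar>of_int i\<bar> \<le> (r::real)} = {- \<lfloor>r\<rfloor>..\<lfloor>r\<rfloor>}"
  by (auto simp: abs_le_iff le_floor_iff minus_le_iff)

lemma card_int_ball_le: "0 \<le> r \<Longrightarrow> real (card {i::int. \<bar>of_int i\<bar> \<le> (r::real)}) \<le> 2 * r + 1"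
  unfolding int_ball_eq by (simp add: of_nat_nat)

context continuous_bm
begin

text \<open>The sign is reversed since an upper bound for visit counts needs an upper bound for
  minus the Tanaka sum. No growing factor: this is the crude bound with parameter 1.\<close>

definition sgn_steps :: "nat \<Rightarrow> int \<Rightarrow> nat \<Rightarrow> real \<Rightarrow> real" where
  "sgn_steps n a j x = - sgn (x - of_int a / 2 ^ n)"

definition sgn_diff_steps :: "nat \<Rightarrow> int \<times> int \<Rightarrow> nat \<Rightarrow> real \<Rightarrow> real" where
  "sgn_diff_steps n p j x = (16 / 15) ^ n * (sgn (x - of_int (fst p) / 2 ^ n) - sgn (x - of_int (snd p) / 2 ^ n))"

text \<open>The component \<open>snd p\<close> runs over 1 and -1, turning the one-sided exponential
  inequality into a bound for the absolute value; the cutoff \<open>snd (fst p)\<close> covers all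
  partial sums.\<close>

definition level_steps :: "nat \<Rightarrow> (int \<times> nat) \<times> real \<Rightarrow> nat \<Rightarrow> real \<Rightarrow> real" where
  "level_steps n p j x =
    (if j < snd (fst p) \<and> x = of_int (fst (fst p)) / 2 ^ n then snd p * (16 / 15) ^ n else 0)"

definition level_set_steps :: "nat \<Rightarrow> int \<Rightarrow> nat \<Rightarrow> real \<Rightarrow> real" where
  "level_set_steps n i j x = (if x \<le> of_int i * (3 / 4) ^ n then 1 else 0)"

text \<open>If time 2 came first, the \<open>4 ^ n\<close> stopped squared displacements would add
  up to at most 1 against an elapsed time of 2, so the defect would be at most -1, beyond the
  assumed bound. Once this is known, stopping at 2 has no effect.\<close>

lemma embedded_time_le_2:
  assumes "\<bar>time_defect n (4 ^ n) (\<lambda>_ _. 1) \<omega>\<bar> < (3 / 4) ^ n" (is "\<bar>?Y\<bar> < _")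
  shows "tau n (4 ^ n) \<omega> \<le> 2"
proof (rule ccontr)
  assume gt: "\<not> tau n (4 ^ n) \<omega> \<le> 2"
  have "(V2 n (Suc j) \<omega> - V n j \<omega>)\<^sup>2 - (V2 n j \<omega> - V n j \<omega>)\<^sup>2 \<le> 1 / 4 ^ n" for j
  proof (cases "tau n j \<omega> < 2")
    case True
    have "\<bar>V2 n (Suc j) \<omega> - V n j \<omega>\<bar> \<le> 1 / 2 ^ n"
      using tau_step[of n j \<omega>] tau_between[of n j \<omega> 2] True by (auto simp: min_def not_le)
    then have "(V2 n (Suc j) \<omega> - V n j \<omega>)\<^sup>2 \<le> (1 / 2 ^ n)\<^sup>2"
      by (rule power2_le_iff_abs_le[THEN iffD2, rotated]) simp
    moreover have "(1 / 2 ^ n :: real)\<^sup>2 = 1 / 4 ^ n"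
      by (simp add: power2_eq_square power_mult_distrib[symmetric])
    ultimately show ?thesis using True by (simp add: min_def)
  next
    case False
    then show ?thesis using tau_less_Suc[of n j \<omega>] by (simp add: min_def)
  qed
  then have "?Y \<le> (\<Sum>j<4 ^ n. 1 / 4 ^ n - (tau2 n (Suc j) \<omega> - tau2 n j \<omega>))"
    unfolding time_defect_def by (intro sum_mono) simp
  also have "\<dots> = 1 - (\<Sum>j<4 ^ n. tau2 n (Suc j) \<omega> - tau2 n j \<omega>)"
    by (simp add: sum_subtractf)
  also have "(\<Sum>j<4 ^ n. tau2 n (Suc j) \<omega> - tau2 n j \<omega>) = 2"
    using gt by (subst sum_lessThan_telescope) simp
  finally have "?Y \<le> - 1" by simp
  moreover have "(3 / 4 :: real) ^ n \<le> 1" by (simp add: power_le_one)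
  ultimately show False using assms by simp
qed

lemma AE_walk_bounds: "AE \<omega> in M. \<forall>\<^sub>F n in sequentially. walk_bounds (\<lambda>t. W t \<omega>) n"
proof -
  define I where "I n = {- (4 ^ n)..4 ^ n :: int}" for n :: nat
  define C where "C n = sgn_steps n ` I n \<union> sgn_diff_steps n ` (I n \<times> I n)
      \<union> level_steps n ` ((I n \<times> {..4 ^ n}) \<times> {1, - 1})" for n
  define G where "G n = insert (\<lambda>_ _. 1) (level_set_steps n ` {i. \<bar>of_int i\<bar> \<le> (3 / 2 :: real) ^ n})" for n
  have finI: "finite (I n)" for n by (simp add: I_def)
  have "AE \<omega> in M. \<forall>\<^sub>F n in sequentially. \<forall>c\<in>C n.
    exp_weight n (4 ^ n) c \<omega> < 8 * real n"
  proof (rule AE_exp_bound)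
    show "finite (C n)" for n unfolding C_def using finI by auto
    \<comment> \<open>Single levels, pairs, and triples of level, cutoff and sign give at most
      \<open>3 + 9 + 12\<close> times \<open>16 ^ n\<close> weights.\<close>
    show "real (card (C n)) \<le> 24 * 16 ^ n" for n
    proof -
      have "card (C n) \<le> card (I n) + card (I n \<times> I n) + card ((I n \<times> {..4 ^ n :: nat}) \<times> {1, - 1 :: real})"
        unfolding C_def
        by (intro order_trans[OF card_Un_le] add_mono card_image_le) (use finI in auto)
      also have "\<dots> = card (I n) + card (I n) * card (I n) + card (I n) * (4 ^ n + 1) * 2"
        by (simp add: card_cartesian_product)
      finally have "real (card (C n)) \<le> real (card (I n)) + real (card (I n)) * real (card (I n)) + real (card (I n)) * (4 ^ n + 1) * 2"
        unfolding of_nat_le_iff[where 'a = real, symmetric] by (simp add: algebra_simps)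
      also have "\<dots> \<le> 3 * 4 ^ n + (3 * 4 ^ n) * (3 * 4 ^ n) + (3 * 4 ^ n) * (4 ^ n + 4 ^ n) * 2"
        using card_int_interval_le[of n] unfolding I_def by (intro add_mono mult_mono) auto
      also have "\<dots> \<le> 24 * (4 ^ n * 4 ^ n)"
        using mult_right_mono[of 1 "4 ^ n" "4 ^ n :: real"] by (simp add: algebra_simps)
      also have "(4 ^ n * 4 ^ n :: real) = 16 ^ n" by (simp add: power_mult_distrib[symmetric])
      finally show ?thesis .
    qed
    fix n c j assume "c \<in> C n"
    then show "c j \<in> borel_measurable borel"
      unfolding C_def
      by (auto simp: sgn_steps_def[abs_def] sgn_diff_steps_def[abs_def] level_steps_def[abs_def])
  qed
  moreover have "AE \<omega> in M. \<forall>\<^sub>F n in sequentially. \<forall>c\<in>G n.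
    \<bar>time_defect n (4 ^ n) c \<omega>\<bar> < (3 / 4) ^ n"
  proof (rule AE_square_bound)
    have fin: "finite {i::int. \<bar>of_int i\<bar> \<le> (3 / 2 :: real) ^ n}" for n
      unfolding int_ball_eq by simp
    then show "finite (G n)" for n unfolding G_def by simp
    show "real (card (G n)) \<le> 4 * (3 / 2) ^ n" for n
    proof -
      have "card (G n) \<le> Suc (card {i::int. \<bar>of_int i\<bar> \<le> (3 / 2 :: real) ^ n})"
        unfolding G_def using card_image_le[OF fin, of "level_set_steps n" n]
        by (intro order_trans[OF card_insert_le_m1[of "Suc _"]]) (auto intro: le_trans)
      then have "real (card (G n)) \<le> 2 * (3 / 2) ^ n + 1 + 1"
        using card_int_ball_le[of "(3 / 2) ^ n"] by simp
      moreover have "(1::real) \<le> (3 / 2) ^ n" by (rule one_le_power) simp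
      ultimately show ?thesis by linarith
    qed
    fix n c j and x :: real assume "c \<in> G n"
    then show "c j \<in> borel_measurable borel" "\<bar>c j x\<bar> \<le> 1"
      unfolding G_def by (auto simp: level_set_steps_def[abs_def])
  qed
  ultimately show ?thesis
  proof eventually_elim
    case (elim \<omega>)
    from elim show ?case
    proof eventually_elim
      case (elim n)
      define T where "T j = tau n j \<omega>" for j
      define s where "s j = W (T j) \<omega>" for j
      have le2: "T (4 ^ n) \<le> 2"
        unfolding T_def by (rule embedded_time_le_2) (use elim(2) in \<open>auto simp: G_def\<close>)
      \<comment> \<open>All stopped quantities become the actual ones from here on.\<close>
      have min2: "min (T j) 2 = T j" if "j \<le> 4 ^ n" for j
        using tau_mono[OF that, of n \<omega>] le2 by (simp add: T_def)
      have D0: "0 \<le> T (Suc j) - T j" for j using tau_less_Suc[of n j \<omega>] by (simp add: T_def less_imp_le)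
      have D_sum: "(\<Sum>j<4 ^ n. T (Suc j) - T j) = T (4 ^ n)"
        by (subst sum_lessThan_telescope) (simp add: T_def)
      have E: "(\<Sum>j<4 ^ n. c j (s j) * (s (Suc j) - s j)) \<le> 8 * real n + (\<Sum>j<4 ^ n. (c j (s j))\<^sup>2 / 2 * (T (Suc j) - T j))"
        if "c \<in> C n" for c
      proof -
        have "(\<Sum>j<4 ^ n. c j (s j) * (s (Suc j) - s j) - (c j (s j))\<^sup>2 / 2 * (T (Suc j) - T j)) < 8 * real n"
        proof -
          have "(\<Sum>j<4 ^ n. c j (s j) * (s (Suc j) - s j) - (c j (s j))\<^sup>2 / 2 * (T (Suc j) - T j))
            = exp_weight n (4 ^ n) c \<omega>"
            using min2 unfolding exp_weight_def s_def T_def by (intro sum.cong refl) simp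
          then show ?thesis using elim(1) that by simp
        qed
        then show ?thesis by (simp add: sum_subtractf)
      qed
      have S: "\<bar>\<Sum>j<4 ^ n. c j (s j) * (1 / 4 ^ n - (T (Suc j) - T j))\<bar> \<le> (3 / 4) ^ n" if "c \<in> G n" for c
      proof -
        \<comment> \<open>An embedded step has a deterministic squared length, so
          \<open>time_defect\<close> compares \<open>1 / 4 ^ n\<close> with the true duration of the
          step.\<close>
        have sq: "(s (Suc j) - s j)\<^sup>2 = 1 / 4 ^ n" for j
        proof -
          have "(s (Suc j) - s j)\<^sup>2 = \<bar>s (Suc j) - s j\<bar>\<^sup>2" by simp
          also have "\<dots> = (1 / 2 ^ n)\<^sup>2" unfolding s_def T_def tau_step ..
          also have "\<dots> = 1 / 4 ^ n" by (simp add: power2_eq_square power_mult_distrib[symmetric])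
          finally show ?thesis .
        qed
        have "(\<Sum>j<4 ^ n. c j (s j) * (1 / 4 ^ n - (T (Suc j) - T j))) =
          time_defect n (4 ^ n) c \<omega>"
          unfolding time_defect_def
        proof (intro sum.cong refl)
          fix j :: nat assume "j \<in> {..<4 ^ n}"
          then show "c j (s j) * (1 / 4 ^ n - (T (Suc j) - T j)) = c j (V n j \<omega>) *
            ((V2 n (Suc j) \<omega> - V n j \<omega>)\<^sup>2 - (V2 n j \<omega> - V n j \<omega>)\<^sup>2
            - (tau2 n (Suc j) \<omega> - tau2 n j \<omega>))"
            using min2[of j] min2[of "Suc j"] sq[of j] unfolding s_def T_def by simp
        qed
        then show ?thesis using less_imp_le[OF elim(2)[rule_format, OF that]] by (simp only:)
      qed
      have 1: "\<bar>T (4 ^ n) - 1\<bar> \<le> (3 / 4) ^ n"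
        using S[of "\<lambda>_ _. 1"] D_sum by (simp add: G_def sum_subtractf abs_minus_commute)
      have 2: "\<bar>\<Sum>j<4 ^ n. if s j \<le> of_int i * (3 / 4) ^ n then 1 / 4 ^ n - (T (Suc j) - T j) else 0\<bar> \<le> (3 / 4) ^ n"
        if "\<bar>of_int i\<bar> \<le> (3 / 2 :: real) ^ n" for i :: int
      proof -
        have "(\<Sum>j<4 ^ n. if s j \<le> of_int i * (3 / 4) ^ n then 1 / 4 ^ n - (T (Suc j) - T j) else 0)
          = (\<Sum>j<4 ^ n. level_set_steps n i j (s j) * (1 / 4 ^ n - (T (Suc j) - T j)))"
          by (intro sum.cong refl) (simp add: level_set_steps_def)
        then show ?thesis using S[of "level_set_steps n i"] that by (auto simp: G_def)
      qed
      have 3: "- tanaka_sum s (4 ^ n) (of_int a / 2 ^ n) \<le> 8 * real n + 1" if "a \<in> I n" for a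
      proof -
        \<comment> \<open>The quadratic term is at most half of the total time, hence at most 1;
          this is the summand 1 in the third family of bounds.\<close>
        have "(\<Sum>j<4 ^ n. (sgn_steps n a j (s j))\<^sup>2 / 2 * (T (Suc j) - T j)) \<le> (\<Sum>j<4 ^ n. 1 / 2 * (T (Suc j) - T j))"
          by (intro sum_mono mult_right_mono D0) (simp add: sgn_steps_def sgn_if)
        also have "\<dots> \<le> 1" unfolding sum_distrib_left[symmetric] D_sum using le2 by simp
        finally show ?thesis
          using E[of "sgn_steps n a"] that by (auto simp: C_def sgn_steps_def sum_negf tanaka_sum_def)
      qed
      have 4: "(tanaka_sum s (4 ^ n) (of_int a / 2 ^ n) - tanaka_sum s (4 ^ n) (of_int a' / 2 ^ n)) * (16 / 15) ^ n
       \<le> 8 * real n + ((16 / 15) ^ n)\<^sup>2 / 2 *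
         (\<Sum>j<4 ^ n. (sgn (s j - of_int a / 2 ^ n) - sgn (s j - of_int a' / 2 ^ n))\<^sup>2 * (T (Suc j) - T j))"
        if "a \<in> I n" "a' \<in> I n" for a a'
      proof -
        have "sgn_diff_steps n (a, a') \<in> C n" using that by (auto simp: C_def)
        from E[OF this] show ?thesis
          unfolding tanaka_sum_def sum_subtractf[symmetric] left_diff_distrib[symmetric] sum_distrib_right sum_distrib_left
          by (simp add: sgn_diff_steps_def power_mult_distrib mult_ac)
      qed
      have 5: "\<bar>level_sum s J (of_int a / 2 ^ n)\<bar> * (16 / 15) ^ n
       \<le> 8 * real n + ((16 / 15) ^ n)\<^sup>2 / 2 *
         (\<Sum>j<4 ^ n. if s j = of_int a / 2 ^ n then T (Suc j) - T j else 0)"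
        if a: "a \<in> I n" and J: "J \<le> 4 ^ n" for a J
      proof -
        let ?R = "(\<Sum>j<4 ^ n. if s j = of_int a / 2 ^ n then T (Suc j) - T j else 0)"
        let ?L = "level_sum s J (of_int a / 2 ^ n)"
        have "x * ?L * (16 / 15) ^ n \<le> 8 * real n + ((16 / 15) ^ n)\<^sup>2 / 2 * ?R" if x: "x \<in> {1, - 1}" for x
        proof -
          have "level_steps n ((a, J), x) \<in> C n" using a J x unfolding C_def by auto
          note e = E[OF this]
          have "(\<Sum>j<4 ^ n. level_steps n ((a, J), x) j (s j) * (s (Suc j) - s j))
            = (\<Sum>j<J. level_steps n ((a, J), x) j (s j) * (s (Suc j) - s j))"
            using J by (intro sum.mono_neutral_right) (auto simp: level_steps_def)
          also have "\<dots> = x * ?L * (16 / 15) ^ n"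
            unfolding level_sum_def sum_distrib_right sum_distrib_left
            by (intro sum.cong refl) (auto simp: level_steps_def)
          finally have L: "(\<Sum>j<4 ^ n. level_steps n ((a, J), x) j (s j) * (s (Suc j) - s j)) = x * ?L * (16 / 15) ^ n" .
          \<comment> \<open>Dropping the cutoff in the quadratic term makes the bound uniform in
            \<open>J\<close>.\<close>
          have "(\<Sum>j<4 ^ n. (level_steps n ((a, J), x) j (s j))\<^sup>2 / 2 * (T (Suc j) - T j))
            \<le> (\<Sum>j<4 ^ n. ((16 / 15) ^ n)\<^sup>2 / 2 * (if s j = of_int a / 2 ^ n then T (Suc j) - T j else 0))"
            using D0 x by (intro sum_mono) (auto simp: level_steps_def power_mult_distrib)
          then show ?thesis using e unfolding L sum_distrib_left[symmetric] by linarith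
        qed
        from this[of 1] this[of "- 1"] show ?thesis by (auto simp: abs_if)
      qed
      show ?case
        unfolding walk_bounds_def Let_def tau_def[symmetric]
        unfolding T_def[symmetric] s_def[symmetric] I_def[symmetric]
        by (intro conjI allI ballI impI; fact le2 1 2 3 4 5)
    qed
  qed
qed

end

section \<open>Occupation measures\<close>

lemma floor_diff_bounds:
  fixes x y :: real
  assumes "y \<le> x"
  shows "\<bar>real (card {\<lfloor>y\<rfloor><..\<lfloor>x\<rfloor>}) - (x - y)\<bar> \<le> 1"
proof -
  have "\<lfloor>y\<rfloor> \<le> \<lfloor>x\<rfloor>" using assms by (rule floor_mono)
  then have "real (card {\<lfloor>y\<rfloor><..\<lfloor>x\<rfloor>}) = of_int \<lfloor>x\<rfloor> - of_int \<lfloor>y\<rfloor>" by (simp add: of_nat_nat)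
  then show ?thesis by linarith
qed

lemma fmeasurable_intervals: "{x..y::real} \<in> fmeasurable lborel" "{x..<y::real} \<in> fmeasurable lborel"
proof -
  show *: "{x..y::real} \<in> fmeasurable lborel" for x y
    by (simp add: fmeasurable_def emeasure_lborel_Icc_eq)
  show "{x..<y::real} \<in> fmeasurable lborel" by (rule fmeasurableI2[OF *[of x y]]) auto
qed

lemma measure_Icc_le: "y - x \<le> d \<Longrightarrow> 0 \<le> d \<Longrightarrow> measure lborel {x..y::real} \<le> d"
  by (cases "x \<le> y") auto

lemma power_bounds: "(1 / 2 ^ n :: real) \<le> (3 / 4) ^ n" "(0::real) < (3 / 4) ^ n" "(0::real) < 1 / 2 ^ n"
    "(3 / 4 :: real) ^ n \<le> 1" "(1 / 2 ^ n :: real) \<le> 1"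
  by (auto simp: power_one_over[symmetric] power_le_one intro!: power_mono simp del: power_one_over)

lemma round_to_grid:
  fixes x r :: real
  assumes "0 < r"
  shows "x \<le> of_int \<lceil>x / r\<rceil> * r" "of_int \<lceil>x / r\<rceil> * r \<le> x + r"
    "of_int \<lfloor>x / r\<rfloor> * r \<le> x" "x - r \<le> of_int \<lfloor>x / r\<rfloor> * r"
proof -
  have "of_int \<lceil>x / r\<rceil> \<le> x / r + 1" "x / r - 1 \<le> of_int \<lfloor>x / r\<rfloor>" by linarith+
  then have "of_int \<lceil>x / r\<rceil> * r \<le> (x / r + 1) * r" "(x / r - 1) * r \<le> of_int \<lfloor>x / r\<rfloor> * r"
    using assms by (auto intro: mult_right_mono)
  then show "of_int \<lceil>x / r\<rceil> * r \<le> x + r" "x - r \<le> of_int \<lfloor>x / r\<rfloor> * r"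
    using assms by (simp_all add: algebra_simps)
  show "x \<le> of_int \<lceil>x / r\<rceil> * r" "of_int \<lfloor>x / r\<rfloor> * r \<le> x"
    using assms by (simp_all add: pos_divide_le_eq[symmetric] pos_le_divide_eq[symmetric])
qed

declare embedding_time.simps(2) [simp del]

text \<open>One path satisfying the almost sure bounds. The constant \<open>R\<close> bounds it up
  to time 2 because the first \<open>4 ^ n\<close> embedding times eventually lie there.\<close>

locale embedded_walks = unbounded_path b for b :: "real \<Rightarrow> real" +
  fixes R :: real
  assumes bounds: "\<forall>\<^sub>F n in sequentially. walk_bounds b n"
    and R_bound: "\<And>t. 0 \<le> t \<Longrightarrow> t \<le> 2 \<Longrightarrow> \<bar>b t\<bar> < R"
begin

abbreviation s :: "nat \<Rightarrow> nat \<Rightarrow> real" where "s n j \<equiv> b (T n j)"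

text \<open>The local time of the walk: a visit lasts \<open>1 / 4 ^ n\<close> on average and levels
  are \<open>1 / 2 ^ n\<close> apart, so time per length is visits over
  \<open>2 ^ n\<close>.\<close>

definition occ :: "nat \<Rightarrow> real \<Rightarrow> real" where
  "occ n a = (\<Sum>j<4 ^ n. if s n j = a then 1 else 0) / 2 ^ n"

definition walk_cdf :: "nat \<Rightarrow> real \<Rightarrow> real" where
  "walk_cdf n a = (\<Sum>j<4 ^ n. if s n j \<le> a then 1 else 0) / 4 ^ n"

text \<open>A go-between for \<open>walk_cdf\<close> and \<open>cdf\<close>: real durations as in
  the latter, positions only at embedding times as in the former.\<close>

definition time_cdf :: "nat \<Rightarrow> real \<Rightarrow> real" where
  "time_cdf n a = (\<Sum>j<4 ^ n. if s n j \<le> a then T n (Suc j) - T n j else 0)"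

definition cdf :: "real \<Rightarrow> real" where
  "cdf a = measure lborel {t\<in>{0..1}. b t \<le> a}"

definition P :: "nat \<Rightarrow> real" where "P n = R + 8 * real n + 1"

text \<open>The two growth conditions ensure that levels up to \<open>R + 3\<close> lie among the
  lattice levels, respectively the coarse grid levels, covered by \<open>walk_bounds\<close>; note
  \<open>(9 / 8) ^ n = (3 / 2) ^ n * (3 / 4) ^ n\<close>.\<close>

definition good :: "nat \<Rightarrow> bool" where
  "good n \<longleftrightarrow> walk_bounds b n \<and> R + 3 \<le> 2 ^ n \<and> R + 3 \<le> (9 / 8) ^ n"

lemma R_pos: "0 < R"
  using R_bound[of 0] by simp

lemma P_ge: "1 \<le> P n" "8 * real n \<le> P n" "R \<le> P n"
  using R_pos by (auto simp: P_def)

lemma eventually_good: "\<forall>\<^sub>F n in sequentially. good n"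
proof -
  have "\<forall>\<^sub>F n in sequentially. R + 3 \<le> c ^ n" if c: "1 < c" for c :: real
  proof -
    obtain N where N: "R + 3 < c ^ N" using real_arch_pow[OF c] by blast
    show ?thesis
    proof (rule eventually_sequentiallyI[of N])
      fix n assume "N \<le> n"
      then have "c ^ N \<le> c ^ n" using c by (intro power_increasing) auto
      then show "R + 3 \<le> c ^ n" using N by simp
    qed
  qed
  from this[of 2] this[of "9 / 8"] bounds show ?thesis
    unfolding good_def by (simp add: eventually_conj_iff)
qed

lemma lattice: "lattice_walk (s n) (1 / 2 ^ n)"
proof
  show "b (T n 0) = 0" by (simp add: start)
  show "s n (Suc j) - s n j \<in> {1 / 2 ^ n, - (1 / 2 ^ n)}" for j by (rule embedding_step)
  show "\<exists>z::int. s n j = of_int z * (1 / 2 ^ n)" for j using embedding_integer[of n j] by auto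
qed simp

lemma visits_occ: "1 / 2 ^ n * real (lattice_walk.visits (s n) (4 ^ n) a) = occ n a"
  unfolding lattice_walk.visits_def[OF lattice] occ_def card_less_Collect by simp

lemma occ_tanaka:
  "occ n (of_int z / 2 ^ n) = \<bar>s n (4 ^ n) - of_int z / 2 ^ n\<bar> - \<bar>of_int z / 2 ^ n\<bar>
    - tanaka_sum (s n) (4 ^ n) (of_int z / 2 ^ n)"
  using lattice_walk.discrete_tanaka[OF lattice, of "of_int z / 2 ^ n" z n "4 ^ n"]
  unfolding visits_occ by simp

lemma D_nonneg: "0 \<le> T n (Suc j) - T n j"
  using embedding_time_less_Suc[of n j] by simp

lemma good_T: "good n \<Longrightarrow> j \<le> 4 ^ n \<Longrightarrow> T n j \<le> 2"
  using embedding_time_mono[of j "4 ^ n" n] by (auto simp: good_def walk_bounds_def Let_def)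

lemma good_range: "good n \<Longrightarrow> j \<le> 4 ^ n \<Longrightarrow> \<bar>s n j\<bar> < R"
  by (rule R_bound[OF embedding_time_nonneg good_T])

lemma occ_nonneg: "0 \<le> occ n a"
  unfolding occ_def by (auto intro!: divide_nonneg_nonneg sum_nonneg)

lemma occ_outside: "good n \<Longrightarrow> R \<le> \<bar>a\<bar> \<Longrightarrow> occ n a = 0"
proof -
  assume n: "good n" and a: "R \<le> \<bar>a\<bar>"
  have "s n j \<noteq> a" if "j < 4 ^ n" for j using good_range[OF n, of j] that a by auto
  then show ?thesis unfolding occ_def by (auto intro!: sum.neutral)
qed

text \<open>In Tanaka's formula the two absolute values differ by at most the final position, which
  is below \<open>R\<close>. The rest is the martingale bound with parameter 1.\<close>

lemma occ_le:
  assumes n: "good n" shows "occ n a \<le> P n"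
proof (cases "\<exists>j<4 ^ n. s n j = a")
  case True
  then obtain j where j: "j < 4 ^ n" "s n j = a" by blast
  obtain z :: int where z: "s n j = of_int z / 2 ^ n" "\<bar>z\<bar> \<le> int j" using embedding_integer by blast
  have "int j \<le> 4 ^ n" using j(1) by (metis of_nat_le_iff of_nat_numeral of_nat_power less_imp_le)
  then have zI: "z \<in> {- (4 ^ n)..4 ^ n}" using z(2) unfolding atLeastAtMost_iff by linarith
  have a: "a = of_int z / 2 ^ n" using j z by simp
  have "- tanaka_sum (s n) (4 ^ n) (of_int z / 2 ^ n) \<le> 8 * real n + 1"
    using n zI by (simp add: good_def walk_bounds_def Let_def)
  moreover have "\<bar>s n (4 ^ n)\<bar> < R" using good_range[OF n] by simp
  ultimately show ?thesis unfolding a occ_tanaka P_def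
    by (smt (verit))
next
  case False
  then have "occ n a = 0" unfolding occ_def by (auto intro!: sum.neutral)
  then show ?thesis using P_ge(1)[of n] by simp
qed

section \<open>Comparison of the occupation measures of walk and path\<close>

lemma walk_cdf_diff:
  assumes xy: "y \<le> x"
  shows "walk_cdf n x - walk_cdf n y = 1 / 2 ^ n * (\<Sum>z\<in>{\<lfloor>y * 2 ^ n\<rfloor><..\<lfloor>x * 2 ^ n\<rfloor>}. occ n (of_int z / 2 ^ n))"
proof -
  let ?Z = "{\<lfloor>y * 2 ^ n\<rfloor><..\<lfloor>x * 2 ^ n\<rfloor>}"
  have "(if s n j \<le> x then 1 else 0) - (if s n j \<le> y then 1 else 0) = (\<Sum>z\<in>?Z. if s n j = of_int z / 2 ^ n then 1 else (0::real))" for j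
  proof -
    obtain u :: int where u: "s n j = of_int u / 2 ^ n" using embedding_integer by blast
    have "(\<Sum>z\<in>?Z. if s n j = of_int z / 2 ^ n then 1 else (0::real)) = (\<Sum>z\<in>?Z. if u = z then 1 else 0)"
      unfolding u by (intro sum.cong) auto
    also have "\<dots> = (if u \<in> ?Z then 1 else 0)" by simp
    also have "\<dots> = (if s n j \<le> x then 1 else 0) - (if s n j \<le> y then 1 else 0)"
    proof -
      have "s n j \<le> w \<longleftrightarrow> u \<le> \<lfloor>w * 2 ^ n\<rfloor>" for w
        unfolding u le_floor_iff by (simp add: pos_divide_le_eq)
      then show ?thesis using xy by (auto dest: order_trans)
    qed
    finally show ?thesis by simp
  qed
  then have "(\<Sum>j<4 ^ n. if s n j \<le> x then 1 else 0) - (\<Sum>j<4 ^ n. if s n j \<le> y then 1 else 0)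
      = (\<Sum>j<4 ^ n. \<Sum>z\<in>?Z. if s n j = of_int z / 2 ^ n then 1 else (0::real))"
    by (simp only: sum_subtractf[symmetric])
  also have "\<dots> = (\<Sum>z\<in>?Z. 2 ^ n * occ n (of_int z / 2 ^ n))"
    by (subst sum.swap) (simp add: occ_def)
  finally have "walk_cdf n x - walk_cdf n y = (2 ^ n * (\<Sum>z\<in>?Z. occ n (of_int z / 2 ^ n))) / 4 ^ n"
    unfolding walk_cdf_def by (simp add: diff_divide_distrib[symmetric] sum_distrib_left)
  also have "(4 ^ n :: real) = 2 ^ n * 2 ^ n" by (simp add: power_mult_distrib[symmetric])
  finally show ?thesis by simp
qed

lemma walk_cdf_increment:
  assumes n: "good n" and xy: "y \<le> x"
  shows "walk_cdf n x - walk_cdf n y \<le> (x - y + 1 / 2 ^ n) * P n"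
proof -
  let ?Z = "{\<lfloor>y * 2 ^ n\<rfloor><..\<lfloor>x * 2 ^ n\<rfloor>}"
  have "real (card ?Z) \<le> (x * 2 ^ n - y * 2 ^ n) + 1"
    using floor_diff_bounds[of "y * 2 ^ n" "x * 2 ^ n"] xy by (simp add: abs_le_iff)
  then have c: "1 / 2 ^ n * real (card ?Z) \<le> x - y + 1 / 2 ^ n"
    by (simp add: field_simps)
  have "walk_cdf n x - walk_cdf n y \<le> 1 / 2 ^ n * (\<Sum>z\<in>?Z. P n)"
    unfolding walk_cdf_diff[OF xy] by (intro mult_left_mono sum_mono occ_le[OF n]) auto
  also have "\<dots> = 1 / 2 ^ n * real (card ?Z) * P n" by simp
  also have "\<dots> \<le> (x - y + 1 / 2 ^ n) * P n"
    using c P_ge(1)[of n] by (intro mult_right_mono) auto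
  finally show ?thesis .
qed

lemma good_total: "good n \<Longrightarrow> \<bar>T n (4 ^ n) - 1\<bar> \<le> (3 / 4) ^ n"
  by (simp add: good_def walk_bounds_def Let_def)

lemma sublevel_fmeasurable: "{t\<in>{0..1}. b t \<le> a} \<in> fmeasurable lborel" "{t\<in>{0..1}. b t < a} \<in> fmeasurable lborel"
proof -
  have [measurable]: "b \<in> borel_measurable borel" by (rule borel_measurable_continuous_onI[OF cont])
  have "{t\<in>{0..1}. b t \<le> a} = {0..1} \<inter> {t\<in>space borel. b t \<le> a}"
    "{t\<in>{0..1}. b t < a} = {0..1} \<inter> {t\<in>space borel. b t < a}" by auto
  then show "{t\<in>{0..1}. b t \<le> a} \<in> fmeasurable lborel" "{t\<in>{0..1}. b t < a} \<in> fmeasurable lborel"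
    by (auto intro!: fmeasurableI2[OF fmeasurable_intervals(1)[of 0 1]])
qed

text \<open>During a step the path stays within \<open>1 / 2 ^ n\<close> of its starting position,
  so levels shift by that much; times not covered by the first \<open>4 ^ n\<close> steps have
  length at most \<open>(3 / 4) ^ n\<close>.\<close>

lemma cdf_le_time_cdf:
  assumes n: "good n"
  shows "cdf a \<le> time_cdf n (a + 1 / 2 ^ n) + (3 / 4) ^ n"
proof -
  let ?S = "{j\<in>{..<4 ^ n}. s n j \<le> a + 1 / 2 ^ n}"
  let ?I = "\<lambda>j. {T n j..<T n (Suc j)}"
  have "{t\<in>{0..1}. b t \<le> a} \<subseteq> (\<Union>j\<in>?S. ?I j) \<union> {T n (4 ^ n)..1}"
  proof
    fix t assume t: "t \<in> {t\<in>{0..1}. b t \<le> a}"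
    show "t \<in> (\<Union>j\<in>?S. ?I j) \<union> {T n (4 ^ n)..1}"
    proof (cases "T n (4 ^ n) \<le> t")
      case False
      \<comment> \<open>The step in progress at time \<open>t\<close>: minimality says that the
        previous one has ended.\<close>
      define j where "j = (LEAST j. t < T n (Suc j))"
      have ex: "t < T n (Suc (4 ^ n))" using False embedding_time_less_Suc[of n "4 ^ n"] by linarith
      have j: "t < T n (Suc j)" unfolding j_def by (rule LeastI[of "\<lambda>j. t < T n (Suc j)", OF ex])
      have j': "T n j \<le> t"
      proof (cases j)
        case (Suc i)
        then show ?thesis using not_less_Least[of i "\<lambda>j. t < T n (Suc j)"] by (simp add: j_def)
      qed (use t in simp)
      have "j < 4 ^ n"
      proof (rule ccontr)
        assume "\<not> j < 4 ^ n"
        then show False using embedding_time_mono[of "4 ^ n" j n] j' False by linarith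
      qed
      moreover have "s n j \<le> a + 1 / 2 ^ n" using embedding_between[OF j' j] t by auto
      ultimately show ?thesis using j j' by auto
    qed (use t in auto)
  qed
  then have "cdf a \<le> measure lborel ((\<Union>j\<in>?S. ?I j) \<union> {T n (4 ^ n)..1})"
    unfolding cdf_def using sublevel_fmeasurable(1)[of a]
    by (intro measure_mono_fmeasurable fmeasurable.Un fmeasurable.finite_UN fmeasurable_intervals fmeasurableD)
      auto
  also have "\<dots> \<le> measure lborel (\<Union>j\<in>?S. ?I j) + measure lborel {T n (4 ^ n)..1}"
    by (rule measure_Un_le) auto
  also have "measure lborel (\<Union>j\<in>?S. ?I j) \<le> (\<Sum>j\<in>?S. measure lborel (?I j))"
    by (rule measure_UNION_le) auto
  also have "\<dots> = time_cdf n (a + 1 / 2 ^ n)"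
    unfolding time_cdf_def using D_nonneg
    by (subst sum.inter_filter) (auto intro!: sum.cong)
  also have "measure lborel {T n (4 ^ n)..1} \<le> (3 / 4) ^ n"
    using good_total[OF n] by (intro measure_Icc_le) auto
  finally show ?thesis by simp
qed

lemma time_cdf_le_cdf:
  assumes n: "good n"
  shows "time_cdf n a \<le> cdf (a + 1 / 2 ^ n) + (3 / 4) ^ n"
proof -
  let ?S = "{j\<in>{..<4 ^ n}. s n j \<le> a}"
  let ?I = "\<lambda>j. {T n j..<T n (Suc j)}"
  have "(\<Union>j\<in>?S. ?I j) \<subseteq> {t\<in>{0..1}. b t \<le> a + 1 / 2 ^ n} \<union> {1..T n (4 ^ n)}"
  proof
    fix t assume "t \<in> (\<Union>j\<in>?S. ?I j)"
    then obtain j where j: "j < 4 ^ n" "s n j \<le> a" "T n j \<le> t" "t < T n (Suc j)" by auto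
    have "b t \<le> a + 1 / 2 ^ n" using embedding_between[OF j(3,4)] j(2) by linarith
    moreover have "t \<le> T n (4 ^ n)" using j embedding_time_mono[of "Suc j" "4 ^ n" n] by linarith
    moreover have "0 \<le> t" using embedding_time_nonneg[of n j] j(3) by linarith
    ultimately show "t \<in> {t\<in>{0..1}. b t \<le> a + 1 / 2 ^ n} \<union> {1..T n (4 ^ n)}" by auto
  qed
  then have "measure lborel (\<Union>j\<in>?S. ?I j) \<le> measure lborel ({t\<in>{0..1}. b t \<le> a + 1 / 2 ^ n} \<union> {1..T n (4 ^ n)})"
    by (intro measure_mono_fmeasurable fmeasurable.Un sublevel_fmeasurable(1) fmeasurable_intervals) auto
  also have "\<dots> \<le> cdf (a + 1 / 2 ^ n) + measure lborel {1..T n (4 ^ n)}"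
    unfolding cdf_def by (intro measure_Un_le fmeasurableD sublevel_fmeasurable(1) fmeasurable_intervals)
  also have "measure lborel {1..T n (4 ^ n)} \<le> (3 / 4) ^ n"
    using good_total[OF n] by (intro measure_Icc_le) auto
  finally have "measure lborel (\<Union>j\<in>?S. ?I j) \<le> cdf (a + 1 / 2 ^ n) + (3 / 4) ^ n" by simp
  moreover have "measure lborel (\<Union>j\<in>?S. ?I j) = (\<Sum>j\<in>?S. measure lborel (?I j))"
  proof (rule measure_finite_Union)
    show "disjoint_family_on ?I ?S"
      unfolding disjoint_family_on_def
    proof (intro ballI impI)
      fix i j :: nat assume "i \<noteq> j"
      then show "?I i \<inter> ?I j = {}"
        using embedding_time_mono[of "Suc i" j n] embedding_time_mono[of "Suc j" i n]
        by (cases "i < j") auto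
    qed
  qed (auto simp: fmeasurableD2[OF fmeasurable_intervals(2)])
  moreover have "\<dots> = time_cdf n a"
    unfolding time_cdf_def using D_nonneg
    by (subst sum.inter_filter) (auto intro!: sum.cong)
  ultimately show ?thesis by simp
qed

lemma time_cdf_mono: "y \<le> x \<Longrightarrow> time_cdf n y \<le> time_cdf n x"
  unfolding time_cdf_def using D_nonneg by (intro sum_mono) auto

lemma walk_cdf_time_cdf:
  assumes n: "good n" and i: "\<bar>of_int i\<bar> \<le> (3 / 2 :: real) ^ n"
  shows "\<bar>walk_cdf n (of_int i * (3 / 4) ^ n) - time_cdf n (of_int i * (3 / 4) ^ n)\<bar> \<le> (3 / 4) ^ n"
proof -
  have "walk_cdf n (of_int i * (3 / 4) ^ n) - time_cdf n (of_int i * (3 / 4) ^ n)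
    = (\<Sum>j<4 ^ n. if s n j \<le> of_int i * (3 / 4) ^ n then 1 / 4 ^ n - (T n (Suc j) - T n j) else 0)"
    unfolding walk_cdf_def time_cdf_def sum_divide_distrib sum_subtractf[symmetric]
    by (intro sum.cong) auto
  then show ?thesis using n i by (simp add: good_def walk_bounds_def Let_def)
qed

lemma cdf_mono: "y \<le> x \<Longrightarrow> cdf y \<le> cdf x"
  unfolding cdf_def by (intro measure_mono_fmeasurable fmeasurableD sublevel_fmeasurable(1)) auto

lemma cdf_above: "R \<le> a \<Longrightarrow> cdf a = 1"
proof -
  assume "R \<le> a"
  then have "{t\<in>{0..1}. b t \<le> a} = {0..1}" using R_bound by fastforce
  then show ?thesis by (simp add: cdf_def)
qed

lemma cdf_below: "a \<le> - R \<Longrightarrow> cdf a = 0"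
proof -
  assume "a \<le> - R"
  then have "{t\<in>{0..1}. b t \<le> a} = {}" using R_bound by fastforce
  then show ?thesis by (simp only: cdf_def measure_empty)
qed

lemma grid_index:
  assumes n: "good n" and g: "\<bar>of_int i * (3 / 4) ^ n\<bar> \<le> R + 3"
  shows "\<bar>of_int i\<bar> \<le> (3 / 2 :: real) ^ n"
proof -
  have "\<bar>of_int i\<bar> * (3 / 4) ^ n \<le> (9 / 8 :: real) ^ n"
    using g n by (simp add: good_def abs_mult)
  also have "\<dots> = (3 / 2) ^ n * (3 / 4) ^ n" by (simp add: power_mult_distrib[symmetric])
  finally show ?thesis by simp
qed

text \<open>Durations are controlled only at grid levels, so \<open>a\<close> is moved to a grid
  level on either side, at a cost of \<open>P n\<close> per unit of length. Three such lengths and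
  two time errors give the constant 5; beyond \<open>R\<close> both functions are constant.\<close>

lemma walk_cdf_cdf:
  assumes n: "good n"
  shows "\<bar>walk_cdf n a - cdf a\<bar> \<le> 5 * (3 / 4) ^ n * P n"
proof -
  let ?r = "(3 / 4 :: real) ^ n" and ?e = "1 / 2 ^ n :: real"
  note pb = power_bounds[of n]
  have rP: "?r \<le> ?r * P n" "?e * P n \<le> ?r * P n"
    using pb P_ge(1)[of n] mult_left_mono[of 1 "P n" ?r] mult_right_mono[of ?e ?r "P n"] by auto
  consider "R \<le> a" | "a \<le> - R" | "- R < a" "a < R" by linarith
  then show ?thesis
  proof cases
    case 1
    have "s n j \<le> a" if "j < 4 ^ n" for j using good_range[OF n, of j] that 1 by auto
    then have "(\<Sum>j<4 ^ n. if s n j \<le> a then 1 else 0) = (\<Sum>j<(4::nat) ^ n. 1 :: real)"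
      by (intro sum.cong) auto
    then have "walk_cdf n a = 1" unfolding walk_cdf_def by simp
    then show ?thesis using cdf_above[OF 1] pb P_ge(1)[of n] by simp
  next
    case 2
    have "\<not> s n j \<le> a" if "j < 4 ^ n" for j using good_range[OF n, of j] that 2 by auto
    then have "walk_cdf n a = 0" unfolding walk_cdf_def by (auto intro!: sum.neutral)
    then show ?thesis using cdf_below[OF 2] pb P_ge(1)[of n] by simp
  next
    case 3
    \<comment> \<open>Rounding starts from \<open>a\<close> plus one lattice step, which absorbs the
      shift of levels in \<open>cdf_le_time_cdf\<close>; the rounding down below mirrors
      this.\<close>
    define i where "i = \<lceil>(a + ?e) / ?r\<rceil>"
    define g where "g = of_int i * ?r"
    have g: "a + ?e \<le> g" "g \<le> a + ?e + ?r"
      unfolding g_def i_def by (rule round_to_grid[OF pb(2)])+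
    have ig: "\<bar>of_int i\<bar> \<le> (3 / 2 :: real) ^ n"
      using 3 pb g by (intro grid_index[OF n]) (unfold g_def[symmetric] abs_le_iff, linarith)
    have "cdf a \<le> time_cdf n g + ?r"
      using cdf_le_time_cdf[OF n, of a] time_cdf_mono[OF g(1), of n] by simp
    also have "time_cdf n g \<le> walk_cdf n g + ?r"
      using walk_cdf_time_cdf[OF n ig] unfolding g_def by simp
    also have "walk_cdf n g \<le> walk_cdf n a + (g - a + ?e) * P n"
      using walk_cdf_increment[OF n, of a g] g(1) pb by simp
    also have "(g - a + ?e) * P n \<le> (?e + ?r + ?e) * P n"
      using g P_ge(1)[of n] by (intro mult_right_mono) auto
    finally have "cdf a \<le> walk_cdf n a + (?e + ?r + ?e) * P n + ?r + ?r" by simp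
    then have up: "cdf a \<le> walk_cdf n a + 5 * ?r * P n"
      using rP unfolding distrib_right mult.assoc by linarith
    define k where "k = \<lfloor>(a - ?e) / ?r\<rfloor>"
    define f where "f = of_int k * ?r"
    have f: "f \<le> a - ?e" "a - ?e - ?r \<le> f"
      unfolding f_def k_def by (rule round_to_grid[OF pb(2)])+
    have kf: "\<bar>of_int k\<bar> \<le> (3 / 2 :: real) ^ n"
      using 3 pb f by (intro grid_index[OF n]) (unfold f_def[symmetric] abs_le_iff, linarith)
    have "walk_cdf n a \<le> walk_cdf n f + (a - f + ?e) * P n"
      using walk_cdf_increment[OF n, of f a] f(1) pb by simp
    also have "(a - f + ?e) * P n \<le> (?e + ?r + ?e) * P n"
      using f P_ge(1)[of n] by (intro mult_right_mono) auto
    also have "walk_cdf n f \<le> time_cdf n f + ?r"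
      using walk_cdf_time_cdf[OF n kf] unfolding f_def by simp
    also have "time_cdf n f \<le> cdf (f + ?e) + ?r" by (rule time_cdf_le_cdf[OF n])
    also have "cdf (f + ?e) \<le> cdf a" by (rule cdf_mono) (use f in simp)
    finally have "walk_cdf n a \<le> cdf a + (?e + ?r + ?e) * P n + ?r + ?r" by simp
    then have "walk_cdf n a \<le> cdf a + 5 * ?r * P n"
      using rP unfolding distrib_right mult.assoc by linarith
    with up show ?thesis by (simp add: abs_le_iff)
  qed
qed

end

section \<open>Oscillation of the visit counts\<close>

lemma rate_bounds:
  fixes n :: nat
  defines "\<rho> \<equiv> (15 / 16 :: real) ^ n" and "\<theta> \<equiv> (16 / 15 :: real) ^ n"
    and "h \<equiv> (7 / 8 :: real) ^ n" and "r \<equiv> (3 / 4 :: real) ^ n"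
  shows "\<theta> * \<rho> = 1" "\<theta> * h \<le> \<rho>" "\<theta> * r \<le> \<rho>" "h \<le> \<rho>" "r \<le> h * \<rho>" "1 / 2 ^ n \<le> h * \<rho>"
    "r \<le> h" "1 / 2 ^ n \<le> h" "\<rho> \<le> 1" "0 < \<rho>" "0 < \<theta>" "0 < h" "0 < r" "h \<le> 1"
proof -
  have e: "(1 / 2 ^ n :: real) = (1 / 2) ^ n" by (simp add: power_one_over)
  show "\<theta> * \<rho> = 1" "\<theta> * h \<le> \<rho>" "\<theta> * r \<le> \<rho>" "h \<le> \<rho>" "r \<le> h * \<rho>" "1 / 2 ^ n \<le> h * \<rho>"
    "r \<le> h" "1 / 2 ^ n \<le> h" "\<rho> \<le> 1" "0 < \<rho>" "0 < \<theta>" "0 < h" "0 < r" "h \<le> 1"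
    unfolding assms e power_mult_distrib[symmetric]
    by (auto intro!: power_mono power_le_one zero_less_power)
qed

context embedded_walks
begin

text \<open>This bounds the quadratic variation in the exponential inequality. Two comparisons with
  \<open>walk_cdf\<close> cost 10, two time errors 2, and the four extra lattice steps in the window
  4, whence 16.\<close>

lemma window_time:
  assumes n: "good n" and xy: "y \<le> x"
  shows "(\<Sum>j<4 ^ n. if y \<le> s n j \<and> s n j \<le> x then T n (Suc j) - T n j else 0)
    \<le> (x - y) * P n + 16 * (3 / 4) ^ n * P n" (is "?S \<le> _")
proof -
  let ?r = "(3 / 4 :: real) ^ n" and ?e = "1 / 2 ^ n :: real"
  note pb = power_bounds[of n]
  have rP: "?r * 1 \<le> ?r * P n"
    by (rule mult_left_mono[OF P_ge(1)]) (use pb in simp)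
  have eP: "?e * P n \<le> ?r * P n"
    by (rule mult_right_mono[OF pb(1)]) (use P_ge(1)[of n] in simp)
  have "?S
      \<le> time_cdf n x - time_cdf n (y - ?e)"
  proof -
    have "(if y \<le> u \<and> u \<le> x then d else 0) \<le> (if u \<le> x then d else 0) - (if u \<le> y - e then d else 0)"
      if "0 \<le> d" "0 < e" for u d e :: real
      using xy that by auto
    from this[OF D_nonneg pb(3)] show ?thesis
      unfolding time_cdf_def sum_subtractf[symmetric] by (rule sum_mono)
  qed
  also have "time_cdf n x \<le> cdf (x + ?e) + ?r" by (rule time_cdf_le_cdf[OF n])
  also have "cdf (x + ?e) \<le> walk_cdf n (x + ?e) + 5 * ?r * P n"
    using walk_cdf_cdf[OF n, of "x + ?e"] by (simp add: abs_le_iff)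
  finally have 1: "?S
      \<le> walk_cdf n (x + ?e) + 5 * ?r * P n + ?r - time_cdf n (y - ?e)" by simp
  have "cdf (y - 2 * ?e) \<le> time_cdf n (y - 2 * ?e + ?e) + ?r" by (rule cdf_le_time_cdf[OF n])
  then have 2: "cdf (y - 2 * ?e) \<le> time_cdf n (y - ?e) + ?r" by simp
  have 3: "walk_cdf n (y - 2 * ?e) - 5 * ?r * P n \<le> cdf (y - 2 * ?e)"
    using walk_cdf_cdf[OF n, of "y - 2 * ?e"] by (simp add: abs_le_iff)
  have 4: "walk_cdf n (x + ?e) - walk_cdf n (y - 2 * ?e) \<le> (x + ?e - (y - 2 * ?e) + ?e) * P n"
    using xy pb(3) by (intro walk_cdf_increment[OF n]) linarith
  have 5: "(x + ?e - (y - 2 * ?e) + ?e) * P n = (x - y) * P n + 4 * (?e * P n)"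
    by (simp add: algebra_simps)
  show ?thesis using 1 2 3 4 rP eP unfolding 5 mult.assoc by linarith
qed

text \<open>The two sign integrands differ only while the walk is between the levels, and by at most
  2, so the quadratic variation is at most four times the window time. Dividing by the parameter
  \<open>?\<theta>\<close> gives 37; the absolute values in Tanaka's formula add 4.\<close>

lemma occ_modulus:
  fixes z z' :: int
  assumes n: "good n" and close: "\<bar>of_int z / 2 ^ n - of_int z' / 2 ^ n\<bar> \<le> 2 * (7 / 8 :: real) ^ n"
  shows "occ n (of_int z / 2 ^ n) - occ n (of_int z' / 2 ^ n) \<le> 41 * (15 / 16) ^ n * P n"
proof -
  let ?\<rho> = "(15 / 16 :: real) ^ n" and ?\<theta> = "(16 / 15 :: real) ^ n" and ?h = "(7 / 8 :: real) ^ n" and ?r = "(3 / 4 :: real) ^ n"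
  let ?a = "of_int z / 2 ^ n :: real" and ?a' = "of_int z' / 2 ^ n :: real"
  let ?w = "\<lambda>j. if min ?a ?a' \<le> s n j \<and> s n j \<le> max ?a ?a' then T n (Suc j) - T n j else 0"
  note rb = rate_bounds[of n] and P = P_ge[of n]
  have pow: "(2::real) ^ n * 2 ^ n = 4 ^ n" by (simp add: power_mult_distrib[symmetric])
  have range: "x \<in> {- (4 ^ n)..4 ^ n} \<or> R + 3 \<le> \<bar>of_int x / 2 ^ n :: real\<bar>" for x :: int
  proof (rule disjCI)
    assume "\<not> R + 3 \<le> \<bar>of_int x / 2 ^ n :: real\<bar>"
    then have "\<bar>of_int x / 2 ^ n :: real\<bar> \<le> 2 ^ n" using n by (auto simp: good_def)
    then have "\<bar>of_int x :: real\<bar> \<le> 2 ^ n * 2 ^ n" by (simp add: pos_divide_le_eq)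
    then have "of_int \<bar>x\<bar> \<le> (of_int (4 ^ n) :: real)" unfolding pow by simp
    then have "\<bar>x\<bar> \<le> 4 ^ n" by (simp only: of_int_le_iff)
    then show "x \<in> {- (4 ^ n)..4 ^ n}" by auto
  qed
  show ?thesis
  proof (cases "z \<in> {- (4 ^ n)..4 ^ n} \<and> z' \<in> {- (4 ^ n)..4 ^ n}")
    case False
    \<comment> \<open>The levels are at most 2 apart, so if either is beyond \<open>R + 3\<close>
      then \<open>?a\<close> is beyond \<open>R\<close> and is never visited; this explains the
      margin 3 in \<open>good\<close>.\<close>
    then have "R + 3 \<le> \<bar>?a\<bar> \<or> R + 3 \<le> \<bar>?a'\<bar>" using range by blast
    then have "R \<le> \<bar>?a\<bar>" using close rb(14) by linarith
    then have "occ n ?a = 0" by (rule occ_outside[OF n])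
    then show ?thesis using occ_nonneg[of n ?a'] rb(10) P(1) by (smt (verit) mult_nonneg_nonneg)
  next
    case True
    let ?q = "\<lambda>j. (sgn (s n j - ?a') - sgn (s n j - ?a))\<^sup>2"
    define S where "S = (\<Sum>j<4 ^ n. ?q j * (T n (Suc j) - T n j))"
    define L where "L = tanaka_sum (s n) (4 ^ n) ?a' - tanaka_sum (s n) (4 ^ n) ?a"
    have bound: "L * ?\<theta> \<le> 8 * real n + ?\<theta>\<^sup>2 / 2 * S"
      using n True unfolding S_def L_def by (simp add: good_def walk_bounds_def Let_def)
    have "S \<le> (\<Sum>j<4 ^ n. 4 * ?w j)"
      unfolding S_def
    proof (rule sum_mono)
      fix j
      have "?q j
          \<le> 4 * (if min ?a ?a' \<le> s n j \<and> s n j \<le> max ?a ?a' then 1 else 0)"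
        by (auto simp: sgn_if)
      then have "?q j * (T n (Suc j) - T n j)
          \<le> 4 * (if min ?a ?a' \<le> s n j \<and> s n j \<le> max ?a ?a' then 1 else 0) * (T n (Suc j) - T n j)"
        by (rule mult_right_mono[OF _ D_nonneg])
      then show "?q j * (T n (Suc j) - T n j)
          \<le> 4 * ?w j"
        by (auto split: if_splits)
    qed
    also have "\<dots> = 4 * (\<Sum>j<4 ^ n. ?w j)"
      by (rule sum_distrib_left[symmetric])
    also have "\<dots> \<le> 4 * ((max ?a ?a' - min ?a ?a') * P n + 16 * ?r * P n)"
      by (intro mult_left_mono window_time[OF n]) auto
    also have "(max ?a ?a' - min ?a ?a') * P n \<le> 2 * ?h * P n"
      using close P(1) by (intro mult_right_mono) (auto simp: max_def min_def abs_if split: if_splits)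
    also have "16 * ?r * P n \<le> 16 * ?h * P n"
      using rb(7) P(1) by (intro mult_right_mono mult_left_mono) auto
    finally have S: "S \<le> 72 * ?h * P n" by (simp add: mult_ac)
    have L: "L \<le> 37 * ?\<rho> * P n"
    proof -
      have "?\<theta>\<^sup>2 / 2 * S \<le> ?\<theta>\<^sup>2 / 2 * (72 * ?h * P n)" by (intro mult_left_mono S) simp
      then have "L * ?\<theta> \<le> P n + ?\<theta>\<^sup>2 / 2 * (72 * ?h * P n)" using bound P(2) by linarith
      then have "L * ?\<theta> * ?\<rho> \<le> (P n + ?\<theta>\<^sup>2 / 2 * (72 * ?h * P n)) * ?\<rho>"
        using rb(10) by (intro mult_right_mono) auto
      also have "\<dots> = P n * ?\<rho> + 36 * (?\<theta> * ?\<rho>) * (?\<theta> * ?h) * P n"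
        by (simp only: power2_eq_square) (simp only: algebra_simps)
      also have "\<dots> \<le> P n * ?\<rho> + 36 * 1 * ?\<rho> * P n"
        unfolding rb(1) using rb(2) P(1) by (intro add_left_mono mult_right_mono mult_left_mono) auto
      finally have "L * (?\<theta> * ?\<rho>) \<le> P n * ?\<rho> + 36 * 1 * ?\<rho> * P n" by (simp only: mult.assoc)
      then show ?thesis unfolding rb(1) by (simp add: mult_ac)
    qed
    have "occ n ?a - occ n ?a' = (\<bar>s n (4 ^ n) - ?a\<bar> - \<bar>s n (4 ^ n) - ?a'\<bar>) + (\<bar>?a'\<bar> - \<bar>?a\<bar>) + L"
      unfolding occ_tanaka L_def by simp
    also have "\<dots> \<le> 2 * \<bar>?a - ?a'\<bar> + L"
    proof -
      have "\<bar>p - u\<bar> - \<bar>p - v\<bar> \<le> \<bar>u - v\<bar>" "\<bar>v\<bar> - \<bar>u\<bar> \<le> \<bar>u - v\<bar>" for p u v :: real by linarith+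
      from this(1)[of "s n (4 ^ n)" ?a ?a'] this(2)[of ?a' ?a] show ?thesis by simp
    qed
    also have "\<dots> \<le> 4 * ?h + L" using mult_left_mono[OF close, of 2] by simp
    also have "\<dots> \<le> 4 * ?\<rho> * P n + 37 * ?\<rho> * P n"
    proof -
      have "?h * 1 \<le> ?\<rho> * P n" using rb P(1) by (intro mult_mono) auto
      then show ?thesis using L unfolding mult.assoc by linarith
    qed
    finally show ?thesis by (simp add: mult_ac)
  qed
qed

text \<open>The martingale runs only while the walk sits at one level, a degenerate window whose
  time is geometrically small. Levels outside the lattice range are not visited at all.\<close>

lemma level_walk_bound:
  assumes n: "good n" and J: "J \<le> 4 ^ n"
  shows "\<bar>level_sum (s n) J (of_int z / 2 ^ n)\<bar> \<le> 9 * (15 / 16) ^ n * P n"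
proof -
  let ?\<rho> = "(15 / 16 :: real) ^ n" and ?\<theta> = "(16 / 15 :: real) ^ n" and ?r = "(3 / 4 :: real) ^ n"
  note rb = rate_bounds[of n] and P = P_ge[of n]
  show ?thesis
  proof (cases "z \<in> {- (4 ^ n)..4 ^ n}")
    case True
    define S where "S = (\<Sum>j<4 ^ n. if s n j = of_int z / 2 ^ n then T n (Suc j) - T n j else 0)"
    define L where "L = \<bar>level_sum (s n) J (of_int z / 2 ^ n)\<bar>"
    have "L * ?\<theta> \<le> 8 * real n + ?\<theta>\<^sup>2 / 2 * S"
      using n True J unfolding L_def S_def by (simp add: good_def walk_bounds_def Let_def)
    moreover have "S \<le> 16 * ?r * P n"
      using window_time[OF n order_refl, of "of_int z / 2 ^ n"] unfolding S_def
      by (simp add: antisym_conv eq_commute order_antisym_conv conj_commute order_class.order_eq_iff[symmetric])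
    then have "?\<theta>\<^sup>2 / 2 * S \<le> ?\<theta>\<^sup>2 / 2 * (16 * ?r * P n)" by (intro mult_left_mono) simp_all
    ultimately have "L * ?\<theta> \<le> P n + ?\<theta>\<^sup>2 / 2 * (16 * ?r * P n)" using P(2) by linarith
    then have "L * ?\<theta> * ?\<rho> \<le> (P n + ?\<theta>\<^sup>2 / 2 * (16 * ?r * P n)) * ?\<rho>"
      using rb(10) by (intro mult_right_mono) auto
    also have "\<dots> = P n * ?\<rho> + 8 * (?\<theta> * ?\<rho>) * (?\<theta> * ?r) * P n"
      by (simp only: power2_eq_square) (simp only: algebra_simps)
    also have "\<dots> \<le> P n * ?\<rho> + 8 * 1 * ?\<rho> * P n"
      unfolding rb(1) using rb(3) P(1) by (intro add_left_mono mult_right_mono mult_left_mono) auto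
    finally have "L * (?\<theta> * ?\<rho>) \<le> P n * ?\<rho> + 8 * 1 * ?\<rho> * P n" by (simp only: mult.assoc)
    then show ?thesis unfolding rb(1) L_def by (simp add: mult_ac)
  next
    case False
    have "s n j \<noteq> of_int z / 2 ^ n" if "j < J" for j
    proof
      assume eq: "s n j = of_int z / 2 ^ n"
      obtain u :: int where u: "s n j = of_int u / 2 ^ n" "\<bar>u\<bar> \<le> int j" using embedding_integer by blast
      have "u = z" using eq u(1) by simp
      moreover have "int j \<le> int (4 ^ n)" using that J by (simp only: of_nat_le_iff)
      then have "int j \<le> 4 ^ n" by (simp only: of_nat_power of_nat_numeral)
      ultimately show False using u(2) False unfolding atLeastAtMost_iff by linarith
    qed
    then have "level_sum (s n) J (of_int z / 2 ^ n) = 0"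
      unfolding level_sum_def by (intro sum.neutral) auto
    then show ?thesis using rb(10) P(1) by simp
  qed
qed

definition loc :: "nat \<Rightarrow> real \<Rightarrow> real" where
  "loc n x = occ n (of_int \<lfloor>x * 2 ^ n\<rfloor> / 2 ^ n)"

text \<open>The average of \<open>occ\<close> over a window is a difference quotient of
  \<open>walk_cdf\<close>, and replacing it by \<open>cdf\<close> costs order
  \<open>(3 / 4) ^ n / w\<close>. The range of \<open>w\<close> admits the windows of scales
  \<open>n\<close> and \<open>n + 1\<close>, so one walk compares two consecutive quotients of the
  path.\<close>

lemma loc_quotient:
  assumes n: "good n" and w: "7 / 8 * (7 / 8) ^ n \<le> w" "w \<le> (7 / 8) ^ n"
  shows "\<bar>loc n x - (cdf (x + w) - cdf x) / w\<bar> \<le> 160 * (15 / 16) ^ n * P n"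
proof -
  let ?\<rho> = "(15 / 16 :: real) ^ n" and ?h = "(7 / 8 :: real) ^ n" and ?r = "(3 / 4 :: real) ^ n"
    and ?e = "1 / 2 ^ n :: real"
  let ?Z = "{\<lfloor>x * 2 ^ n\<rfloor><..\<lfloor>(x + w) * 2 ^ n\<rfloor>}"
  define \<kappa> where "\<kappa> = 41 * ?\<rho> * P n"
  define c where "c = ?e * real (card ?Z)"
  note rb = rate_bounds[of n] and P = P_ge[of n]
  have w0: "0 < w" using w rb(12) by linarith
  have hw: "?h \<le> 8 / 7 * w" using w(1) by simp
  have c: "\<bar>c - w\<bar> \<le> ?e"
  proof -
    have "\<bar>real (card ?Z) - ((x + w) * 2 ^ n - x * 2 ^ n)\<bar> \<le> 1"
      using w0 by (intro floor_diff_bounds) auto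
    then have "\<bar>real (card ?Z) - w * 2 ^ n\<bar> \<le> 1" by (simp add: algebra_simps)
    then have "?e * \<bar>real (card ?Z) - w * 2 ^ n\<bar> \<le> ?e * 1" by (intro mult_left_mono) auto
    also have "?e * \<bar>real (card ?Z) - w * 2 ^ n\<bar> = \<bar>?e * (real (card ?Z) - w * 2 ^ n)\<bar>"
      by (simp add: abs_mult)
    also have "?e * (real (card ?Z) - w * 2 ^ n) = c - w" by (simp add: c_def algebra_simps)
    finally show ?thesis by simp
  qed
  have \<kappa>0: "0 \<le> \<kappa>" using rb(10) P(1) by (simp add: \<kappa>_def)
  have "\<bar>occ n (of_int z / 2 ^ n) - loc n x\<bar> \<le> \<kappa>" if z: "z \<in> ?Z" for z
  proof -
    have "of_int z \<le> (x + w) * 2 ^ n" "x * 2 ^ n < of_int z" using z by (auto simp: le_floor_iff floor_less_iff)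
    moreover have "x * 2 ^ n - 1 \<le> of_int \<lfloor>x * 2 ^ n\<rfloor>" "of_int \<lfloor>x * 2 ^ n\<rfloor> \<le> x * 2 ^ n" by linarith+
    moreover have "0 \<le> w * 2 ^ n" using w0 by simp
    ultimately have d: "\<bar>of_int z - of_int \<lfloor>x * 2 ^ n\<rfloor>\<bar> \<le> w * 2 ^ n + 1"
      unfolding abs_le_iff distrib_right by linarith
    have "\<bar>of_int z / 2 ^ n - of_int \<lfloor>x * 2 ^ n\<rfloor> / 2 ^ n\<bar> = \<bar>of_int z - of_int \<lfloor>x * 2 ^ n\<rfloor>\<bar> / (2 ^ n :: real)"
      by (simp add: diff_divide_distrib[symmetric])
    also have "\<dots> \<le> (w * 2 ^ n + 1) / 2 ^ n" by (intro divide_right_mono d) simp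
    also have "\<dots> = w + ?e" by (simp add: add_divide_distrib)
    also have "\<dots> \<le> 2 * ?h" using w(2) rb(8) by linarith
    finally have "\<bar>of_int z / 2 ^ n - of_int \<lfloor>x * 2 ^ n\<rfloor> / 2 ^ n\<bar> \<le> 2 * ?h" .
    note close = this
    have "\<bar>of_int \<lfloor>x * 2 ^ n\<rfloor> / 2 ^ n - of_int z / 2 ^ n\<bar> \<le> 2 * ?h"
      using close by (subst abs_minus_commute)
    from occ_modulus[OF n close] occ_modulus[OF n this] show ?thesis unfolding loc_def \<kappa>_def by (simp add: abs_le_iff)
  qed
  then have "(\<Sum>z\<in>?Z. \<bar>occ n (of_int z / 2 ^ n) - loc n x\<bar>) \<le> (\<Sum>z\<in>?Z. \<kappa>)" by (rule sum_mono)
  from order_trans[OF sum_abs this]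
  have "\<bar>\<Sum>z\<in>?Z. occ n (of_int z / 2 ^ n) - loc n x\<bar> \<le> real (card ?Z) * \<kappa>"
    by (simp only: sum_constant)
  then have "?e * \<bar>\<Sum>z\<in>?Z. occ n (of_int z / 2 ^ n) - loc n x\<bar> \<le> ?e * (real (card ?Z) * \<kappa>)"
    by (intro mult_left_mono) auto
  moreover have "?e * \<bar>\<Sum>z\<in>?Z. occ n (of_int z / 2 ^ n) - loc n x\<bar> = \<bar>walk_cdf n (x + w) - walk_cdf n x - c * loc n x\<bar>"
  proof -
    have "walk_cdf n (x + w) - walk_cdf n x = ?e * (\<Sum>z\<in>?Z. occ n (of_int z / 2 ^ n))"
      using w0 by (intro walk_cdf_diff) simp
    moreover have "c * loc n x = ?e * (\<Sum>z\<in>?Z. loc n x)" unfolding c_def sum_constant by (rule mult.assoc)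
    ultimately have "walk_cdf n (x + w) - walk_cdf n x - c * loc n x = ?e * (\<Sum>z\<in>?Z. occ n (of_int z / 2 ^ n) - loc n x)"
      by (simp only: sum_subtractf right_diff_distrib)
    then show ?thesis by (simp only: abs_mult) simp
  qed
  ultimately have 1: "\<bar>walk_cdf n (x + w) - walk_cdf n x - c * loc n x\<bar> \<le> c * \<kappa>"
    by (simp add: c_def mult.assoc)
  have 2: "\<bar>c * loc n x - w * loc n x\<bar> \<le> ?e * P n"
  proof -
    have "\<bar>c * loc n x - w * loc n x\<bar> = \<bar>c - w\<bar> * loc n x"
      using occ_nonneg by (simp add: left_diff_distrib[symmetric] abs_mult loc_def)
    also have "\<dots> \<le> ?e * P n"
      using c occ_nonneg occ_le[OF n] by (intro mult_mono) (auto simp: loc_def)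
    finally show ?thesis .
  qed
  have 3: "\<bar>(walk_cdf n (x + w) - walk_cdf n x) - (cdf (x + w) - cdf x)\<bar> \<le> 10 * ?r * P n"
    using walk_cdf_cdf[OF n, of "x + w"] walk_cdf_cdf[OF n, of x] by linarith
  \<comment> \<open>\<open>c\<close> exceeds \<open>w\<close> by at most \<open>?e\<close>, hence by
    at most \<open>?h\<close>, which is at most \<open>8 / 7 * w\<close>.\<close>
  have cw: "c * \<kappa> \<le> 3 * w * \<kappa>"
    using c rb(8) hw w0 by (intro mult_right_mono \<kappa>0) linarith
  have hr: "?h * ?\<rho> \<le> 8 / 7 * w * ?\<rho>" by (rule mult_right_mono[OF hw]) (use rb(10) in simp)
  have P0: "0 \<le> P n" using P(1) by simp
  have ew: "?e * P n \<le> 8 / 7 * w * ?\<rho> * P n"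
    by (rule mult_right_mono[OF order_trans[OF rb(6) hr] P0])
  have rw: "10 * ?r * P n \<le> 10 * (8 / 7 * w * ?\<rho>) * P n"
    by (rule mult_right_mono[OF mult_left_mono[OF order_trans[OF rb(5) hr]] P0]) simp
  have "\<bar>w * loc n x - (cdf (x + w) - cdf x)\<bar> \<le> c * \<kappa> + ?e * P n + 10 * ?r * P n"
    using 1 2 3 by linarith
  also have "\<dots> \<le> 3 * w * \<kappa> + 8 / 7 * w * ?\<rho> * P n + 10 * (8 / 7 * w * ?\<rho>) * P n"
    by (intro add_mono cw ew rw)
  also have "\<dots> = (123 + 88 / 7) * (w * (?\<rho> * P n))" unfolding \<kappa>_def by (simp add: algebra_simps)
  also have "\<dots> \<le> 160 * (w * (?\<rho> * P n))" using w0 rb(10) P(1) by (intro mult_right_mono) auto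
  finally have *: "\<bar>w * loc n x - (cdf (x + w) - cdf x)\<bar> \<le> w * (160 * ?\<rho> * P n)" by (simp add: mult_ac)
  have "loc n x - (cdf (x + w) - cdf x) / w = (w * loc n x - (cdf (x + w) - cdf x)) / w"
    using w0 by (simp add: field_simps)
  then have "\<bar>loc n x - (cdf (x + w) - cdf x) / w\<bar> = \<bar>w * loc n x - (cdf (x + w) - cdf x)\<bar> / w"
    using w0 by simp
  also have "\<dots> \<le> w * (160 * ?\<rho> * P n) / w" using * w0 by (intro divide_right_mono) auto
  finally show ?thesis using w0 by simp
qed

end

section \<open>The local time as a uniform limit\<close>

context embedded_walks
begin

definition quot :: "nat \<Rightarrow> real \<Rightarrow> real" where
  "quot n x = (cdf (x + (7 / 8) ^ n) - cdf x) / (7 / 8) ^ n"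

definition eps :: "nat \<Rightarrow> real" where
  "eps n = 160 * (15 / 16) ^ n * P n"

text \<open>The limit of \<open>quot n x\<close>, written as a telescoping series to which the
  Weierstrass test applies; it involves the path alone.\<close>

definition L :: "real \<Rightarrow> real" where
  "L x = quot 0 x + (\<Sum>i. quot (Suc i) x - quot i x)"

lemma eps_nonneg: "0 \<le> eps n"
  using P_ge(1)[of n] by (simp add: eps_def)

lemma summable_eps: "summable eps"
proof (rule summable_comparison_test')
  have "summable (\<lambda>n. of_nat (Suc n) * (15 / 16 :: real) ^ n)"
    using geometric_deriv_sums[of "15 / 16 :: real"] by (intro sums_summable) auto
  then show "summable (\<lambda>n. 160 * (R + 9) * (of_nat (Suc n) * (15 / 16 :: real) ^ n))"
    by (rule summable_mult)
  fix n :: nat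
  have "P n \<le> (R + 9) * of_nat (Suc n)"
    unfolding P_def using R_pos by (simp add: algebra_simps)
  then have "160 * (15 / 16) ^ n * P n \<le> 160 * (15 / 16) ^ n * ((R + 9) * of_nat (Suc n))"
    by (intro mult_left_mono) auto
  then have "eps n \<le> 160 * (15 / 16) ^ n * ((R + 9) * of_nat (Suc n))" by (simp only: eps_def)
  also have "\<dots> = 160 * (R + 9) * (of_nat (Suc n) * (15 / 16) ^ n)" by (simp only: mult_ac)
  finally show "norm (eps n) \<le> 160 * (R + 9) * (of_nat (Suc n) * (15 / 16) ^ n)"
    using eps_nonneg[of n] by (simp only: real_norm_def abs_of_nonneg)
qed

lemma eps_tendsto: "eps \<longlonglongrightarrow> 0"
  by (rule summable_LIMSEQ_zero[OF summable_eps])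

lemma loc_quot:
  assumes "good n"
  shows "\<bar>loc n x - quot n x\<bar> \<le> eps n" "\<bar>loc n x - quot (Suc n) x\<bar> \<le> eps n"
  using loc_quotient[OF assms, of "(7 / 8) ^ n" x] loc_quotient[OF assms, of "(7 / 8) ^ Suc n" x]
  by (simp_all add: quot_def eps_def)

lemma quot_uniform: "uniform_limit UNIV quot L sequentially"
proof -
  have "uniform_limit UNIV (\<lambda>n x. \<Sum>i<n. quot (Suc i) x - quot i x) (\<lambda>x. \<Sum>i. quot (Suc i) x - quot i x) sequentially"
  proof (rule Weierstrass_m_test_ev)
    show "summable (\<lambda>n. 2 * eps n)" by (intro summable_mult summable_eps)
    show "\<forall>\<^sub>F n in sequentially. \<forall>x\<in>UNIV. norm (quot (Suc n) x - quot n x) \<le> 2 * eps n"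
      using eventually_good
    proof eventually_elim
      case (elim n)
      show ?case
      proof
        fix x show "norm (quot (Suc n) x - quot n x) \<le> 2 * eps n"
          using loc_quot[OF elim, of x] unfolding real_norm_def by linarith
      qed
    qed
  qed
  then have "uniform_limit UNIV (\<lambda>n x. quot 0 x + (\<Sum>i<n. quot (Suc i) x - quot i x)) L sequentially"
    unfolding L_def[abs_def] by (intro uniform_limit_add uniform_limit_const)
  moreover have "quot 0 x + (\<Sum>i<n. quot (Suc i) x - quot i x) = quot n x" for n x
    by (subst sum_lessThan_telescope) simp
  ultimately show ?thesis by simp
qed

lemma quot_tendsto: "(\<lambda>n. quot n x) \<longlonglongrightarrow> L x"
  by (rule tendsto_uniform_limitI[OF quot_uniform]) simp

text \<open>For fixed \<open>n\<close> the increments are Lipschitz with constant \<open>P n\<close>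
  up to an error below \<open>eps n\<close>. So \<open>n\<close> is chosen first, and the distance
  \<open>e / (2 * P n)\<close> afterwards.\<close>

lemma cdf_continuous: "continuous_on A cdf"
proof -
  have "\<exists>d>0. \<forall>y. \<bar>y - x\<bar> < d \<longrightarrow> \<bar>cdf y - cdf x\<bar> < e" if e: "0 < e" for x e
  proof -
    have "\<forall>\<^sub>F n in sequentially. eps n < e / 2"
      using order_tendstoD(2)[OF eps_tendsto, of "e / 2"] e by simp
    then obtain n where n: "good n" "eps n < e / 2"
      using eventually_conj[OF eventually_good] by (metis (mono_tags, lifting) eventually_sequentially order_refl)
    note rb = rate_bounds[of n] and P = P_ge[of n]
    have small: "11 * (3 / 4) ^ n * P n \<le> eps n"
    proof -
      have "(3 / 4 :: real) ^ n \<le> (15 / 16) ^ n" using rb by linarith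
      then have "11 * (3 / 4 :: real) ^ n \<le> 160 * (15 / 16) ^ n" using rb(10) by linarith
      then show ?thesis unfolding eps_def using P(1) by (intro mult_right_mono) auto
    qed
    have inc: "cdf v - cdf u < e" if "u \<le> v" "v - u < e / (2 * P n)" for u v
    proof -
      have "walk_cdf n v - walk_cdf n u \<le> (v - u + 1 / 2 ^ n) * P n"
        by (rule walk_cdf_increment[OF n(1) that(1)])
      moreover have "\<bar>walk_cdf n v - cdf v\<bar> \<le> 5 * (3 / 4) ^ n * P n" "\<bar>walk_cdf n u - cdf u\<bar> \<le> 5 * (3 / 4) ^ n * P n"
        using walk_cdf_cdf[OF n(1)] by blast+
      moreover have "(v - u + 1 / 2 ^ n) * P n \<le> (v - u) * P n + (3 / 4) ^ n * P n"
        using mult_right_mono[OF power_bounds(1), of "P n" n] P(1) by (simp add: distrib_right)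
      ultimately have "cdf v - cdf u \<le> (v - u) * P n + 11 * (3 / 4) ^ n * P n"
        unfolding mult.assoc by linarith
      moreover have "(v - u) * P n < e / (2 * P n) * P n"
        using that(2) P(1) by (intro mult_strict_right_mono) auto
      moreover have "e / (2 * P n) * P n = e / 2" using P(1) by simp
      ultimately show ?thesis using small n(2) by linarith
    qed
    show ?thesis
    proof (intro exI[of _ "e / (2 * P n)"] conjI allI impI)
      show "0 < e / (2 * P n)" using e P(1) by simp
      fix y assume y: "\<bar>y - x\<bar> < e / (2 * P n)"
      show "\<bar>cdf y - cdf x\<bar> < e"
        using inc[of x y] inc[of y x] y cdf_mono[of x y] cdf_mono[of y x] by (cases "x \<le> y") auto
    qed
  qed
  then have "continuous_on UNIV cdf" unfolding continuous_on_iff dist_real_def by simp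
  then show ?thesis using continuous_on_subset by blast
qed

lemma L_continuous: "continuous_on A L"
proof -
  have "continuous_on UNIV L"
  proof (rule uniform_limit_theorem[OF _ quot_uniform])
    show "\<forall>\<^sub>F n in sequentially. continuous_on UNIV (quot n)"
      unfolding quot_def[abs_def]
      by (intro always_eventually allI continuous_intros continuous_on_compose2[OF cdf_continuous[of UNIV]]) auto
  qed simp
  then show ?thesis using continuous_on_subset by blast
qed

text \<open>The windows extend to the right of \<open>x\<close>, hence the strict inequality on the
  left. The remaining point \<open>- R\<close> is a null set for the integrals.\<close>

lemma L_outside: "R \<le> x \<or> x < - R \<Longrightarrow> L x = 0"
proof -
  assume "R \<le> x \<or> x < - R"
  then have "\<forall>\<^sub>F n in sequentially. quot n x = 0"
  proof
    assume "R \<le> x"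
    moreover have "R \<le> x + (7 / 8) ^ n" for n
      using rate_bounds(12)[of n] \<open>R \<le> x\<close> by linarith
    ultimately show ?thesis by (simp add: quot_def cdf_above)
  next
    assume x: "x < - R"
    have "(\<lambda>n. (7 / 8 :: real) ^ n) \<longlonglongrightarrow> 0" by (rule LIMSEQ_power_zero) simp
    then have "\<forall>\<^sub>F n in sequentially. (7 / 8 :: real) ^ n < - R - x"
      using x by (intro order_tendstoD) auto
    then show ?thesis
      by eventually_elim (use x in \<open>simp add: quot_def cdf_below\<close>)
  qed
  then have "(\<lambda>n. quot n x) \<longlonglongrightarrow> 0" by (rule tendsto_eventually)
  then show ?thesis using quot_tendsto LIMSEQ_unique by blast
qed

lemma loc_uniform:
  assumes e: "0 < e"
  shows "\<forall>\<^sub>F n in sequentially. \<forall>x. \<bar>loc n x - L x\<bar> < e"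
proof -
  have "\<forall>\<^sub>F n in sequentially. eps n < e / 2"
    using order_tendstoD(2)[OF eps_tendsto, of "e / 2"] e by simp
  moreover have "\<forall>\<^sub>F n in sequentially. \<forall>x\<in>UNIV. dist (quot n x) (L x) < e / 2"
    using quot_uniform[unfolded uniform_limit_iff] e half_gt_zero by blast
  ultimately show ?thesis using eventually_good
  proof eventually_elim
    case (elim n)
    show ?case
    proof
      fix x
      have "\<bar>quot n x - L x\<bar> < e / 2" using elim(2) by (simp add: dist_real_def)
      then show "\<bar>loc n x - L x\<bar> < e" using loc_quot(1)[OF elim(3), of x] elim(1) by linarith
    qed
  qed
qed

section \<open>Identification of the limit with the local time\<close>

lemma L_has_integral:
  assumes xy: "x \<le> y"
  shows "(L has_integral (cdf y - cdf x)) {x..y}"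
proof -
  \<comment> \<open>Difference quotients of an antiderivative of \<open>cdf\<close> are
    antiderivatives of \<open>quot n\<close> and tend to \<open>cdf\<close>. The larger interval
    provides two-sided derivatives and room for the windows.\<close>
  obtain g where g: "\<And>t. t \<in> {x - 1..y + 2} \<Longrightarrow> (g has_vector_derivative cdf t) (at t within {x - 1..y + 2})"
    using antiderivative_continuous[OF cdf_continuous] by blast
  have dg: "(g has_real_derivative cdf t) (at t)" if "x \<le> t" "t \<le> y + 1" for t
  proof -
    have "t \<in> interior {x - 1..y + 2}" using that by simp
    then have "at t within {x - 1..y + 2} = at t" by (rule at_within_interior)
    moreover have "t \<in> {x - 1..y + 2}" using that by simp
    ultimately show ?thesis using g[of t]
      by (simp only: has_real_derivative_iff_has_vector_derivative)
  qed
  define E where "E n t = (g (t + (7 / 8) ^ n) - g t) / (7 / 8) ^ n" for n t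
  have E: "(quot n has_integral (E n y - E n x)) {x..y}" for n
  proof (rule fundamental_theorem_of_calculus[OF xy])
    fix t assume t: "t \<in> {x..y}"
    have "(g has_real_derivative cdf (t + (7 / 8) ^ n)) (at (t + (7 / 8) ^ n))"
    proof (rule dg)
      show "x \<le> t + (7 / 8) ^ n" "t + (7 / 8) ^ n \<le> y + 1"
        using t rate_bounds(12,14)[of n] unfolding atLeastAtMost_iff by linarith+
    qed
    then have "((\<lambda>t. g (t + (7 / 8) ^ n)) has_real_derivative cdf (t + (7 / 8) ^ n)) (at t)"
      by (simp only: DERIV_shift)
    then have "(E n has_real_derivative quot n t) (at t)"
      unfolding E_def[abs_def] quot_def using t
      by (intro DERIV_cdivide DERIV_diff dg) auto
    then show "(E n has_vector_derivative quot n t) (at t within {x..y})"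
      by (simp add: has_real_derivative_iff_has_vector_derivative has_vector_derivative_at_within)
  qed
  have qc: "continuous_on {x..y} (quot n)" for n
    unfolding quot_def[abs_def]
    by (intro continuous_intros continuous_on_compose2[OF cdf_continuous[of UNIV]] cdf_continuous) auto
  obtain I J where I: "\<And>n. (quot n has_integral I n) {x..y}" and J: "(L has_integral J) {x..y}"
    and IJ: "I \<longlonglongrightarrow> J"
    using uniform_limit_integral[OF uniform_limit_on_subset[OF quot_uniform subset_UNIV] qc] by auto
  have "I = (\<lambda>n. E n y - E n x)" by (intro ext has_integral_unique[OF I E])
  then have "(\<lambda>n. E n y - E n x) \<longlonglongrightarrow> J" using IJ by simp
  moreover have "(\<lambda>n. E n t) \<longlonglongrightarrow> cdf t" if "x \<le> t" "t \<le> y" for t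
  proof -
    have h: "(\<lambda>n. (7 / 8 :: real) ^ n) \<longlonglongrightarrow> 0" by (rule LIMSEQ_power_zero) simp
    then have "filterlim (\<lambda>n. (7 / 8 :: real) ^ n) (at 0) sequentially"
      by (intro filterlim_atI) auto
    moreover have "((\<lambda>h. (g (t + h) - g t) / h) \<longlongrightarrow> cdf t) (at 0)"
      using dg[of t] that by (simp add: DERIV_def)
    ultimately show ?thesis unfolding E_def by (rule filterlim_compose[rotated])
  qed
  then have "(\<lambda>n. E n y - E n x) \<longlonglongrightarrow> cdf y - cdf x"
    using xy by (intro tendsto_diff) auto
  ultimately have "J = cdf y - cdf x" by (rule LIMSEQ_unique)
  then show ?thesis using J by simp
qed

lemma cdf_derivative: "(cdf has_real_derivative L x) (at x)"
proof -
  have "((\<lambda>t. integral {x - 1..t} L) has_real_derivative L x) (at x within {x - 1..x + 1})"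
    by (rule integral_has_real_derivative[OF L_continuous]) auto
  moreover have "x \<in> interior {x - 1..x + 1}" by simp
  ultimately have "((\<lambda>t. integral {x - 1..t} L) has_real_derivative L x) (at x)"
    by (simp only: at_within_interior)
  then have "((\<lambda>t. cdf (x - 1) + integral {x - 1..t} L) has_real_derivative 0 + L x) (at x)"
    by (intro DERIV_add DERIV_const)
  then have "((\<lambda>t. cdf (x - 1) + integral {x - 1..t} L) has_real_derivative L x) (at x)" by simp
  then show ?thesis
  proof (rule has_field_derivative_transform_within[of _ _ _ _ 1])
    fix t assume "dist t x < 1"
    then have "x - 1 \<le> t" by (simp add: dist_real_def)
    then show "cdf (x - 1) + integral {x - 1..t} L = cdf t"
      using integral_unique[OF L_has_integral[of "x - 1" t]] by simp
  qed simp_all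
qed

lemma measure_less: "measure lborel {t\<in>{0..1}. b t < a} = cdf a"
proof (rule antisym)
  show "measure lborel {t\<in>{0..1}. b t < a} \<le> cdf a"
    unfolding cdf_def by (intro measure_mono_fmeasurable fmeasurableD sublevel_fmeasurable) auto
  have "(\<lambda>n. a - (7 / 8) ^ n) \<longlonglongrightarrow> a - 0"
    by (intro tendsto_intros LIMSEQ_power_zero) simp
  then have "(\<lambda>n. cdf (a - (7 / 8) ^ n)) \<longlonglongrightarrow> cdf a"
    by (intro continuous_on_tendsto_compose[OF cdf_continuous[of UNIV]]) auto
  moreover have "cdf (a - (7 / 8) ^ n) \<le> measure lborel {t\<in>{0..1}. b t < a}" for n
    unfolding cdf_def
  proof (intro measure_mono_fmeasurable fmeasurableD sublevel_fmeasurable subsetI)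
    fix t assume "t \<in> {t\<in>{0..1}. b t \<le> a - (7 / 8) ^ n}"
    moreover from this have "b t < a" using rate_bounds(12)[of n] by (simp only: mem_Collect_eq) linarith
    ultimately show "t \<in> {t\<in>{0..1}. b t < a}" by simp
  qed
  ultimately show "cdf a \<le> measure lborel {t\<in>{0..1}. b t < a}"
    by (intro LIMSEQ_le_const2) auto
qed

lemma occupation_ball:
  assumes e: "0 < e"
  shows "(LBINT t:{0..1}. indicator {x. \<bar>x - a\<bar> < e} (b t)) = cdf (a + e) - cdf (a - e)"
proof -
  let ?U = "{t\<in>{0..1}. \<bar>b t - a\<bar> < e}"
  have U: "?U = {t\<in>{0..1}. b t < a + e} - {t\<in>{0..1}. b t \<le> a - e}" by auto
  have Us: "?U \<in> sets lborel" unfolding U by (intro sets.Diff fmeasurableD sublevel_fmeasurable)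
  have "(LBINT t:{0..1}. indicator {x. \<bar>x - a\<bar> < e} (b t)) = (LBINT t. indicator ?U t)"
    unfolding set_lebesgue_integral_def by (intro Bochner_Integration.integral_cong) (auto simp: indicator_def)
  also have "\<dots> = measure lborel ?U" using Us by simp
  also have "\<dots> = measure lborel {t\<in>{0..1}. b t < a + e} - measure lborel {t\<in>{0..1}. b t \<le> a - e}"
    unfolding U
  proof (rule measure_Diff)
    show "emeasure lborel {t\<in>{0..1}. b t < a + e} \<noteq> \<infinity>"
      unfolding infinity_ennreal_def by (rule fmeasurableD2[OF sublevel_fmeasurable(2)])
    show "{t\<in>{0..1}. b t < a + e} \<in> sets lborel" "{t\<in>{0..1}. b t \<le> a - e} \<in> sets lborel"
      by (intro fmeasurableD sublevel_fmeasurable)+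
  qed (use e in auto)
  finally show ?thesis unfolding measure_less cdf_def .
qed

text \<open>The symmetric occupation average is the mean of the forward and backward difference
  quotients of \<open>cdf\<close>. Rational levels suffice by continuity, and being countable they
  cost only one null set.\<close>

lemma local_time_unique:
  assumes l: "continuous_on UNIV l"
    and lim: "\<And>a. a \<in> \<rat> \<Longrightarrow> ((\<lambda>e. 1 / (2 * e) * (LBINT t:{0..1}. indicator {x. \<bar>x - a\<bar> < e} (b t))) \<longlongrightarrow> l a) (at_right 0)"
  shows "l = L"
proof -
  have "l a = L a" if a: "a \<in> \<rat>" for a
  proof (rule tendsto_unique[OF _ lim[OF a]])
    have d: "((\<lambda>h. (cdf (a + h) - cdf a) / h) \<longlongrightarrow> L a) (at 0)"
      using cdf_derivative[of a] by (simp add: DERIV_def)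
    have p: "((\<lambda>h. (cdf (a + h) - cdf a) / h) \<longlongrightarrow> L a) (at_right 0)"
      by (rule tendsto_mono[OF at_le[OF subset_UNIV] d])
    have "filterlim (\<lambda>h::real. - h) (at 0) (at_right 0)"
      by (rule filterlim_atI) (auto intro!: tendsto_eq_intros simp: eventually_at_filter)
    from filterlim_compose[OF d this]
    have m: "((\<lambda>h. (cdf (a - h) - cdf a) / - h) \<longlongrightarrow> L a) (at_right 0)" by simp
    let ?q = "\<lambda>h. ((cdf (a + h) - cdf a) / h + (cdf (a - h) - cdf a) / - h) / 2"
    have "(?q \<longlongrightarrow> (L a + L a) / 2) (at_right 0)"
      by (intro tendsto_divide tendsto_add p m tendsto_const) simp
    then have "(?q \<longlongrightarrow> L a) (at_right 0)" by simp
    then show "((\<lambda>e. 1 / (2 * e) * (LBINT t:{0..1}. indicator {x. \<bar>x - a\<bar> < e} (b t))) \<longlongrightarrow> L a) (at_right 0)"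
    proof (rule Lim_transform_eventually)
      show "\<forall>\<^sub>F h in at_right 0. ?q h
          = 1 / (2 * h) * (LBINT t:{0..1}. indicator {x. \<bar>x - a\<bar> < h} (b t))"
        using eventually_at_right_less[of 0]
      proof eventually_elim
        case (elim h)
        then show ?case unfolding occupation_ball[OF elim] by (simp add: field_simps)
      qed
    qed
  qed simp
  then have "\<And>a. a \<in> \<rat> \<Longrightarrow> l a - L a = 0" by simp
  moreover have "closure \<rat> = (UNIV :: real set)" by (rule Rats_closure_real)
  moreover have "continuous_on (closure \<rat>) (\<lambda>a. l a - L a)"
    using l L_continuous by (intro continuous_intros continuous_on_subset[OF l]) auto
  ultimately have "\<And>a. l a - L a = 0"
    using continuous_constant_on_closure[of "\<rat>" "\<lambda>a. l a - L a" 0] by (metis UNIV_I)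
  then show ?thesis by (intro ext) simp
qed

lemma occupation_cdf_L: "occupation_cdf L a = cdf a"
proof (cases "a \<le> - R")
  case True
  have "(LBINT y:{..a}. L y) = (LBINT y:{..a}. (if y = - R then L y else 0))"
    using True L_outside by (intro set_lebesgue_integral_cong) force+
  also have "\<dots> = 0"
    unfolding set_lebesgue_integral_def
    by (intro integral_eq_zero_AE AE_mp[OF AE_lborel_singleton[of "- R"] AE_I2]) auto
  finally show ?thesis using cdf_below[OF True] by (simp add: occupation_cdf_def)
next
  case False
  have "(LBINT y:{..a}. L y) = (LBINT y:{- R..a}. L y)"
    unfolding set_lebesgue_integral_def
    by (intro Bochner_Integration.integral_cong refl) (use L_outside in \<open>auto simp: indicator_def\<close>)
  also have "\<dots> = integral {- R..a} L"
    by (intro set_borel_integral_eq_integral borel_integrable_atLeastAtMost' L_continuous)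
  also have "\<dots> = cdf a - cdf (- R)"
    using False by (intro integral_unique L_has_integral) simp
  finally show ?thesis using cdf_below[of "- R"] by (simp add: occupation_cdf_def)
qed

end

section \<open>Convergence of the quantile transforms\<close>

context embedded_walks
begin

definition lo :: real where "lo = Inf (b ` {0..1})"

definition hi :: real where "hi = Sup (b ` {0..1})"

lemma lo_hi_range: "t \<in> {0..1} \<Longrightarrow> lo \<le> b t \<and> b t \<le> hi"
  and lo_attained: "\<exists>t\<in>{0..1}. b t = lo" and hi_attained: "\<exists>t\<in>{0..1}. b t = hi"
proof -
  have c: "continuous_on {0..1} b" by (rule continuous_on_subset[OF cont]) simp
  obtain u where u: "u \<in> {0..1}" "\<And>t. t \<in> {0..1} \<Longrightarrow> b u \<le> b t"
    using continuous_attains_inf[OF _ _ c] by auto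
  obtain v where v: "v \<in> {0..1}" "\<And>t. t \<in> {0..1} \<Longrightarrow> b t \<le> b v"
    using continuous_attains_sup[OF _ _ c] by auto
  have "lo = b u" unfolding lo_def using u by (intro cInf_eq_minimum) auto
  moreover have "hi = b v" unfolding hi_def using v by (intro cSup_eq_maximum) auto
  ultimately show "t \<in> {0..1} \<Longrightarrow> lo \<le> b t \<and> b t \<le> hi" "\<exists>t\<in>{0..1}. b t = lo" "\<exists>t\<in>{0..1}. b t = hi"
    using u v by auto
qed

lemma lo_le_hi: "lo \<le> hi"
  using lo_hi_range[of 0] by auto

lemma lo_hi_R: "- R < lo" "hi < R"
  using lo_attained hi_attained R_bound by fastforce+

lemma cdf_hi: "hi \<le> a \<Longrightarrow> cdf a = 1"
proof -
  assume "hi \<le> a"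
  then have "{t\<in>{0..1}. b t \<le> a} = {0..1}" using lo_hi_range by fastforce
  then show ?thesis by (simp add: cdf_def)
qed

lemma cdf_lo: "a \<le> lo \<Longrightarrow> cdf a = 0"
proof -
  assume "a \<le> lo"
  then have "{t\<in>{0..1}. b t < a} = {}" using lo_hi_range by fastforce
  then show ?thesis by (simp only: measure_less[symmetric] measure_empty)
qed

text \<open>The path takes the value midway between \<open>x\<close> and \<open>y\<close>, and by
  continuity it stays between them for a time interval of positive length.\<close>

lemma cdf_strict:
  assumes "lo \<le> x" "x < y" "y \<le> hi"
  shows "cdf x < cdf y"
proof -
  obtain u v where uv: "u \<in> {0..1}" "b u = lo" "v \<in> {0..1}" "b v = hi"
    using lo_attained hi_attained by blast
  define z where "z = (x + y) / 2"
  have "z \<in> {b u..b v}" using assms uv by (simp add: z_def)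
  moreover have "connected (b ` {0..1})"
    by (intro connected_continuous_image continuous_on_subset[OF cont]) auto
  then have "{b u..b v} \<subseteq> b ` {0..1}"
    using uv(1,3) by (intro connected_contains_Icc) auto
  ultimately obtain t where t: "t \<in> {0..1}" "b t = z" by auto
  obtain d where d: "0 < d" "\<And>t'. \<bar>t' - t\<bar> < d \<Longrightarrow> \<bar>b t' - b t\<bar> < (y - x) / 2"
    using cont[unfolded continuous_on_iff, rule_format, of t "(y - x) / 2"] assms(2)
    by (auto simp: dist_real_def)
  define I where "I = {max 0 (t - d / 2)..min 1 (t + d / 2)}"
  have I: "0 < measure lborel I" using t d(1) unfolding I_def by (auto simp: min_def max_def)
  have If: "I \<in> fmeasurable lborel" unfolding I_def by (rule fmeasurable_intervals)
  have mem: "x < b t' \<and> b t' \<le> y \<and> t' \<in> {0..1}" if "t' \<in> I" for t'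
  proof -
    have "\<bar>t' - t\<bar> < d" using that d(1) unfolding I_def by (auto simp: abs_less_iff)
    then have "\<bar>b t' - b t\<bar> < (y - x) / 2" by (rule d(2))
    then have "\<bar>b t' - (x + y) / 2\<bar> < (y - x) / 2" unfolding t(2) z_def .
    then have "x < b t'" "b t' \<le> y" by (auto simp: abs_less_iff field_simps)
    then show ?thesis using that unfolding I_def by auto
  qed
  have "cdf x + measure lborel I = measure lborel ({t\<in>{0..1}. b t \<le> x} \<union> I)"
    unfolding cdf_def
  proof (rule measure_Un3[OF sublevel_fmeasurable(1) If, THEN trans, symmetric])
    have "{t\<in>{0..1}. b t \<le> x} \<inter> I = {}" using mem by fastforce
    then show "measure lborel {t\<in>{0..1}. b t \<le> x} + measure lborel I - measure lborel ({t\<in>{0..1}. b t \<le> x} \<inter> I)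
      = measure lborel {t\<in>{0..1}. b t \<le> x} + measure lborel I"
      by (simp only: measure_empty diff_zero)
  qed
  also have "\<dots> \<le> cdf y"
    unfolding cdf_def
  proof (rule measure_mono_fmeasurable)
    show "{t\<in>{0..1}. b t \<le> x} \<union> I \<subseteq> {t\<in>{0..1}. b t \<le> y}" using mem assms(2) by force
    show "{t\<in>{0..1}. b t \<le> x} \<union> I \<in> sets lborel"
      using fmeasurableD[OF sublevel_fmeasurable(1)] fmeasurableD[OF If] by (rule sets.Un)
  qed (rule sublevel_fmeasurable(1))
  finally show ?thesis using I by simp
qed

section \<open>The quantile level as an inverse, and convergence\<close>

abbreviation WQ :: "nat \<Rightarrow> nat \<Rightarrow> real" where
  "WQ n \<equiv> walk_quantile_transform (embedded_walk b n) (4 ^ n)"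

definition A :: "real \<Rightarrow> real" where "A = quantile_level b L"

text \<open>On the range of the path \<open>cdf\<close> is a bijection onto the unit interval and
  \<open>A\<close> is its inverse. At \<open>t = 1\<close> no level has larger mass, so there the
  separate clause for the maximum is used.\<close>

lemma cdf_A:
  assumes t: "t \<in> {0..1}"
  shows "A t \<in> {lo..hi}" "cdf (A t) = t"
proof -
  have "A t \<in> {lo..hi} \<and> cdf (A t) = t"
  proof (cases "t < 1")
    case True
    have "\<exists>x\<ge>lo. x \<le> hi \<and> cdf x = t"
      using t cdf_lo[of lo] cdf_hi[of hi] lo_le_hi by (intro IVT' cdf_continuous) auto
    then obtain x where x: "lo \<le> x" "x \<le> hi" "cdf x = t" by blast
    have "{a. occupation_cdf L a > t} = {x<..}"
      unfolding occupation_cdf_L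
    proof (intro set_eqI iffI)
      fix a assume "a \<in> {a. cdf a > t}"
      then show "a \<in> {x<..}" using cdf_mono[of a x] x by (auto simp: not_le[symmetric])
    next
      fix a assume a: "a \<in> {x<..}"
      show "a \<in> {a. cdf a > t}"
      proof (cases "a \<le> hi")
        case True
        then show ?thesis using cdf_strict[of x a] a x by auto
      next
        case False
        then show ?thesis using cdf_hi[of a] \<open>t < 1\<close> by auto
      qed
    qed
    then have "A t = x" using True by (simp add: A_def quantile_level_def)
    then show ?thesis using x by simp
  next
    case False
    then have "t = 1" "A t = hi" using t by (auto simp: A_def quantile_level_def hi_def)
    then show ?thesis using cdf_hi[of hi] lo_le_hi by simp
  qed
  then show "A t \<in> {lo..hi}" "cdf (A t) = t" by auto
qed

lemma cdf_inj: "x \<in> {lo..hi} \<Longrightarrow> y \<in> {lo..hi} \<Longrightarrow> cdf x = cdf y \<Longrightarrow> x = y"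
  using cdf_strict[of x y] cdf_strict[of y x] by (cases x y rule: linorder_cases) auto

lemma cdf_range: "cdf x \<in> {0..1}"
proof -
  have "cdf x \<le> cdf (max R x)" "cdf (min (- R) x) \<le> cdf x" by (intro cdf_mono; simp)+
  then show ?thesis using cdf_above[of "max R x"] cdf_below[of "min (- R) x"] by simp
qed

lemma A_cdf: "x \<in> {lo..hi} \<Longrightarrow> A (cdf x) = x"
  by (rule cdf_inj) (use cdf_A[OF cdf_range[of x]] in auto)

lemma A_continuous: "continuous_on {0..1} A"
proof -
  have "continuous_on (cdf ` {lo..hi}) A"
    by (rule continuous_on_inv[OF cdf_continuous]) (auto simp: A_cdf)
  moreover have "{0..1} \<subseteq> cdf ` {lo..hi}"
    using cdf_A by force
  ultimately show ?thesis by (rule continuous_on_subset)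
qed

text \<open>The walk may leave the range of the path slightly. Clipping \<open>a\<close> to that
  range does not change \<open>cdf a\<close>, and uniform continuity of \<open>A\<close> does the
  rest.\<close>

lemma A_close:
  assumes e: "0 < e"
  obtains d where "0 < d" "\<And>a t. t \<in> {0..1} \<Longrightarrow> lo - d < a \<Longrightarrow> a < hi + d \<Longrightarrow> \<bar>cdf a - t\<bar> < d \<Longrightarrow> \<bar>a - A t\<bar> < e"
proof -
  have "uniformly_continuous_on {0..1} A"
    by (rule compact_uniformly_continuous[OF A_continuous]) simp
  then obtain d where d: "0 < d" "\<And>t t'. t \<in> {0..1} \<Longrightarrow> t' \<in> {0..1} \<Longrightarrow> \<bar>t' - t\<bar> < d \<Longrightarrow> \<bar>A t' - A t\<bar> < e / 2"
    using e unfolding uniformly_continuous_on_def dist_real_def by (metis half_gt_zero)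
  show thesis
  proof (rule that[of "min d (e / 2)"])
    show "0 < min d (e / 2)" using d e by simp
    fix a t assume t: "t \<in> {0..1}" and a: "lo - min d (e / 2) < a" "a < hi + min d (e / 2)"
      and c: "\<bar>cdf a - t\<bar> < min d (e / 2)"
    define a' where "a' = max lo (min a hi)"
    have "lo - e / 2 < a" "a < hi + e / 2" using a by linarith+
    then have a': "a' \<in> {lo..hi}" "\<bar>a - a'\<bar> < e / 2" using lo_le_hi e by (auto simp: a'_def max_def min_def)
    have "cdf a' = cdf a" using lo_le_hi by (auto simp: a'_def max_def min_def cdf_lo cdf_hi)
    then have "\<bar>A (cdf a') - A t\<bar> < e / 2" using c t d(2)[of t "cdf a'"] cdf_range by simp
    then show "\<bar>a - A t\<bar> < e" using a'(2) unfolding A_cdf[OF a'(1)] by linarith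
  qed
qed

text \<open>The positive part of \<open>x - c\<close> is \<open>x - min c x\<close>; this is the
  form in which Tanaka's formula for the walk delivers the drift.\<close>

lemma quantile_transform_min:
  "quantile_transform b L t = L (A t) / 2 + (min (b 1) (A t) - min 0 (A t))"
  unfolding quantile_transform_def A_def[symmetric] by (auto simp: max_def min_def)

text \<open>The level \<open>s n j\<close> is the one reached at rank \<open>k\<close>. The partial
  and full level martingales there are negligible, and the rank is known up to the visits to that
  single level, at most \<open>2 ^ n * P n\<close> of \<open>4 ^ n\<close>.\<close>

lemma walk_quantile_approx:
  assumes n: "good n" and k: "k \<in> {1..4 ^ n}"
  obtains j where "j < 4 ^ n"
    "\<bar>1 / 2 ^ n * WQ n k
      - (loc n (s n j) / 2 + (min (s n (4 ^ n)) (s n j) - min 0 (s n j)))\<bar> \<le> eps n"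
    "\<bar>walk_cdf n (s n j) - real k / 4 ^ n\<bar> \<le> P n / 2 ^ n"
proof -
  define w where "w = embedded_walk b n"
  define q where "q = quantile_perm w (4 ^ n) k"
  define j where "j = q - 1"
  define v where "v = w j"
  define a where "a = s n j"
  have w: "w i = 2 ^ n * s n i" for i by (simp add: w_def embedded_walk_def)
  have q: "q \<in> {1..4 ^ n}" unfolding q_def by (rule quantile_perm_initial(1)[OF k])
  have j: "j < 4 ^ n" using q by (auto simp: j_def)
  have va: "v = 2 ^ n * a" by (simp add: v_def a_def w)
  have cmp: "w i < v \<longleftrightarrow> s n i < a" "w i = v \<longleftrightarrow> s n i = a" for i by (auto simp: va w)
  obtain z :: int where z: "a = of_int z / 2 ^ n" using embedding_integer unfolding a_def by blast
  have floor: "of_int \<lfloor>a * 2 ^ n\<rfloor> / 2 ^ n = a" by (simp add: z)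
  have loc: "loc n a = occ n a" unfolding loc_def floor ..
  let ?S1 = "\<Sum>i<4 ^ n. if s n i < a then s n (Suc i) - s n i else 0"
  let ?S2 = "level_sum (s n) q a" and ?S3 = "level_sum (s n) (4 ^ n) a"
  have "WQ n k =
      (\<Sum>i<4 ^ n. if w i < v then w (Suc i) - w i else 0) + level_sum w q v"
    using quantile_perm_initial(3)[OF k, of w] unfolding v_def j_def q_def w_def .
  also have "\<dots> = 2 ^ n * ?S1 + 2 ^ n * ?S2"
    unfolding level_sum_def sum_distrib_left cmp by (intro arg_cong2[where f = "(+)"] sum.cong) (auto simp: w right_diff_distrib)
  finally have WQ: "1 / 2 ^ n * WQ n k = ?S1 + ?S2"
    by (simp add: distrib_left[symmetric])
  have S1: "?S1 = occ n a / 2 - ?S3 / 2 + min (s n (4 ^ n)) a - min 0 a"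
    using lattice_walk.discrete_tanaka_min[OF lattice, of a z n "4 ^ n"] z unfolding visits_occ by simp
  have "\<bar>?S2\<bar> \<le> 9 * (15 / 16) ^ n * P n" "\<bar>?S3\<bar> \<le> 9 * (15 / 16) ^ n * P n"
    unfolding z using q by (auto intro!: level_walk_bound[OF n])
  moreover have "0 \<le> (15 / 16) ^ n * P n" using P_ge(1)[of n] by simp
  ultimately have "\<bar>?S2 - ?S3 / 2\<bar> \<le> eps n" unfolding eps_def mult.assoc by linarith
  then have 1: "\<bar>1 / 2 ^ n * WQ n k - (loc n a / 2 + (min (s n (4 ^ n)) a - min 0 a))\<bar> \<le> eps n"
    unfolding WQ S1 loc by (simp add: algebra_simps)
  let ?C1 = "\<Sum>i<4 ^ n. if s n i < a then 1 else (0::real)"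
  let ?C2 = "\<Sum>i<q. if s n i = a then 1 else (0::real)"
  let ?C3 = "\<Sum>i<4 ^ n. if s n i = a then 1 else (0::real)"
  have "k = card {i. i < 4 ^ n \<and> w i < v} + card {i. i < q \<and> w i = v}"
    using quantile_perm_initial(2)[OF k, of w] unfolding q_def[symmetric] j_def[symmetric] v_def[symmetric] .
  then have "real k = ?C1 + ?C2" unfolding cmp by (simp add: card_less_Collect)
  moreover have "?C1 + ?C3 = 4 ^ n * walk_cdf n a"
    unfolding walk_cdf_def sum.distrib[symmetric] by (auto intro!: sum.cong)
  moreover have "0 \<le> ?C2" by (intro sum_nonneg) auto
  moreover have "?C2 \<le> ?C3" using q by (intro sum_mono2) auto
  moreover have "?C3 = 2 ^ n * occ n a" by (simp add: occ_def)
  moreover have "2 ^ n * occ n a \<le> 2 ^ n * P n" by (intro mult_left_mono occ_le[OF n]) simp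
  ultimately have "\<bar>4 ^ n * walk_cdf n a - real k\<bar> \<le> 2 ^ n * P n" by linarith
  moreover have "(4::real) ^ n = 2 ^ n * 2 ^ n" by (simp add: power_mult_distrib[symmetric])
  moreover have "walk_cdf n a - real k / 4 ^ n = (4 ^ n * walk_cdf n a - real k) / 4 ^ n" by (simp add: diff_divide_distrib)
  ultimately have 2: "\<bar>walk_cdf n a - real k / 4 ^ n\<bar> \<le> P n / 2 ^ n"
    by (simp add: abs_divide pos_divide_le_eq mult.commute[of "P n"])
  show thesis using that[OF j] 1 2 unfolding a_def w_def by blast
qed

text \<open>Rank 0 has no associated step, so times before \<open>1 / 4 ^ n\<close> are treated with
  rank 1 at the cost of one step.\<close>

lemma walk_quantile_0_1: "\<bar>WQ n 0 - WQ n 1\<bar> \<le> 1"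
proof -
  define q where "q = quantile_perm (embedded_walk b n) (4 ^ n) 1"
  have "q \<in> {1..4 ^ n}" unfolding q_def by (rule quantile_perm_initial(1)) simp
  then obtain j where "q = Suc j" by (cases q) auto
  then have j: "quantile_perm (embedded_walk b n) (4 ^ n) (Suc 0) = Suc j" by (simp add: q_def)
  have "s n (Suc j) - s n j \<in> {1 / 2 ^ n, - (1 / 2 ^ n)}" by (rule embedding_step)
  then have "2 ^ n * (s n (Suc j) - s n j) \<in> {1, - 1}" by auto
  then show ?thesis
    unfolding walk_quantile_transform_def by (auto simp: j embedded_walk_def right_diff_distrib)
qed

lemma floor_index:
  fixes n :: nat and t :: real
  assumes "t \<in> {0..1}"
  defines "k \<equiv> max 1 (nat \<lfloor>4 ^ n * t\<rfloor>)"
  shows "k \<in> {1..4 ^ n}" "\<bar>real k / 4 ^ n - t\<bar> \<le> 1 / 4 ^ n"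
    "\<bar>WQ n (nat \<lfloor>4 ^ n * t\<rfloor>) - WQ n k\<bar> \<le> 1"
proof -
  let ?y = "4 ^ n * t"
  have y: "0 \<le> ?y" "?y \<le> 4 ^ n" using assms(1) by (auto simp: mult_left_le)
  have "\<lfloor>?y\<rfloor> \<le> 4 ^ n" using order_trans[OF of_int_floor_le y(2)]
    by (simp only: of_int_le_iff[symmetric, where 'a = real] of_int_power of_int_numeral)
  then have "nat \<lfloor>?y\<rfloor> \<le> 4 ^ n" by (simp add: nat_le_iff)
  then show "k \<in> {1..4 ^ n}" by (auto simp: k_def)
  have "real (nat \<lfloor>?y\<rfloor>) = of_int \<lfloor>?y\<rfloor>" using y(1) by simp
  then have "\<bar>real k - ?y\<bar> \<le> 1" using y unfolding k_def by (auto simp: max_def abs_le_iff of_nat_le_iff) linarith+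
  moreover have "real k / 4 ^ n - t = (real k - ?y) / 4 ^ n" by (simp add: diff_divide_distrib)
  ultimately show "\<bar>real k / 4 ^ n - t\<bar> \<le> 1 / 4 ^ n" by (simp add: abs_divide divide_right_mono)
  show "\<bar>WQ n (nat \<lfloor>?y\<rfloor>) - WQ n k\<bar> \<le> 1"
  proof (cases "nat \<lfloor>?y\<rfloor> = 0")
    case True
    then show ?thesis using walk_quantile_0_1[of n] by (simp add: k_def)
  next
    case False
    then have "1 \<le> nat \<lfloor>?y\<rfloor>" by linarith
    then have "k = nat \<lfloor>?y\<rfloor>" by (simp only: k_def max_absorb2)
    then show ?thesis by simp
  qed
qed

lemma near_endpoint:
  assumes e: "0 < e"
  shows "\<forall>\<^sub>F n in sequentially. \<bar>s n (4 ^ n) - b 1\<bar> < e \<and> (\<forall>j<4 ^ n. lo - e < s n j \<and> s n j < hi + e)"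
proof -
  obtain d where d: "0 < d" "\<And>t. \<bar>t - 1\<bar> < d \<Longrightarrow> \<bar>b t - b 1\<bar> < e"
    using cont[unfolded continuous_on_iff, rule_format, of 1 e] e by (auto simp: dist_real_def)
  have "(\<lambda>n. (3 / 4 :: real) ^ n) \<longlonglongrightarrow> 0" by (rule LIMSEQ_power_zero) simp
  then have "\<forall>\<^sub>F n in sequentially. (3 / 4 :: real) ^ n < d" using d(1) by (intro order_tendstoD) auto
  then show ?thesis using eventually_good
  proof eventually_elim
    case (elim n)
    have T: "\<bar>T n (4 ^ n) - 1\<bar> < d" using good_total[OF elim(2)] elim(1) by simp
    have "lo - e < s n j \<and> s n j < hi + e" if j: "j < 4 ^ n" for j
    proof (cases "T n j \<le> 1")
      case True
      then show ?thesis using lo_hi_range[of "T n j"] embedding_time_nonneg[of n j] e by auto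
    next
      case False
      then have "\<bar>T n j - 1\<bar> < d" using T embedding_time_mono[of j "4 ^ n" n] j by auto
      then have "\<bar>s n j - b 1\<bar> < e" by (rule d(2))
      then show ?thesis using lo_hi_range[of 1] by auto
    qed
    then show ?case using d(2)[OF T] by blast
  qed
qed

lemma quantile_convergence:
  "uniform_limit {0..1} (rescaled_walk_quantile_transform b) (quantile_transform b L) sequentially"
proof (rule uniform_limitI)
  fix e :: real assume e: "0 < e"
  \<comment> \<open>Six errors arise, each below \<open>e'\<close>, and the two local time errors
    enter with factor one half; 8 leaves room.\<close>
  define e' where "e' = e / 8"
  have e': "0 < e'" using e by (simp add: e'_def)
  have "uniformly_continuous_on {- R - 1..R + 1} L"
    by (rule compact_uniformly_continuous[OF L_continuous]) simp
  then obtain c where c: "0 < c" "\<And>x y. x \<in> {- R - 1..R + 1} \<Longrightarrow> y \<in> {- R - 1..R + 1} \<Longrightarrow> \<bar>y - x\<bar> < c \<Longrightarrow> \<bar>L y - L x\<bar> < e'"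
    using e' unfolding uniformly_continuous_on_def dist_real_def by metis
  define c' where "c' = min c e'"
  have c': "0 < c'" using c e' by (simp add: c'_def)
  obtain d where d: "0 < d"
    "\<And>a t. t \<in> {0..1} \<Longrightarrow> lo - d < a \<Longrightarrow> a < hi + d \<Longrightarrow> \<bar>cdf a - t\<bar> < d \<Longrightarrow> \<bar>a - A t\<bar> < c'"
    using A_close[OF c'] by metis
  define d' where "d' = min d e'"
  have d': "0 < d'" using d e' by (simp add: d'_def)
  have ev: "\<forall>\<^sub>F n in sequentially. eps n < min e' d"
    using e' d(1) by (intro order_tendstoD(2)[OF eps_tendsto]) simp
  have "(\<lambda>n. (1 / 2 :: real) ^ n) \<longlonglongrightarrow> 0" by (rule LIMSEQ_power_zero) simp
  then have "\<forall>\<^sub>F n in sequentially. (1 / 2 :: real) ^ n < e'" using e' by (intro order_tendstoD) auto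
  then show "\<forall>\<^sub>F n in sequentially. \<forall>t\<in>{0..1}. dist (rescaled_walk_quantile_transform b n t) (quantile_transform b L t) < e"
    using ev eventually_good near_endpoint[OF d'] loc_uniform[OF e']
  proof eventually_elim
    case (elim n)
    note n = elim(3) and rb = rate_bounds[of n] and P = P_ge[of n]
    have small: "P n / 2 ^ n + 1 / 4 ^ n + 5 * (3 / 4) ^ n * P n \<le> eps n"
    proof -
      have r: "(3 / 4 :: real) ^ n \<le> (15 / 16) ^ n" using rb by linarith
      have "P n / 2 ^ n = 1 / 2 ^ n * P n" by simp
      also have "\<dots> \<le> (3 / 4) ^ n * P n" using P(1) by (intro mult_right_mono power_bounds(1)) simp
      finally have 1: "P n / 2 ^ n \<le> (3 / 4) ^ n * P n" .
      have "1 / 4 ^ n = (1 / 4 :: real) ^ n" by (simp add: power_one_over)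
      also have "\<dots> \<le> (3 / 4) ^ n" by (intro power_mono) auto
      also have "\<dots> \<le> (3 / 4) ^ n * P n" using P(1) by simp
      finally have 2: "1 / 4 ^ n \<le> (3 / 4) ^ n * P n" .
      have 3: "(3 / 4) ^ n * P n \<le> (15 / 16) ^ n * P n" using r P(1) by (intro mult_right_mono) auto
      have 4: "0 \<le> (15 / 16) ^ n * P n" using P(1) by simp
      show ?thesis using 1 2 3 4 unfolding eps_def mult.assoc by linarith
    qed
    show ?case
    proof
      fix t :: real assume t: "t \<in> {0..1}"
      define k where "k = max 1 (nat \<lfloor>4 ^ n * t\<rfloor>)"
      note k = floor_index[OF t, of n, folded k_def]
      obtain j where j: "j < 4 ^ n"
        and j1: "\<bar>1 / 2 ^ n * WQ n k
          - (loc n (s n j) / 2 + (min (s n (4 ^ n)) (s n j) - min 0 (s n j)))\<bar> \<le> eps n"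
        and j2: "\<bar>walk_cdf n (s n j) - real k / 4 ^ n\<bar> \<le> P n / 2 ^ n"
        using walk_quantile_approx[OF n k(1)] by metis
      define a where "a = s n j"
      have "\<bar>cdf a - t\<bar> \<le> P n / 2 ^ n + 1 / 4 ^ n + 5 * (3 / 4) ^ n * P n"
        using walk_cdf_cdf[OF n, of a] j2 k(2) unfolding a_def by linarith
      then have "\<bar>cdf a - t\<bar> < d" using small elim(2) by simp
      moreover have "lo - d < a" "a < hi + d" using elim(4) j unfolding a_def d'_def by auto
      ultimately have aA: "\<bar>a - A t\<bar> < c'" by (intro d(2) t) auto
      have "A t \<in> {lo..hi}" by (rule cdf_A(1)[OF t])
      then have "A t \<in> {- R - 1..R + 1}" using lo_hi_R by auto
      moreover have "a \<in> {- R - 1..R + 1}" using good_range[OF n, of j] j unfolding a_def by (auto simp: abs_less_iff)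
      ultimately have La: "\<bar>L a - L (A t)\<bar> < e'" using aA by (intro c(2)) (auto simp: c'_def)
      have loc: "\<bar>loc n a - L a\<bar> < e'" using elim(5) by blast
      have end1: "\<bar>s n (4 ^ n) - b 1\<bar> < e'" using elim(4) unfolding d'_def by auto
      have aA': "\<bar>a - A t\<bar> < e'" using aA unfolding c'_def by simp
      have mm: "\<bar>min p a - min q (A t)\<bar> \<le> max \<bar>p - q\<bar> \<bar>a - A t\<bar>" for p q :: real by (auto simp: min_def max_def)
      have m1: "\<bar>min (s n (4 ^ n)) a - min (b 1) (A t)\<bar> < e'" 
        by (rule le_less_trans[OF mm]) (simp only: max_less_iff_conj end1 aA' simp_thms)
      have m2: "\<bar>min 0 a - min 0 (A t)\<bar> < e'" 
        by (rule le_less_trans[OF mm]) (simp only: max_less_iff_conj aA' e' diff_self abs_zero simp_thms)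
      have "\<bar>1 / 2 ^ n * WQ n (nat \<lfloor>4 ^ n * t\<rfloor>)
        - 1 / 2 ^ n * WQ n k\<bar> \<le> 1 / 2 ^ n * 1"
        unfolding right_diff_distrib[symmetric] abs_mult by (intro mult_mono k(3)) auto
      then have r1: "\<bar>rescaled_walk_quantile_transform b n t
        - 1 / 2 ^ n * WQ n k\<bar> < e'"
        using elim(1) unfolding rescaled_walk_quantile_transform_def by (simp add: power_one_over)
      have j1': "\<bar>1 / 2 ^ n * WQ n k
          - (loc n a / 2 + (min (s n (4 ^ n)) a - min 0 a))\<bar> < e'"
        using j1 elim(2) unfolding a_def by simp
      have "e = 8 * e'" by (simp add: e'_def)
      then have "\<bar>rescaled_walk_quantile_transform b n t - quantile_transform b L t\<bar> < e"
        using r1 j1' loc La m1 m2 e' unfolding quantile_transform_min abs_less_iff by linarith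
      then show "dist (rescaled_walk_quantile_transform b n t) (quantile_transform b L t) < e"
        by (simp add: dist_real_def)
    qed
  qed
qed

end

lemma rescaled_walk_quantile_transform_cong:
  assumes "unbounded_path b'" "\<And>t. 0 \<le> t \<Longrightarrow> b t = b' t"
  shows "rescaled_walk_quantile_transform b n t = rescaled_walk_quantile_transform b' n t"
proof -
  have nn: "0 \<le> embedding_time b' n j" for j by (rule unbounded_path.embedding_time_nonneg[OF assms(1)])
  have "embedding_time b n j = embedding_time b' n j" for j
    using embedding_time_cong[of b b'] assms(2) nn by blast
  then have "embedded_walk b n = embedded_walk b' n"
    using assms(2)[OF nn] by (simp add: embedded_walk_def fun_eq_iff)
  then show ?thesis by (simp add: rescaled_walk_quantile_transform_def)
qed

lemma quantile_transform_cong: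
  assumes "\<And>t. 0 \<le> t \<Longrightarrow> b t = b' t"
  shows "quantile_transform b l t = quantile_transform b' l t"
proof -
  have "b ` {0..1} = b' ` {0..1}" using assms by (intro image_cong) auto
  then have "quantile_level b l t = quantile_level b' l t" by (simp add: quantile_level_def)
  then show ?thesis using assms[of 1] by (simp add: quantile_transform_def)
qed

theorem theorem8p16:
  fixes M :: "'a measure"
    and B l :: "real \<Rightarrow> 'a \<Rightarrow> real"
  assumes "standard_brownian_motion M B"
    and "continuous_local_time M B l"
  shows "AE \<omega> in M.
    uniform_limit {0..1}
      (\<lambda>n t. rescaled_walk_quantile_transform (\<lambda>s. B s \<omega>) n t)
      (\<lambda>t. quantile_transform (\<lambda>s. B s \<omega>) (\<lambda>a. l a \<omega>) t)
      sequentially"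
proof -
  obtain W where "continuous_bm M W" and WB: "AE \<omega> in M. \<forall>t\<ge>0. W t \<omega> = B t \<omega>"
    using continuous_modification[OF assms(1)] by blast
  interpret continuous_bm M W by fact
  have l_cont: "AE \<omega> in M. continuous_on UNIV (\<lambda>a. l a \<omega>)"
    using assms(2) by (simp add: continuous_local_time_def)
  let ?avg = "\<lambda>\<omega> a e. 1 / (2 * e) * (LBINT s:{0..1}. indicator {x. \<bar>x - a\<bar> < e} (B s \<omega>))"
  \<comment> \<open>Restricting to rational levels merges the exceptional sets of the separate
    levels into one null set.\<close>
  have "AE \<omega> in M. \<forall>a\<in>\<rat>. (?avg \<omega> a \<longlongrightarrow> l a \<omega>) (at_right 0)"
    using assms(2) by (simp add: continuous_local_time_def AE_ball_countable countable_rat)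
  with AE_walk_bounds WB l_cont show ?thesis
  proof eventually_elim
    case (elim \<omega>)
    define b where "b = (\<lambda>t. W t \<omega>)"
    have path: "unbounded_path b" unfolding b_def by (rule W_path)
    have bB: "B t \<omega> = b t" if "0 \<le> t" for t using elim(2) that by (simp add: b_def)
    have "compact (b ` {0..2})"
      by (intro compact_continuous_image continuous_on_subset[OF unbounded_path.cont[OF path]]) auto
    then obtain R where R: "\<And>t. t \<in> {0..2} \<Longrightarrow> \<bar>b t\<bar> < R"
      using compact_imp_bounded[THEN bounded_pos_less[THEN iffD1]] by (metis imageI real_norm_def)
    interpret embedded_walks b R
      using path elim(1) R by (auto simp: embedded_walks_def embedded_walks_axioms_def b_def)
    \<comment> \<open>The paths of \<open>B\<close> and \<open>W\<close> agree only at nonnegative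
      times, the only ones that the occupation average and both transforms consult.\<close>
    have "(LBINT s:{0..1}. indicator {x. \<bar>x - a\<bar> < e} (B s \<omega>))
        = (LBINT s:{0..1}. indicator {x. \<bar>x - a\<bar> < e} (b s) :: real)" for a e
      by (intro set_lebesgue_integral_cong) (auto simp: bB)
    then have "(\<lambda>a. l a \<omega>) = L"
      using elim(3,4) by (intro local_time_unique) auto
    then show ?case
      using quantile_convergence
      by (simp add: rescaled_walk_quantile_transform_cong[OF path bB] quantile_transform_cong[OF bB])
  qed
qed


end
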